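(* Let $\alpha=[a_0;a_1,a_2,\dots]$ be an irrational number such that $\sum_n\frac1{\log a_n}<\infty$ (the sum being taken over all sufficiently large $n$; in particular $a_n\ge2$ for all large $n$). Then any reparametrized linear flow (in the sense of the context) with angle $\alpha$ and stopping points $\mathbf p$ and $\mathbf q$ lying on the same orbit of the linear flow has a unique physical measure; this measure attracts Lebesgue almost every point (i.e. its basin has full $\lambda^2$-measure) and it is equal to $\mu_\infty$.
   Context: $[a_0;a_1,a_2,\dots]$ is the continued fraction expansion. Let $\mathbb T^2=\mathbb R^2/\mathbb Z^2$, and let $\lambda^2$ be Lebesgue (Haar) measure on $\mathbb T^2$. A reparametrized linear flow with angle $\alpha$ and stopping points at $\mathbf p$ and $\mathbf q$ is the flow $\phi^t$ on $\mathbb T^2$ generated by a vector field $X=\varphi X_0$ such that: $X_0=(1,\alpha)$ with $\alpha\in\mathbb R$ irrational; $\varphi:\mathbb T^2\to[0,\infty)$ is of class $C^3$; $\varphi$ vanishes at two distinct points $\mathbf p,\mathbf q$ and is positive elsewhere; the Hessians $D^2\varphi(\mathbf p)$ and $D^2\varphi(\mathbf q)$ are positive definite. The points $\mathbf p,\mathbf q$ lie on the same orbit if $\mathbf q=\mathbf p+r(1,\alpha)\bmod\mathbb Z^2$ for some $r\in\mathbb R$. Put $d_{\mathbf p}=\det D^2\varphi(\mathbf p)$, $d_{\mathbf q}=\det D^2\varphi(\mathbf q)$ and $$\mu_\infty=\frac{\sqrt{d_{\mathbf q}}}{\sqrt{d_{\mathbf p}}+\sqrt{d_{\mathbf q}}}\delta_{\mathbf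 p}+\frac{\sqrt{d_{\mathbf p}}}{\sqrt{d_{\mathbf p}}+\sqrt{d_{\mathbf q}}}\delta_{\mathbf q}.$$ For $\mathbf x\in\mathbb T^2$ and $t>0$ the empirical measure $\mu^t_{\mathbf x}$ is the Borel probability with $\int f\,d\mu^t_{\mathbf x}=\frac1t\int_0^t f(\phi^s(\mathbf x))\,ds$ for continuous $f$, and $p\omega(\mathbf x)=\bigcap_{T>0}\overline{\{\mu^t_{\mathbf x}:t\ge T\}}$ (weak-* closure). The basin of a probability measure $\mu$ is $\{\mathbf x:p\omega(\mathbf x)=\{\mu\}\}$, and $\mu$ is physical if its basin has positive $\lambda^2$-measure. *)

theory Defs
  imports "HOL-Probability.Probability"
begin

section \<open>The torus\<close>

definition int_congruent :: "real^2 \<Rightarrow> real^2 \<Rightarrow> bool" where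
  "int_congruent x y \<longleftrightarrow> (\<forall>i. x $ i - y $ i \<in> \<int>)"

lemma equivp_int_congruent: "equivp int_congruent"
proof (rule equivpI)
  show "reflp int_congruent"
    by (auto simp: reflp_def int_congruent_def)
  show "symp int_congruent"
    unfolding symp_def int_congruent_def by (metis Ints_minus minus_diff_eq)
  show "transp int_congruent"
    unfolding transp_def int_congruent_def
  proof (intro allI impI)
    fix x y z :: "real^2" and i
    assume "\<forall>i. x $ i - y $ i \<in> \<int>" "\<forall>i. y $ i - z $ i \<in> \<int>"
    then have "(x $ i - y $ i) + (y $ i - z $ i) \<in> \<int>"
      by (intro Ints_add) auto
    then show "x $ i - z $ i \<in> \<int>" by simp
  qed
qed

text \<open>The canonical projection from the plane to the torus is \<open>abs_torus\<close>.\<close>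

quotient_type torus = "real^2" / int_congruent
  by (rule equivp_int_congruent)

lemma abs_torus_eq_iff: "abs_torus x = abs_torus y \<longleftrightarrow> (\<forall>i. x $ i - y $ i \<in> \<int>)"
  by (simp add: torus.abs_eq_iff int_congruent_def)

lemma abs_rep_torus [simp]: "abs_torus (rep_torus p) = p"
  by (rule Quotient_abs_rep[OF Quotient_torus])

instantiation torus :: ab_group_add
begin

lift_definition zero_torus :: torus is "0 :: real^2" .

lift_definition plus_torus :: "torus \<Rightarrow> torus \<Rightarrow> torus" is "(+)"
  unfolding int_congruent_def by (metis Ints_add add_diff_add vector_add_component)

lift_definition uminus_torus :: "torus \<Rightarrow> torus" is uminus
  unfolding int_congruent_def
  by (metis Ints_minus minus_diff_minus vector_uminus_component)

definition minus_torus :: "torus \<Rightarrow> torus \<Rightarrow> torus" where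
  "minus_torus x y = x + (- y)"

instance
  by standard (unfold minus_torus_def, (transfer, simp add: int_congruent_def)+)

end

text \<open>The quotient topology.\<close>

instantiation torus :: topological_space
begin

definition open_torus :: "torus set \<Rightarrow> bool" where
  "open_torus U \<longleftrightarrow> open (abs_torus -` U)"

instance
  by standard (auto simp: open_torus_def vimage_Union)

end

lemma continuous_on_abs_torus [continuous_intros]: "continuous_on A abs_torus"
  by (rule continuous_on_subset[of UNIV])
    (auto simp: continuous_on_open_vimage open_torus_def)

definition torus_lebesgue :: "torus measure" where
  "torus_lebesgue =
     distr (restrict_space lborel {z :: real^2. \<forall>i. 0 \<le> z $ i \<and> z $ i < 1}) borel abs_torus"

section \<open>Functions of class $C^k$ and Hessians\<close>

primrec C_k :: "nat \<Rightarrow> ('a::real_normed_vector \<Rightarrow> 'b::real_normed_vector) \<Rightarrow> bool" where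
  "C_k 0 f \<longleftrightarrow> continuous_on UNIV f"
| "C_k (Suc k) f \<longleftrightarrow>
     (\<forall>x. f differentiable (at x)) \<and> (\<forall>v. C_k k (\<lambda>x. frechet_derivative f (at x) v))"

definition torus_C_k :: "nat \<Rightarrow> (torus \<Rightarrow> real) \<Rightarrow> bool" where
  "torus_C_k k f \<longleftrightarrow> C_k k (\<lambda>z. f (abs_torus z))"

definition partial_deriv :: "2 \<Rightarrow> (real^2 \<Rightarrow> real) \<Rightarrow> real^2 \<Rightarrow> real" where
  "partial_deriv i f z = frechet_derivative f (at z) (axis i 1)"

definition hessian :: "(real^2 \<Rightarrow> real) \<Rightarrow> real^2 \<Rightarrow> real^2^2" where
  "hessian f z = (\<chi> i j. partial_deriv i (partial_deriv j f) z)"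

text \<open>The choice of the representative is irrelevant, see \<open>torus_hessian_abs\<close> below.\<close>

definition torus_hessian :: "(torus \<Rightarrow> real) \<Rightarrow> torus \<Rightarrow> real^2^2" where
  "torus_hessian f p = hessian (\<lambda>z. f (abs_torus z)) (rep_torus p)"

definition positive_definite :: "real^'n^'n \<Rightarrow> bool" where
  "positive_definite A \<longleftrightarrow> (\<forall>v. v \<noteq> 0 \<longrightarrow> v \<bullet> (A *v v) > 0)"

lemma has_derivative_shift_iff:
  fixes f :: "'a::real_normed_vector \<Rightarrow> 'b::real_normed_vector"
  shows "(f has_derivative D) (at (x + c)) \<longleftrightarrow> ((\<lambda>y. f (y + c)) has_derivative D) (at x)"
proof
  assume "(f has_derivative D) (at (x + c))"
  then show "((\<lambda>y. f (y + c)) has_derivative D) (at x)"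
    by (rule has_derivative_compose[of "\<lambda>y. y + c" "\<lambda>h. h", rotated])
      (auto intro!: derivative_eq_intros)
next
  assume "((\<lambda>y. f (y + c)) has_derivative D) (at x)"
  then have "((\<lambda>y. f (y + c)) has_derivative D) (at ((x + c) - c))" by simp
  moreover have "((\<lambda>y. y - c) has_derivative (\<lambda>h. h)) (at (x + c))"
    by (auto intro!: derivative_eq_intros)
  ultimately have "((\<lambda>y. f (y - c + c)) has_derivative (\<lambda>h. D h)) (at (x + c))"
    by (rule has_derivative_compose[rotated])
  then show "(f has_derivative D) (at (x + c))" by simp
qed

lemma partial_deriv_periodic:
  assumes "\<And>y. f (y + c) = f y"
  shows "partial_deriv i f (z + c) = partial_deriv i f z"
  using assms by (simp add: partial_deriv_def frechet_derivative_def has_derivative_shift_iff)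

lemma torus_hessian_abs: "torus_hessian f (abs_torus z) = hessian (\<lambda>z. f (abs_torus z)) z"
proof -
  define c where "c = rep_torus (abs_torus z) - z"
  have "abs_torus (z + c) = abs_torus z" by (simp add: c_def)
  then have c: "c $ i \<in> \<int>" for i by (simp add: abs_torus_eq_iff)
  have "f (abs_torus (y + c)) = f (abs_torus y)" for y
    using c by (intro arg_cong[of _ _ f]) (simp add: abs_torus_eq_iff)
  then have "hessian (\<lambda>z. f (abs_torus z)) (z + c) = hessian (\<lambda>z. f (abs_torus z)) z"
    by (simp add: hessian_def partial_deriv_periodic)
  then show ?thesis by (simp add: torus_hessian_def c_def)
qed

section \<open>Continued fractions\<close>

fun cfrac_convergent :: "(nat \<Rightarrow> int) \<Rightarrow> nat \<Rightarrow> real" where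
  "cfrac_convergent a 0 = of_int (a 0)"
| "cfrac_convergent a (Suc n) = of_int (a 0) + 1 / cfrac_convergent (\<lambda>k. a (Suc k)) n"

definition is_cfrac_expansion :: "(nat \<Rightarrow> int) \<Rightarrow> real \<Rightarrow> bool" where
  "is_cfrac_expansion a \<alpha> \<longleftrightarrow> (\<forall>n\<ge>1. a n \<ge> 1) \<and> cfrac_convergent a \<longlonglongrightarrow> \<alpha>"

section \<open>Reparametrized linear flows\<close>

text \<open>Tangent vectors of the torus are identified with vectors of the plane, so derivatives of
  curves in the torus are those of their lifts.\<close>

definition is_integral_curve :: "(torus \<Rightarrow> real^2) \<Rightarrow> (real \<Rightarrow> torus) \<Rightarrow> bool" where
  "is_integral_curve X c \<longleftrightarrow>
     (\<exists>\<gamma>. \<forall>t. c t = abs_torus (\<gamma> t) \<and> (\<gamma> has_vector_derivative X (c t)) (at t))"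

text \<open>For a Lipschitz vector field this determines \<open>\<Phi>\<close> uniquely, and \<open>\<Phi>\<close> is then a continuous
  action of the reals.\<close>

definition is_flow_of :: "(torus \<Rightarrow> real^2) \<Rightarrow> (real \<Rightarrow> torus \<Rightarrow> torus) \<Rightarrow> bool" where
  "is_flow_of X \<Phi> \<longleftrightarrow> (\<forall>x. \<Phi> 0 x = x \<and> is_integral_curve X (\<lambda>t. \<Phi> t x))"

definition linear_field :: "real \<Rightarrow> real^2" where
  "linear_field \<alpha> = vector [1, \<alpha>]"

definition reparametrized_linear_flow ::
  "real \<Rightarrow> torus \<Rightarrow> torus \<Rightarrow> (torus \<Rightarrow> real) \<Rightarrow> (real \<Rightarrow> torus \<Rightarrow> torus) \<Rightarrow> bool" where
  "reparametrized_linear_flow \<alpha> p q \<phi> \<Phi> \<longleftrightarrow>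
     \<alpha> \<notin> \<rat> \<and> p \<noteq> q \<and>
     torus_C_k 3 \<phi> \<and>
     \<phi> p = 0 \<and> \<phi> q = 0 \<and> (\<forall>x. x \<noteq> p \<and> x \<noteq> q \<longrightarrow> \<phi> x > 0) \<and>
     positive_definite (torus_hessian \<phi> p) \<and> positive_definite (torus_hessian \<phi> q) \<and>
     is_flow_of (\<lambda>x. \<phi> x *\<^sub>R linear_field \<alpha>) \<Phi>"

definition same_linear_orbit :: "real \<Rightarrow> torus \<Rightarrow> torus \<Rightarrow> bool" where
  "same_linear_orbit \<alpha> p q \<longleftrightarrow> (\<exists>r. q = p + abs_torus (r *\<^sub>R linear_field \<alpha>))"

section \<open>Physical measures\<close>

definition borel_prob_measures :: "'a::topological_space measure set" where
  "borel_prob_measures = {\<mu>. prob_space \<mu> \<and> sets \<mu> = sets borel}"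

text \<open>The weak-* topology: the coarsest one for which integration of every continuous function
  is continuous.\<close>

definition weak_star_topology :: "torus measure topology" where
  "weak_star_topology = topology_generated_by
     {{\<mu> \<in> borel_prob_measures. (\<integral>x. f x \<partial>\<mu>) \<in> U} | (f :: torus \<Rightarrow> real) U.
        continuous_on UNIV f \<and> open U}"

text \<open>The image of the normalized Lebesgue measure on \<open>[0, t]\<close> under the orbit map; the lemmas
  \<open>empirical_measure_in\<close> and \<open>integral_empirical_measure\<close> below show that it is the Borel
  probability given by time averages.\<close>

definition empirical_measure :: "(real \<Rightarrow> torus \<Rightarrow> torus) \<Rightarrow> real \<Rightarrow> torus \<Rightarrow> torus measure" where
  "empirical_measure \<Phi> t x = distr (uniform_measure lborel {0..t}) borel (\<lambda>s. \<Phi> s x)"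

definition p_omega :: "(real \<Rightarrow> torus \<Rightarrow> torus) \<Rightarrow> torus \<Rightarrow> torus measure set" where
  "p_omega \<Phi> x = (\<Inter>T\<in>{0<..}. weak_star_topology closure_of {empirical_measure \<Phi> t x | t. t \<ge> T})"

definition basin :: "(real \<Rightarrow> torus \<Rightarrow> torus) \<Rightarrow> torus measure \<Rightarrow> torus set" where
  "basin \<Phi> \<mu> = {x. p_omega \<Phi> x = {\<mu>}}"

definition physical_measure :: "(real \<Rightarrow> torus \<Rightarrow> torus) \<Rightarrow> torus measure \<Rightarrow> bool" where
  "physical_measure \<Phi> \<mu> \<longleftrightarrow>
     \<mu> \<in> borel_prob_measures \<and> emeasure torus_lebesgue (basin \<Phi> \<mu>) > 0"

definition two_point_measure :: "real \<Rightarrow> 'a::topological_space \<Rightarrow> real \<Rightarrow> 'a \<Rightarrow> 'a measure" where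
  "two_point_measure a p b q = measure_of UNIV (sets borel)
     (\<lambda>A. ennreal a * emeasure (return borel p) A + ennreal b * emeasure (return borel q) A)"

definition mu_infinity :: "(torus \<Rightarrow> real) \<Rightarrow> torus \<Rightarrow> torus \<Rightarrow> torus measure" where
  "mu_infinity \<phi> p q =
     (let d\<^sub>p = det (torus_hessian \<phi> p); d\<^sub>q = det (torus_hessian \<phi> q) in
      two_point_measure (sqrt d\<^sub>q / (sqrt d\<^sub>p + sqrt d\<^sub>q)) p (sqrt d\<^sub>p / (sqrt d\<^sub>p + sqrt d\<^sub>q)) q)"

section \<open>Basic properties\<close>

lemma prob_space_torus_lebesgue: "prob_space torus_lebesgue"
proof -
  let ?D = "{z :: real^2. \<forall>i. 0 \<le> z $ i \<and> z $ i < 1}"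
  have D: "?D \<in> sets borel" by measurable
  have "emeasure lborel ?D = 1"
  proof -
    have "emeasure lborel (box 0 (1::real^2)) \<le> emeasure lborel ?D"
      by (intro emeasure_mono) (auto simp: mem_box_cart less_imp_le D)
    moreover have "emeasure lborel ?D \<le> emeasure lborel (cbox 0 (1::real^2))"
      by (intro emeasure_mono) (auto simp: mem_box_cart less_imp_le)
    moreover have "(1::real^2) \<bullet> b = 1" if "b \<in> Basis" for b
      using that by (auto simp: Basis_vec_def inner_axis)
    ultimately show ?thesis
      by (auto simp: emeasure_lborel_box_eq emeasure_lborel_cbox_eq intro: antisym)
  qed
  moreover have "abs_torus \<in> borel_measurable (restrict_space lborel ?D)"
    by (intro measurable_restrict_space1)
      (simp add: borel_measurable_continuous_onI continuous_on_abs_torus)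
  ultimately show ?thesis
    unfolding torus_lebesgue_def
    by (intro prob_space.prob_space_distr prob_spaceI)
      (auto simp: emeasure_restrict_space space_restrict_space D)
qed

lemma topspace_weak_star: "topspace weak_star_topology = borel_prob_measures"
proof -
  have "borel_prob_measures \<in> {{\<mu> \<in> borel_prob_measures. (\<integral>x. f x \<partial>\<mu>) \<in> U} | (f :: torus \<Rightarrow> real) U.
        continuous_on UNIV f \<and> open U}"
    by (rule CollectI, rule exI[of _ "\<lambda>_. 0"], rule exI[of _ UNIV]) auto
  then show ?thesis
    unfolding weak_star_topology_def topology_generated_by_topspace by blast
qed

lemma continuous_is_integral_curve:
  assumes "is_integral_curve X c"
  shows "continuous_on UNIV c"
proof -
  from assms obtain \<gamma> where \<gamma>: "\<And>t. c t = abs_torus (\<gamma> t)"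
    "\<And>t. (\<gamma> has_vector_derivative X (c t)) (at t)"
    unfolding is_integral_curve_def by blast
  have "continuous_on UNIV \<gamma>"
    by (intro continuous_at_imp_continuous_on ballI has_vector_derivative_continuous[OF \<gamma>(2)])
  then have "continuous_on UNIV (\<lambda>t. abs_torus (\<gamma> t))"
    by (rule continuous_on_compose2[OF continuous_on_abs_torus[of UNIV]]) auto
  then show ?thesis using \<gamma>(1) by (simp cong: continuous_on_cong)
qed

lemma empirical_measure_in:
  assumes "continuous_on UNIV (\<lambda>s. \<Phi> s x)" "t > 0"
  shows "empirical_measure \<Phi> t x \<in> borel_prob_measures"
proof -
  have "(\<lambda>s. \<Phi> s x) \<in> borel_measurable (uniform_measure lborel {0..t})"
    using borel_measurable_continuous_onI[OF assms(1)] by simp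
  with assms(2) show ?thesis
    unfolding empirical_measure_def borel_prob_measures_def
    by (auto intro!: prob_space.prob_space_distr prob_space_uniform_measure)
qed

lemma integral_empirical_measure:
  fixes f :: "torus \<Rightarrow> real"
  assumes orbit: "continuous_on UNIV (\<lambda>s. \<Phi> s x)" and f: "continuous_on UNIV f" and t: "t > 0"
  shows "(\<integral>y. f y \<partial>empirical_measure \<Phi> t x) = (1 / t) * integral {0..t} (\<lambda>s. f (\<Phi> s x))"
proof -
  have m: "(\<lambda>s. \<Phi> s x) \<in> borel_measurable borel"
    by (rule borel_measurable_continuous_onI[OF orbit])
  have fm: "f \<in> borel_measurable borel"
    by (rule borel_measurable_continuous_onI[OF f])
  have c: "continuous_on UNIV (\<lambda>s. f (\<Phi> s x))"
    by (rule continuous_on_compose2[OF f orbit]) auto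
  have "(\<integral>y. f y \<partial>empirical_measure \<Phi> t x) = (\<integral>s. f (\<Phi> s x) \<partial>uniform_measure lborel {0..t})"
    unfolding empirical_measure_def using m fm by (intro integral_distr) auto
  also have "uniform_measure lborel {0..t} = density lborel (\<lambda>s. ennreal (indicator {0..t} s / t))"
    unfolding uniform_measure_def using t
    by (intro density_cong) (auto simp: indicator_def divide_ennreal simp flip: ennreal_1)
  also have "(\<integral>s. f (\<Phi> s x) \<partial>\<dots>) = (\<integral>s. (1 / t) * (indicator {0..t} s *\<^sub>R f (\<Phi> s x)) \<partial>lborel)"
    using t m fm by (subst integral_density) (auto simp: mult_ac)
  also have "\<dots> = (1 / t) * (LINT s:{0..t}|lborel. f (\<Phi> s x))"
    by (simp add: set_lebesgue_integral_def)
  also have "(LINT s:{0..t}|lborel. f (\<Phi> s x)) = integral {0..t} (\<lambda>s. f (\<Phi> s x))"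
    by (intro set_borel_integral_eq_integral borel_integrable_atLeastAtMost'
        continuous_on_subset[OF c]) auto
  finally show ?thesis .
qed

lemma sets_two_point_measure: "sets (two_point_measure a p b q) = sets borel"
  unfolding two_point_measure_def using sets.sigma_sets_eq[of borel] by simp

lemma emeasure_two_point_measure:
  assumes "A \<in> sets borel"
  shows "emeasure (two_point_measure a p b q) A =
    ennreal a * indicator A p + ennreal b * indicator A q"
proof -
  let ?\<mu> = "\<lambda>A. ennreal a * emeasure (return borel p) A + ennreal b * emeasure (return borel q) A"
  have "countably_additive (sets borel) ?\<mu>"
    unfolding countably_additive_def
  proof (intro allI impI)
    fix A :: "nat \<Rightarrow> 'a set"
    assume A: "range A \<subseteq> sets borel" "disjoint_family A"
    then have "(\<Sum>i. emeasure (return borel x) (A i)) = emeasure (return borel x) (\<Union>(range A))" for x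
      by (intro suminf_emeasure) auto
    then show "(\<Sum>i. ?\<mu> (A i)) = ?\<mu> (\<Union>(range A))"
      by (simp add: suminf_add[symmetric])
  qed
  moreover have "positive (sets borel) ?\<mu>" by (simp add: positive_def)
  ultimately have "emeasure (two_point_measure a p b q) A = ?\<mu> A"
    by (intro emeasure_measure_of[OF two_point_measure_def])
      (auto simp: assms sets_two_point_measure)
  then show ?thesis using assms by simp
qed

end

theory Submission
  imports Defs
begin

text \<open>When an orbit of the linear flow passes near a stopping point with transverse offset \<open>y\<close>,
  the reparametrized flow needs time \<open>2 * pi / (sqrt D * \<bar>y\<bar>)\<close> up to a smaller error, where \<open>D\<close> is
  the determinant of the Hessian. Since \<open>p\<close> and \<open>q\<close> lie on the same orbit, the passages near \<open>p\<close> and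
  near \<open>q\<close> come in pairs with the same offset, so apart from boundedly many passages at both ends
  of an orbit segment the two times are proportional to the same sum
  \<open>S n = (\<Sum>j<n. 1 / dist (y + j * \<alpha>, \<int>))\<close>. This sum grows faster than \<open>n\<close>, so the time spent elsewhere
  is negligible, and the passages at the ends are negligible if \<open>S (n + 1) / S n \<longlongrightarrow> 1\<close>.

  This last property holds for almost every \<open>y\<close>. Let \<open>q\<^sub>k\<close> be the denominators of the convergents,
  \<open>\<eta> = 1 / q\<^sub>k\<^sub>+\<^sub>1\<close> and \<open>d = dist (y + n * \<alpha>, \<int>)\<close>. The points \<open>y + (n - l * q\<^sub>k) * \<alpha>\<close> give
  \<open>S n \<ge> (\<Sum>l=1..n div q\<^sub>k. 1 / (d + l * \<eta>))\<close>, so for \<open>m * q\<^sub>k \<le> n < m * q\<^sub>k\<^sub>+\<^sub>1\<close> with \<open>m\<close> large the product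
  \<open>d * S n\<close> can only be small if \<open>d < \<eta>\<close> and \<open>n < sqrt a\<^sub>k\<^sub>+\<^sub>1 * q\<^sub>k\<close>, or if \<open>d < C * \<eta> / ln a\<^sub>k\<^sub>+\<^sub>1\<close>.
  Both events have probability \<open>O (1 / ln a\<^sub>k\<^sub>+\<^sub>1)\<close>, and Borel-Cantelli applies.

  For every point, all limits of the empirical measures are carried by \<open>{p, q}\<close>. Hence a single
  time average decides whether a point belongs to the basin, which is therefore a Borel set.\<close>

section \<open>Continued fractions\<close>

text \<open>What can go wrong is that the last term of \<open>S n\<close> outweighs all earlier
  ones: the time average may then depend on whether the orbit has already passed both stopping
  points or only one. Because \<open>S (n + 1) / S n = 1 + 1 / (d * S n)\<close>, excluding this
  means that \<open>d * S n\<close> tends to infinity. The logarithms in the hypothesis are harmonic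
  sums: for \<open>d \<le> \<eta>\<close> the terms \<open>1 / (d + l * \<eta>)\<close> with
  \<open>l \<le> M\<close> add up to about \<open>ln M / \<eta>\<close>. To separate the two
  singularities of \<open>1 / \<phi>\<close>, a continuous cutoff \<open>\<psi>\<close>, equal to 1
  near \<open>p\<close> and to 0 near \<open>q\<close>, splits it into
  \<open>\<psi> / \<phi>\<close> and \<open>(1 - \<psi>) / \<phi>\<close>. Times are handled as
  primitives of these functions along a line, in the time of the linear flow. That the limits are
  carried by the two points for every orbit rests on the superlinear growth of \<open>S n\<close>,
  which needs no genericity; orbits that run into a stopping point converge and are treated
  directly. The almost sure part concerns the transverse offset alone and is carried over to the
  plane as a null set of lines.\<close>

lemma cfrac_convergent_ge_one:
  assumes "\<And>n. a n \<ge> 1"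
  shows "cfrac_convergent a n \<ge> 1"
  using assms
proof (induction n arbitrary: a)
  case 0
  then show ?case by simp
next
  case (Suc n)
  from Suc.IH[of "\<lambda>k. a (Suc k)"] Suc.prems
  have "1 / cfrac_convergent (\<lambda>k. a (Suc k)) n \<ge> 0" by force
  moreover have "of_int (a 0) \<ge> (1::real)" using Suc.prems[of 0] by simp
  ultimately show ?case unfolding cfrac_convergent.simps by linarith
qed

text \<open>The recursion for the convergents can be solved for those of the tail, and the limit may
  be taken because the irrational \<open>\<alpha>\<close> differs from \<open>a 0\<close>.\<close>

lemma cfrac_expansion_step:
  assumes "is_cfrac_expansion a \<alpha>" "\<alpha> \<notin> \<rat>"
  defines "\<beta> \<equiv> 1 / (\<alpha> - of_int (a 0))"
  shows "is_cfrac_expansion (\<lambda>k. a (Suc k)) \<beta>" and "\<beta> \<notin> \<rat>" and "\<beta> \<ge> 1"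
proof -
  have ne: "\<alpha> \<noteq> of_int (a 0)" using assms(2) by auto
  have lim: "cfrac_convergent a \<longlonglongrightarrow> \<alpha>" and pos: "\<And>n. a (Suc n) \<ge> 1"
    using assms(1) by (auto simp: is_cfrac_expansion_def)
  have "(\<lambda>n. 1 / (cfrac_convergent a (Suc n) - of_int (a 0))) \<longlonglongrightarrow> \<beta>"
    unfolding \<beta>_def using ne by (intro tendsto_intros LIMSEQ_Suc[OF lim]) auto
  then have lim': "cfrac_convergent (\<lambda>k. a (Suc k)) \<longlonglongrightarrow> \<beta>" by simp
  then show "is_cfrac_expansion (\<lambda>k. a (Suc k)) \<beta>"
    using pos by (auto simp: is_cfrac_expansion_def)
  show "\<beta> \<ge> 1"
    by (rule LIMSEQ_le_const[OF lim']) (use cfrac_convergent_ge_one[of "\<lambda>k. a (Suc k)"] pos in auto)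
  show "\<beta> \<notin> \<rat>"
  proof
    assume "\<beta> \<in> \<rat>"
    then have "1 / \<beta> + of_int (a 0) \<in> \<rat>" by (intro Rats_add Rats_divide) auto
    moreover have "1 / \<beta> + of_int (a 0) = \<alpha>" using ne by (simp add: \<beta>_def)
    ultimately show False using assms(2) by simp
  qed
qed

fun complete_quotient :: "(nat \<Rightarrow> int) \<Rightarrow> real \<Rightarrow> nat \<Rightarrow> real" where
  "complete_quotient a \<alpha> 0 = \<alpha>"
| "complete_quotient a \<alpha> (Suc n) = 1 / (complete_quotient a \<alpha> n - of_int (a n))"

lemma complete_quotient_expansion:
  assumes "is_cfrac_expansion a \<alpha>" "\<alpha> \<notin> \<rat>"
  shows "is_cfrac_expansion (\<lambda>k. a (k + n)) (complete_quotient a \<alpha> n) \<and> complete_quotient a \<alpha> n \<notin> \<rat>"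
proof (induction n)
  case (Suc n)
  then show ?case
    using cfrac_expansion_step[of "\<lambda>k. a (k + n)" "complete_quotient a \<alpha> n"] by simp
qed (use assms in auto)

lemma complete_quotient_bounds:
  assumes "is_cfrac_expansion a \<alpha>" "\<alpha> \<notin> \<rat>"
  shows "complete_quotient a \<alpha> (Suc n) > of_int (a (Suc n))"
    and "complete_quotient a \<alpha> n = of_int (a n) + 1 / complete_quotient a \<alpha> (Suc n)"
proof -
  have ge: "complete_quotient a \<alpha> (Suc k) \<ge> 1" for k
    using cfrac_expansion_step(3)[of "\<lambda>i. a (i + k)" "complete_quotient a \<alpha> k"]
      complete_quotient_expansion[OF assms, of k] by simp
  have eq: "complete_quotient a \<alpha> k = of_int (a k) + 1 / complete_quotient a \<alpha> (Suc k)" for k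
  proof -
    have "complete_quotient a \<alpha> k \<noteq> of_int (a k)"
      using complete_quotient_expansion[OF assms, of k] by auto
    then show ?thesis by simp
  qed
  show "complete_quotient a \<alpha> n = of_int (a n) + 1 / complete_quotient a \<alpha> (Suc n)"
    by (rule eq)
  have "1 / complete_quotient a \<alpha> (Suc (Suc n)) > 0"
    using ge[of "Suc n"] by (simp only: zero_less_divide_1_iff)
  with eq[of "Suc n"] show "complete_quotient a \<alpha> (Suc n) > of_int (a (Suc n))" by linarith
qed

text \<open>Numerators and denominators come from the classical recurrence. Their link to
  \<open>\<alpha>\<close> is made in \<open>cfrac_error\<close> through the complete quotients, not
  through \<open>cfrac_convergent\<close>.\<close>

fun cfrac_numerator :: "(nat \<Rightarrow> int) \<Rightarrow> nat \<Rightarrow> int" where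
  "cfrac_numerator a 0 = a 0"
| "cfrac_numerator a (Suc 0) = a 1 * a 0 + 1"
| "cfrac_numerator a (Suc (Suc n)) = a (Suc (Suc n)) * cfrac_numerator a (Suc n) + cfrac_numerator a n"

fun cfrac_denominator :: "(nat \<Rightarrow> int) \<Rightarrow> nat \<Rightarrow> int" where
  "cfrac_denominator a 0 = 1"
| "cfrac_denominator a (Suc 0) = a 1"
| "cfrac_denominator a (Suc (Suc n)) =
     a (Suc (Suc n)) * cfrac_denominator a (Suc n) + cfrac_denominator a n"

lemma cfrac_denominator_pos:
  assumes "\<And>n. n \<ge> 1 \<Longrightarrow> a n \<ge> 1"
  shows "cfrac_denominator a n > 0"
proof (induction n rule: induct_nat_012)
  case (ge2 n)
  have "a (Suc (Suc n)) * cfrac_denominator a (Suc n) > 0"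
    using assms[of "Suc (Suc n)"] ge2 by (intro mult_pos_pos) auto
  then show ?case using ge2 by simp
qed (use assms[of 1] in auto)

lemma cfrac_denominator_Suc_ge:
  assumes "\<And>n. n \<ge> 1 \<Longrightarrow> a n \<ge> 1"
  shows "cfrac_denominator a (Suc n) \<ge> a (Suc n) * cfrac_denominator a n"
  by (cases n) (auto intro: less_imp_le cfrac_denominator_pos[OF assms])

lemma cfrac_determinant:
  "cfrac_numerator a (Suc n) * cfrac_denominator a n -
     cfrac_numerator a n * cfrac_denominator a (Suc n) = (-1) ^ n"
proof (induction n)
  case (Suc n)
  then show ?case by (simp add: algebra_simps)
qed simp

lemma cfrac_coprime: "coprime (cfrac_numerator a n) (cfrac_denominator a n)"
proof (rule coprimeI)
  fix c assume "c dvd cfrac_numerator a n" "c dvd cfrac_denominator a n"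
  then have "c dvd cfrac_numerator a (Suc n) * cfrac_denominator a n -
     cfrac_numerator a n * cfrac_denominator a (Suc n)" by simp
  then have "c dvd (-1) ^ n" by (simp only: cfrac_determinant)
  then show "is_unit c" by (rule dvd_trans) simp
qed

text \<open>The errors \<open>D\<close> obey the same recurrence as the denominators. In the
  induction step the partial quotient minus the complete quotient is minus the reciprocal of the
  next complete quotient.\<close>

lemma cfrac_error:
  assumes "is_cfrac_expansion a \<alpha>" "\<alpha> \<notin> \<rat>"
  defines "D \<equiv> \<lambda>n. of_int (cfrac_denominator a n) * \<alpha> - of_int (cfrac_numerator a n)"
  shows "D n = - complete_quotient a \<alpha> (Suc (Suc n)) * D (Suc n)"
proof -
  note b = complete_quotient_bounds[OF assms(1,2)]
  have pos: "complete_quotient a \<alpha> (Suc k) > 0" for k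
    using b(1)[of k] assms(1) unfolding is_cfrac_expansion_def
    by (metis of_int_0_less_iff less_trans int_one_le_iff_zero_less le_add1 plus_1_eq_Suc)
  show ?thesis
  proof (induction n)
    case 0
    have "complete_quotient a \<alpha> 1 * (\<alpha> - a 0) = 1"
      using b(2)[of 0] pos[of 0] by simp
    moreover have "complete_quotient a \<alpha> 1 = a 1 + 1 / complete_quotient a \<alpha> (Suc 1)"
      using b(2)[of 1] by simp
    ultimately have "(a 1 + 1 / complete_quotient a \<alpha> (Suc 1)) * (\<alpha> - a 0) = 1"
      by simp
    then show ?case
      using pos[of 1] by (simp add: D_def field_simps del: complete_quotient.simps)
  next
    case (Suc n)
    have "D (Suc (Suc n)) = a (Suc (Suc n)) * D (Suc n) + D n"
      by (simp add: D_def algebra_simps)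
    also have "\<dots> = (a (Suc (Suc n)) - complete_quotient a \<alpha> (Suc (Suc n))) * D (Suc n)"
      by (simp only: Suc.IH) (simp add: algebra_simps del: complete_quotient.simps)
    also have "\<dots> = - (1 / complete_quotient a \<alpha> (Suc (Suc (Suc n)))) * D (Suc n)"
      using b(2)[of "Suc (Suc n)"] by simp
    finally show ?case
      using pos[of "Suc (Suc n)"] by (simp del: complete_quotient.simps)
  qed
qed

text \<open>Eliminating \<open>D (Suc n)\<close> from the determinant identity by
  \<open>cfrac_error\<close> leaves \<open>(q (Suc n) + q n / c) * \<bar>D n\<bar> = 1\<close> with
  \<open>c > 0\<close>.\<close>

lemma cfrac_approximation:
  assumes "is_cfrac_expansion a \<alpha>" "\<alpha> \<notin> \<rat>"
  shows "\<bar>of_int (cfrac_denominator a n) * \<alpha> - of_int (cfrac_numerator a n)\<bar>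
    \<le> 1 / of_int (cfrac_denominator a (Suc n))"
proof -
  define q where "q n = real_of_int (cfrac_denominator a n)" for n
  define p where "p n = real_of_int (cfrac_numerator a n)" for n
  define D where "D n = q n * \<alpha> - p n" for n
  define c where "c = complete_quotient a \<alpha> (Suc (Suc n))"
  have a: "\<And>n. n \<ge> 1 \<Longrightarrow> a n \<ge> 1" using assms(1) by (simp add: is_cfrac_expansion_def)
  have q: "q k > 0" for k using cfrac_denominator_pos[OF a] by (simp add: q_def)
  have step: "D n = - c * D (Suc n)"
    using cfrac_error[OF assms] by (simp add: D_def p_def q_def c_def del: complete_quotient.simps)
  have c: "c > 0"
    using complete_quotient_bounds(1)[OF assms, of "Suc n"] a[of "Suc (Suc n)"] 
    unfolding c_def by linarith
  have "q (Suc n) * D n - q n * D (Suc n) = p (Suc n) * q n - p n * q (Suc n)"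
    by (simp add: D_def algebra_simps)
  also have "\<dots> = of_int ((-1) ^ n)"
    unfolding p_def q_def cfrac_determinant[of a n, symmetric]
    by (simp only: of_int_diff of_int_mult)
  finally have "q (Suc n) * D n - q n * D (Suc n) = (-1) ^ n" by simp
  moreover have "D (Suc n) = - D n / c" using step c by (simp add: field_simps)
  ultimately have "(q (Suc n) + q n / c) * D n = (-1) ^ n" by (simp add: field_simps)
  then have "\<bar>(q (Suc n) + q n / c) * D n\<bar> = 1" by simp
  then have "(q (Suc n) + q n / c) * \<bar>D n\<bar> = 1"
    using q[of n] q[of "Suc n"] c by (simp add: abs_mult add_nonneg_nonneg)
  moreover have "q (Suc n) * \<bar>D n\<bar> \<le> (q (Suc n) + q n / c) * \<bar>D n\<bar>"
    using q[of n] c by (intro mult_right_mono) auto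
  ultimately have "q (Suc n) * \<bar>D n\<bar> \<le> 1" by simp
  then show ?thesis using q[of "Suc n"]
    by (simp add: D_def p_def q_def field_simps)
qed

section \<open>Sums along orbits of a rotation\<close>

definition int_dist :: "real \<Rightarrow> real" where
  "int_dist x = \<bar>x - of_int (round x)\<bar>"

lemma int_dist_le: "int_dist x \<le> \<bar>x - of_int m\<bar>"
  unfolding int_dist_def by (rule round_diff_minimal)

lemma int_dist_nonneg [simp]: "int_dist x \<ge> 0"
  by (simp add: int_dist_def)

lemma int_dist_add_int [simp]: "int_dist (x + of_int m) = int_dist x"
proof -
  have "int_dist (x + of_int m) \<le> int_dist x" for x m
    using int_dist_le[of "x + of_int m" "round x + m"] by (simp add: int_dist_def)
  from this[of x m] this[of "x + of_int m" "-m"] show ?thesis by simp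
qed

lemma int_dist_pos_iff: "int_dist x > 0 \<longleftrightarrow> x \<notin> \<int>"
proof -
  have "int_dist x = 0 \<longleftrightarrow> x \<in> \<int>"
    unfolding int_dist_def by (metis Ints_cases Ints_of_int abs_zero cancel_comm_monoid_add_class.diff_cancel
        eq_iff_diff_eq_0 abs_eq_0_iff round_of_int)
  then show ?thesis using int_dist_nonneg[of x] by linarith
qed

lemma int_dist_add_le: "int_dist (x + y) \<le> int_dist x + \<bar>y\<bar>"
  using int_dist_le[of "x + y" "round x"] by (simp add: int_dist_def)

text \<open>A term with \<open>y + j * \<alpha>\<close> an integer is \<open>1 / 0 = 0\<close> here,
  whereas it should count as infinite. This is why the lower bounds below assume that no such
  \<open>j\<close> exists.\<close>

definition rotation_sum :: "real \<Rightarrow> real \<Rightarrow> nat \<Rightarrow> real" where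
  "rotation_sum \<alpha> y n = (\<Sum>j<n. 1 / int_dist (y + of_nat j * \<alpha>))"

lemma rotation_sum_mono: "m \<le> n \<Longrightarrow> rotation_sum \<alpha> y m \<le> rotation_sum \<alpha> y n"
  unfolding rotation_sum_def by (intro sum_mono2) auto

lemma rotation_sum_nonneg: "rotation_sum \<alpha> y n \<ge> 0"
  unfolding rotation_sum_def by (intro sum_nonneg) auto

lemma rotation_sum_add:
  "rotation_sum \<alpha> y (m + n) = rotation_sum \<alpha> y m + rotation_sum \<alpha> (y + of_nat m * \<alpha>) n"
proof -
  have "rotation_sum \<alpha> y (m + n) = rotation_sum \<alpha> y m + (\<Sum>j = m..<m+n. 1 / int_dist (y + of_nat j * \<alpha>))"
    unfolding rotation_sum_def lessThan_atLeast0
    by (rule sum.atLeastLessThan_concat[symmetric]) auto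
  also have "(\<Sum>j = m..<m+n. 1 / int_dist (y + of_nat j * \<alpha>)) = rotation_sum \<alpha> (y + of_nat m * \<alpha>) n"
    unfolding rotation_sum_def
    by (rule sum.reindex_bij_witness[of _ "\<lambda>j. j + m" "\<lambda>j. j - m"]) (auto simp: algebra_simps of_nat_diff)
  finally show ?thesis .
qed

text \<open>The residue of \<open>j * p - m\<close> modulo \<open>q\<close> ranks the points of a block of length \<open>q\<close> by their
  distance to the integers.\<close>

lemma rotation_sum_block:
  fixes q :: nat and p :: int
  assumes "q > 0" "coprime p (int q)" "\<bar>of_nat q * \<alpha> - of_int p\<bar> \<le> 1 / of_nat q"
    and nz: "\<And>j. y + of_nat j * \<alpha> \<notin> \<int>"
  shows "rotation_sum \<alpha> y q \<ge> of_nat q * (harm q - 1)"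
proof -
  define m where "m = \<lfloor>- y * of_nat q\<rfloor>"
  define r where "r j = nat ((int j * p - m) mod int q)" for j
  have r_less: "r j < q" for j using assms(1) by (simp add: r_def nat_less_iff)
  have "inj_on r {..<q}"
  proof (rule inj_onI)
    fix i j assume ij: "i \<in> {..<q}" "j \<in> {..<q}" "r i = r j"
    then have "(int i * p - m) mod int q = (int j * p - m) mod int q"
      using assms(1) by (simp add: r_def eq_nat_nat_iff)
    then have "int q dvd (int i * p - m) - (int j * p - m)" by (rule mod_eq_dvd_iff[THEN iffD1])
    then have "int q dvd (int i - int j) * p" by (simp add: algebra_simps)
    then have "int q dvd int i - int j"
      using assms(2) by (simp add: coprime_dvd_mult_left_iff coprime_commute)
    moreover have "\<bar>int i - int j\<bar> < int q" using ij(1,2) by auto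
    ultimately show "i = j" using dvd_imp_le_int[of "int i - int j" "int q"] by auto
  qed
  moreover have "r ` {..<q} \<subseteq> {..<q}" using r_less by auto
  ultimately have bij: "bij_betw r {..<q} {..<q}"
    by (metis bij_betw_def card_image card_subset_eq finite_lessThan)
  \<comment> \<open>Multiplied by \<open>q\<close>, the signed distance to \<open>t\<close> is
    \<open>(q * y + m) + r j + j * \<theta>\<close>. The choice of \<open>m\<close> and
    \<open>j < q\<close> make the outer two terms at most 1 in absolute value, hence the 2.\<close>
  have bound: "int_dist (y + of_nat j * \<alpha>) \<le> (of_nat (r j) + 2) / of_nat q" if "j < q" for j
  proof -
    define t where "t = (int j * p - m) div int q"
    define \<theta> where "\<theta> = of_nat q * \<alpha> - of_int p"
    have "int j * p - m = int q * t + int (r j)"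
      using assms(1) by (simp add: t_def r_def)
    then have "real_of_int (int j * p - m) = real_of_int (int q * t + int (r j))" by (rule arg_cong)
    then have jp: "of_nat j * of_int p = of_int m + of_nat q * of_int t + real (r j)" by simp
    have "of_nat q * (y + of_nat j * \<alpha> - of_int t) = of_nat q * y + of_nat j * (of_int p + \<theta>) - of_nat q * of_int t"
      by (simp add: \<theta>_def algebra_simps)
    also have "\<dots> = (of_nat q * y + of_int m) + of_nat (r j) + of_nat j * \<theta>"
      using jp by (simp add: algebra_simps)
    finally have eq: "of_nat q * (y + of_nat j * \<alpha> - of_int t) = (of_nat q * y + of_int m) + of_nat (r j) + of_nat j * \<theta>" .
    have "\<bar>of_nat q * y + of_int m\<bar> \<le> 1"
      unfolding m_def using floor_correct[of "- y * of_nat q"] by (simp add: algebra_simps) linarith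
    moreover have "\<bar>of_nat j * \<theta>\<bar> \<le> of_nat q * (1 / of_nat q)"
      unfolding abs_mult \<theta>_def using that assms(3) by (intro mult_mono) auto
    ultimately have "\<bar>of_nat q * (y + of_nat j * \<alpha> - of_int t)\<bar> \<le> of_nat (r j) + 2"
      unfolding eq using assms(1) by simp
    then have "\<bar>y + of_nat j * \<alpha> - of_int t\<bar> \<le> (of_nat (r j) + 2) / of_nat q"
      using assms(1) by (simp add: abs_mult pos_le_divide_eq mult.commute)
    then show ?thesis using int_dist_le[of "y + of_nat j * \<alpha>" t] by linarith
  qed
  \<comment> \<open>Because of the 2 in \<open>bound\<close> the reciprocals start at 1/2, so the
    first term of \<open>harm\<close> is lost.\<close>
  have "of_nat q * (harm q - 1) \<le> of_nat q * (\<Sum>i<q. 1 / (real i + 2))"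
  proof -
    have "harm (Suc n) - 1 = (\<Sum>i<n. 1 / (real i + 2))" for n
    proof (induction n)
      case (Suc n)
      then show ?case by (simp add: harm_Suc[of "Suc n"] inverse_eq_divide add_ac)
    qed (simp add: harm_def)
    moreover have "harm q \<le> (harm (Suc q) :: real)" by (simp add: harm_Suc)
    ultimately show ?thesis by (intro mult_left_mono) (smt (verit), simp)
  qed
  also have "\<dots> = (\<Sum>i<q. of_nat q / (real i + 2))" by (simp add: sum_distrib_left)
  also have "\<dots> = (\<Sum>j<q. of_nat q / (real (r j) + 2))"
    by (rule sum.reindex_bij_betw[OF bij, symmetric])
  also have "\<dots> \<le> rotation_sum \<alpha> y q"
    unfolding rotation_sum_def
  proof (rule sum_mono)
    fix j assume "j \<in> {..<q}"
    then have "int_dist (y + of_nat j * \<alpha>) \<le> (of_nat (r j) + 2) / of_nat q"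
      by (intro bound) auto
    moreover have "int_dist (y + of_nat j * \<alpha>) > 0" using nz by (simp add: int_dist_pos_iff)
    ultimately have "1 / ((of_nat (r j) + 2) / of_nat q) \<le> 1 / int_dist (y + of_nat j * \<alpha>)"
      by (intro divide_left_mono mult_pos_pos) (auto simp: assms(1))
    then show "of_nat q / (real (r j) + 2) \<le> 1 / int_dist (y + of_nat j * \<alpha>)" by simp
  qed
  finally show ?thesis .
qed

lemma rotation_sum_blocks:
  assumes "q > 0" "coprime p (int q)" "\<bar>of_nat q * \<alpha> - of_int p\<bar> \<le> 1 / of_nat q"
    and nz: "\<And>j. y + of_nat j * \<alpha> \<notin> \<int>"
  shows "rotation_sum \<alpha> y (q * k) \<ge> of_nat (q * k) * (harm q - 1)"
proof (induction k)
  case (Suc k)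
  have "y + of_nat (q * k) * \<alpha> + of_nat j * \<alpha> \<notin> \<int>" for j
    using nz[of "q * k + j"] by (simp add: algebra_simps)
  then have "rotation_sum \<alpha> (y + of_nat (q * k) * \<alpha>) q \<ge> of_nat q * (harm q - 1)"
    using rotation_sum_block[OF assms(1-3)] by blast
  moreover have "rotation_sum \<alpha> y (q * Suc k) = rotation_sum \<alpha> y (q * k) + rotation_sum \<alpha> (y + of_nat (q * k) * \<alpha>) q"
    using rotation_sum_add[of \<alpha> y "q * k" q] by (simp add: add.commute)
  ultimately show ?case using Suc by (simp add: algebra_simps)
qed (simp add: rotation_sum_def)

text \<open>For a given \<open>Z\<close> one fixed \<open>k\<close> with \<open>harm (q k)\<close>
  large is enough, since the bound for a block of length \<open>q k\<close> is uniform in its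
  starting point.\<close>

lemma rotation_sum_superlinear:
  fixes q :: "nat \<Rightarrow> nat" and p :: "nat \<Rightarrow> int"
  assumes q: "\<And>k. q k > 0" "filterlim q at_top sequentially"
    and pq: "\<And>k. coprime (p k) (int (q k))" "\<And>k. \<bar>of_nat (q k) * \<alpha> - of_int (p k)\<bar> \<le> 1 / of_nat (q k)"
    and nz: "\<And>j. y + of_nat j * \<alpha> \<notin> \<int>"
  shows "filterlim (\<lambda>n. rotation_sum \<alpha> y n / of_nat n) at_top sequentially"
  unfolding filterlim_at_top
proof
  fix Z :: real
  have "filterlim (\<lambda>k. harm (q k) :: real) at_top sequentially"
    by (rule filterlim_compose[OF harm_at_top q(2)])
  then have "eventually (\<lambda>k. harm (q k) \<ge> 2 * \<bar>Z\<bar> + 1) sequentially"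
    by (simp add: filterlim_at_top)
  then obtain k where k: "harm (q k) \<ge> 2 * \<bar>Z\<bar> + 1" 
    by (auto simp: eventually_sequentially)
  show "eventually (\<lambda>n. Z \<le> rotation_sum \<alpha> y n / of_nat n) sequentially"
    unfolding eventually_sequentially
  proof (intro exI[of _ "q k"] allI impI)
    fix n assume n: "q k \<le> n"
    define l where "l = n div q k"
    have "n < q k * Suc l" using q(1)[of k] by (simp add: l_def dividend_less_times_div)
    moreover have "l \<ge> 1" using n q(1)[of k] by (simp add: l_def Suc_le_eq div_greater_zero_iff)
    \<comment> \<open>There is at least one full block, so the incomplete last one is no longer than
      the full ones together. This is the origin of the 2 in the choice of \<open>k\<close>.\<close>
    ultimately have nl: "n \<le> 2 * (q k * l)"
      by (metis (no_types, lifting) le_trans less_imp_le mult.left_commute mult_2 mult_Suc_right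
          mult_le_mono2 nat_mult_1_right add_le_mono1 mult.commute)
    have "Z * n \<le> \<bar>Z\<bar> * real n" by (intro mult_right_mono) auto
    also have "\<dots> \<le> \<bar>Z\<bar> * (2 * real (q k * l))"
      using nl by (intro mult_left_mono) (auto simp flip: of_nat_mult)
    also have "\<dots> \<le> real (q k * l) * (harm (q k) - 1)"
      using mult_left_mono[OF k, of "real (q k * l)"] by (simp add: algebra_simps)
    also have "\<dots> \<le> rotation_sum \<alpha> y (q k * l)"
      by (rule rotation_sum_blocks) (use q pq nz in auto)
    also have "\<dots> \<le> rotation_sum \<alpha> y n"
      by (rule rotation_sum_mono) (simp add: l_def)
    finally show "Z \<le> rotation_sum \<alpha> y n / of_nat n"
      using n q(1)[of k] by (simp add: pos_le_divide_eq)
  qed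
qed

text \<open>A step of length \<open>q\<close> moves a point by at most \<open>\<eta>\<close> modulo
  1. The indices \<open>n - l * q\<close> are distinct, and below \<open>n\<close> because
  \<open>l\<close> starts at 1.\<close>

lemma rotation_sum_ge:
  assumes "\<bar>of_nat q * \<alpha> - of_int p\<bar> \<le> \<eta>" "M * q \<le> n" "q > 0"
    and nz: "\<And>j. y + of_nat j * \<alpha> \<notin> \<int>"
  shows "rotation_sum \<alpha> y n \<ge> (\<Sum>l=1..M. 1 / (int_dist (y + of_nat n * \<alpha>) + of_nat l * \<eta>))"
proof -
  have le: "l * q \<le> n" if "l \<le> M" for l
    using that assms(2) by (meson le_trans mult_le_mono1)
  have "(\<Sum>l=1..M. 1 / (int_dist (y + of_nat n * \<alpha>) + of_nat l * \<eta>)) \<le>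
      (\<Sum>l=1..M. 1 / int_dist (y + of_nat (n - l * q) * \<alpha>))"
  proof (rule sum_mono)
    fix l assume l: "l \<in> {1..M}"
    have "y + of_nat (n - l * q) * \<alpha> =
        y + of_nat n * \<alpha> + (- (of_nat l * (of_nat q * \<alpha> - of_int p))) + of_int (- int l * p)"
      using le[of l] l by (simp add: of_nat_diff algebra_simps)
    then have "int_dist (y + of_nat (n - l * q) * \<alpha>) =
        int_dist (y + of_nat n * \<alpha> + (- (of_nat l * (of_nat q * \<alpha> - of_int p))))"
      by (simp only: int_dist_add_int)
    also have "\<dots> \<le> int_dist (y + of_nat n * \<alpha>) + \<bar>- (of_nat l * (of_nat q * \<alpha> - of_int p))\<bar>"
      by (rule int_dist_add_le)
    also have "\<bar>- (of_nat l * (of_nat q * \<alpha> - of_int p))\<bar> \<le> of_nat l * \<eta>"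
      using assms(1) by (simp add: abs_mult mult_left_mono)
    finally have le': "int_dist (y + of_nat (n - l * q) * \<alpha>) \<le> int_dist (y + of_nat n * \<alpha>) + of_nat l * \<eta>"
      by simp
    moreover have "int_dist (y + of_nat (n - l * q) * \<alpha>) > 0"
      using nz by (simp add: int_dist_pos_iff)
    ultimately show "1 / (int_dist (y + of_nat n * \<alpha>) + of_nat l * \<eta>) \<le> 1 / int_dist (y + of_nat (n - l * q) * \<alpha>)"
      by (intro divide_left_mono mult_pos_pos) auto
  qed
  also have "\<dots> = (\<Sum>j\<in>(\<lambda>l. n - l * q) ` {1..M}. 1 / int_dist (y + of_nat j * \<alpha>))"
  proof (subst sum.reindex)
    show "inj_on (\<lambda>l. n - l * q) {1..M}"
    proof (rule inj_onI)
      fix l l' assume "l \<in> {1..M}" "l' \<in> {1..M}" "n - l * q = n - l' * q"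
      then have "l * q = l' * q" using le[of l] le[of l'] by (metis atLeastAtMost_iff diff_diff_cancel)
      then show "l = l'" using assms(3) by simp
    qed
  qed simp
  also have "\<dots> \<le> rotation_sum \<alpha> y n"
    unfolding rotation_sum_def
  proof (rule sum_mono2)
    show "(\<lambda>l. n - l * q) ` {1..M} \<subseteq> {..<n}"
    proof (rule image_subsetI)
      fix l assume "l \<in> {1..M}"
      then have "0 < l * q" "l * q \<le> n" using le[of l] assms(3) by auto
      then have "n - l * q < n" by linarith
      then show "n - l * q \<in> {..<n}" by simp
    qed
  qed auto
  finally show ?thesis .
qed

lemma sum_inverse_Suc_eq_harm: "(\<Sum>l=1..M. 1 / (1 + real l)) = harm (Suc M) - 1"
proof (induction M)
  case (Suc M)
  then show ?case by (simp add: harm_Suc[of "Suc M"] inverse_eq_divide add_ac)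
qed (simp add: harm_def)

text \<open>For \<open>d \<ge> \<eta>\<close> each \<open>d + l * \<eta>\<close> is at most
  \<open>d * (1 + l)\<close>, so the factor \<open>d\<close> cancels and a harmonic sum
  remains.\<close>

lemma int_dist_rotation_sum_ge_large:
  assumes "\<bar>of_nat q * \<alpha> - of_int p\<bar> \<le> \<eta>" "M * q \<le> n" "q > 0" "\<eta> > 0"
    and nz: "\<And>j. y + of_nat j * \<alpha> \<notin> \<int>"
    and d: "int_dist (y + of_nat n * \<alpha>) \<ge> \<eta>"
  shows "int_dist (y + of_nat n * \<alpha>) * rotation_sum \<alpha> y n \<ge> harm (Suc M) - 1"
proof -
  define d where "d = int_dist (y + of_nat n * \<alpha>)"
  have "d \<ge> \<eta>" using d by (simp add: d_def)
  then have "d > 0" using assms by simp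
  have "harm (Suc M) - 1 = (\<Sum>l=1..M. 1 / (1 + real l))" by (rule sum_inverse_Suc_eq_harm[symmetric])
  also have "\<dots> \<le> (\<Sum>l=1..M. d * (1 / (d + of_nat l * \<eta>)))"
  proof (rule sum_mono)
    fix l
    have "d + of_nat l * \<eta> \<le> d * (1 + real l)"
      using mult_left_mono[OF \<open>d \<ge> \<eta>\<close>, of "real l"] by (simp add: algebra_simps)
    moreover have "d + of_nat l * \<eta> > 0" using \<open>d > 0\<close> assms(4) by (simp add: add_pos_nonneg)
    ultimately show "1 / (1 + real l) \<le> d * (1 / (d + of_nat l * \<eta>))"
      by (simp add: field_simps)
  qed
  also have "\<dots> = d * (\<Sum>l=1..M. 1 / (d + of_nat l * \<eta>))" by (simp add: sum_distrib_left)
  also have "\<dots> \<le> d * rotation_sum \<alpha> y n"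
    using rotation_sum_ge[OF assms(1,2,3) nz] \<open>d > 0\<close> by (intro mult_left_mono) (auto simp: d_def)
  finally show ?thesis by (simp add: d_def)
qed

text \<open>For \<open>d \<le> \<eta>\<close> the denominators are at most
  \<open>(1 + l) * \<eta>\<close>. Here \<open>d\<close> does not cancel, so a lower bound for
  \<open>d * S n\<close> also requires one for \<open>d\<close>.\<close>

lemma int_dist_rotation_sum_ge_small:
  assumes "\<bar>of_nat q * \<alpha> - of_int p\<bar> \<le> \<eta>" "M * q \<le> n" "q > 0" "\<eta> > 0"
    and nz: "\<And>j. y + of_nat j * \<alpha> \<notin> \<int>"
    and d: "int_dist (y + of_nat n * \<alpha>) \<le> \<eta>"
  shows "rotation_sum \<alpha> y n \<ge> (harm (Suc M) - 1) / \<eta>"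
proof -
  define d where "d = int_dist (y + of_nat n * \<alpha>)"
  have "d \<le> \<eta>" "d \<ge> 0" using d by (auto simp: d_def)
  have "(harm (Suc M) - 1) / \<eta> = (\<Sum>l=1..M. 1 / (1 + real l)) / \<eta>" by (simp only: sum_inverse_Suc_eq_harm)
  also have "\<dots> = (\<Sum>l=1..M. 1 / ((1 + real l) * \<eta>))" by (simp add: sum_divide_distrib)
  also have "\<dots> \<le> (\<Sum>l=1..M. (1 / (d + of_nat l * \<eta>)))"
  proof (rule sum_mono)
    fix l :: nat assume "l \<in> {1..M}"
    then have "d + of_nat l * \<eta> > 0" using \<open>d \<ge> 0\<close> assms(4) by (intro add_nonneg_pos) auto
    then show "1 / ((1 + real l) * \<eta>) \<le> 1 / (d + of_nat l * \<eta>)"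
      using assms(4) \<open>d \<le> \<eta>\<close> by (intro divide_left_mono mult_pos_pos) (auto simp: algebra_simps)
  qed
  also have "\<dots> \<le> rotation_sum \<alpha> y n"
    using rotation_sum_ge[OF assms(1,2,3) nz] by (simp add: d_def)
  finally show ?thesis .
qed

section \<open>Measure of the exceptional offsets and the Borel-Cantelli argument\<close>

lemma int_dist_measurable [measurable]: "int_dist \<in> borel_measurable borel"
  unfolding int_dist_def round_def by measurable

text \<open>For \<open>\<delta> < 1\<close> only four integers can come within
  \<open>\<delta>\<close> of \<open>y + t\<close>, and each accounts for an interval of length
  \<open>2 * \<delta>\<close>, which gives the 8.\<close>

lemma emeasure_int_dist_less:
  assumes "\<delta> \<ge> 0"
  shows "emeasure lborel {y \<in> {0..1}. int_dist (y + t) < \<delta>} \<le> ennreal (8 * \<delta>)"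
proof (cases "\<delta> < 1")
  case True
  define B where "B m = {real_of_int m - t - \<delta> .. real_of_int m - t + \<delta>}" for m
  have "{y \<in> {0..1}. int_dist (y + t) < \<delta>} \<subseteq> (\<Union>m\<in>{\<lfloor>t\<rfloor>-1..\<lfloor>t\<rfloor>+2}. B m)"
  proof
    fix y assume y: "y \<in> {y \<in> {0..1}. int_dist (y + t) < \<delta>}"
    define m where "m = round (y + t)"
    have *: "\<bar>y + t - of_int m\<bar> < \<delta>" using y by (simp add: int_dist_def m_def)
    have "y + t - of_int m \<le> 1" "of_int m - (y + t) < 1" using * True by linarith+
    then have "real_of_int m > of_int \<lfloor>t\<rfloor> - 2" "real_of_int m < of_int \<lfloor>t\<rfloor> + 3" 
      using y * True floor_correct[of t] unfolding mem_Collect_eq atLeastAtMost_iff by linarith+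
    then have "m \<in> {\<lfloor>t\<rfloor>-1..\<lfloor>t\<rfloor>+2}" by simp
    moreover have "y \<in> B m" using * by (auto simp: B_def)
    ultimately show "y \<in> (\<Union>m\<in>{\<lfloor>t\<rfloor>-1..\<lfloor>t\<rfloor>+2}. B m)" by blast
  qed
  then have "emeasure lborel {y \<in> {0..1}. int_dist (y + t) < \<delta>} \<le> emeasure lborel (\<Union>m\<in>{\<lfloor>t\<rfloor>-1..\<lfloor>t\<rfloor>+2}. B m)"
    by (intro emeasure_mono) (auto simp: B_def)
  also have "\<dots> \<le> (\<Sum>m\<in>{\<lfloor>t\<rfloor>-1..\<lfloor>t\<rfloor>+2}. emeasure lborel (B m))"
    by (intro emeasure_subadditive_finite) (auto simp: B_def)
  also have "\<dots> = (\<Sum>m\<in>{\<lfloor>t\<rfloor>-1..\<lfloor>t\<rfloor>+2}. ennreal (2 * \<delta>))"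
    by (intro sum.cong refl) (use assms in \<open>simp add: B_def\<close>)
  also have "\<dots> = ennreal (8 * \<delta>)"
    using assms by (simp flip: ennreal_numeral ennreal_mult'')
  finally show ?thesis .
next
  case False
  have "emeasure lborel {y \<in> {0..1}. int_dist (y + t) < \<delta>} \<le> emeasure lborel {0..1::real}"
    by (intro emeasure_mono) auto
  also have "\<dots> \<le> ennreal (8 * \<delta>)" using False
    by (simp add: ennreal_leI flip: ennreal_1)
  finally show ?thesis .
qed

text \<open>A union bound. \<open>N\<close> is real since it will be
  \<open>sqrt (A k) * q k\<close>; rounding it up costs the 1 in \<open>N + 1\<close>.\<close>

lemma emeasure_exists_int_dist_less:
  assumes "\<delta> \<ge> 0" "N \<ge> 0"
  shows "emeasure lborel {y \<in> {0..1}. \<exists>n. real n < N \<and> int_dist (y + of_nat n * \<alpha>) < \<delta>} \<le> ennreal (8 * (N + 1) * \<delta>)"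
proof -
  let ?k = "nat \<lceil>N\<rceil>"
  have "{y \<in> {0..1}. \<exists>n. real n < N \<and> int_dist (y + of_nat n * \<alpha>) < \<delta>} \<subseteq>
      (\<Union>n<?k. {y \<in> {0..1}. int_dist (y + of_nat n * \<alpha>) < \<delta>})"
    by (auto simp: zless_nat_eq_int_zless less_ceiling_iff)
  then have "emeasure lborel {y \<in> {0..1}. \<exists>n. real n < N \<and> int_dist (y + of_nat n * \<alpha>) < \<delta>} \<le>
      emeasure lborel (\<Union>n<?k. {y \<in> {0..1}. int_dist (y + of_nat n * \<alpha>) < \<delta>})"
    by (intro emeasure_mono) auto
  also have "\<dots> \<le> (\<Sum>n<?k. emeasure lborel {y \<in> {0..1}. int_dist (y + of_nat n * \<alpha>) < \<delta>})"
    by (intro emeasure_subadditive_finite) auto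
  also have "\<dots> \<le> (\<Sum>n<?k. ennreal (8 * \<delta>))"
    by (intro sum_mono emeasure_int_dist_less assms)
  also have "\<dots> = ennreal (real ?k * (8 * \<delta>))"
    using assms by (simp add: ennreal_mult'' ennreal_of_nat_eq_real_of_nat)
  also have "\<dots> \<le> ennreal (8 * (N + 1) * \<delta>)"
  proof (rule ennreal_leI)
    have "real ?k \<le> N + 1" using assms by linarith
    then show "real ?k * (8 * \<delta>) \<le> 8 * (N + 1) * \<delta>" 
      using mult_right_mono[of "real ?k" "N+1" "8 * \<delta>"] assms by (simp add: algebra_simps)
  qed
  finally show ?thesis .
qed

text \<open>The deterministic half: \<open>y\<close> is fixed and assumed to avoid both bad events
  from some scale on. \<open>A k\<close> stands for the partial quotient with index
  \<open>k + 1\<close>, and \<open>m\<close> is chosen so that the case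
  \<open>d \<ge> \<eta>\<close> already yields \<open>K\<close>.\<close>

lemma rotation_sum_dominates:
  fixes q :: "nat \<Rightarrow> nat" and A :: "nat \<Rightarrow> real"
  assumes q: "\<And>k. q k > 0" "\<And>k. real (q (Suc k)) \<ge> A k * real (q k)"
    and pq: "\<And>k. \<bar>of_nat (q k) * \<alpha> - of_int (p k)\<bar> \<le> 1 / of_nat (q (Suc k))"
    and qlim: "filterlim q at_top sequentially"
    and A: "eventually (\<lambda>k. ln (A k) \<ge> 4 \<and> A k > 1) sequentially"
    and nz: "\<And>j. y + of_nat j * \<alpha> \<notin> \<int>"
    and m: "harm (Suc m) - 1 \<ge> K" and "K > 0"
    and good: "eventually (\<lambda>k. \<not> (\<exists>n. real n < sqrt (A k) * real (q k) \<and>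
        int_dist (y + of_nat n * \<alpha>) < 1 / real (q (Suc k)))) sequentially"
      "eventually (\<lambda>k. \<not> (\<exists>n. real n < real (m * q (Suc k)) \<and>
        int_dist (y + of_nat n * \<alpha>) < 4 * K / (real (q (Suc k)) * ln (A k)))) sequentially"
  shows "eventually (\<lambda>n. int_dist (y + of_nat n * \<alpha>) * rotation_sum \<alpha> y n \<ge> K) sequentially"
proof -
  obtain k0 where *: "\<And>k. k \<ge> k0 \<Longrightarrow> (ln (A k) \<ge> 4 \<and> A k > 1) \<and>
      \<not> (\<exists>n. real n < sqrt (A k) * real (q k) \<and> int_dist (y + of_nat n * \<alpha>) < 1 / real (q (Suc k))) \<and>
      \<not> (\<exists>n. real n < real (m * q (Suc k)) \<and>
        int_dist (y + of_nat n * \<alpha>) < 4 * K / (real (q (Suc k)) * ln (A k)))"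
    using eventually_conj[OF A eventually_conj[OF good]] unfolding eventually_sequentially by blast
  have k0_1: "ln (A k) \<ge> 4 \<and> A k > 1" if "k \<ge> k0" for k
    using *[OF that] by blast
  have k0_2: "int_dist (y + of_nat n * \<alpha>) \<ge> 1 / real (q (Suc k))"
    if "k \<ge> k0" "real n < sqrt (A k) * real (q k)" for k n
    by (rule leI) (use *[OF that(1)] that(2) in blast)
  have k0_3: "int_dist (y + of_nat n * \<alpha>) \<ge> 4 * K / (real (q (Suc k)) * ln (A k))"
    if "k \<ge> k0" "n < m * q (Suc k)" for k n
  proof (rule leI)
    have "real n < real (m * q (Suc k))" using that(2) by (simp only: of_nat_less_iff)
    then show "\<not> int_dist (y + of_nat n * \<alpha>) < 4 * K / (real (q (Suc k)) * ln (A k))"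
      using *[OF that(1)] by blast
  qed
  have "int_dist (y + of_nat n * \<alpha>) * rotation_sum \<alpha> y n \<ge> K" if n: "n \<ge> m * q k0" for n
  proof -
    have "m > 0" using m \<open>K > 0\<close> by (cases m) (auto simp: harm_def)
    have "\<exists>k. n < m * q (Suc (k0 + k))"
    proof -
      have "eventually (\<lambda>k. q k \<ge> Suc n) sequentially" using qlim by (simp add: filterlim_at_top)
      then obtain N where "\<And>k. k \<ge> N \<Longrightarrow> q k \<ge> Suc n" by (auto simp: eventually_sequentially)
      then have "n < q (Suc (k0 + N))" by (simp add: Suc_le_eq)
      also have "\<dots> \<le> m * q (Suc (k0 + N))" using \<open>m > 0\<close> by simp
      finally show ?thesis by blast
    qed
    \<comment> \<open>The scale of \<open>n\<close> is the first one from \<open>k0\<close> on with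
      \<open>n < m * q (Suc k)\<close>. Minimality gives \<open>m * q k \<le> n\<close>, or the
      assumption on \<open>n\<close> does if the scale is \<open>k0\<close> itself.\<close>
    define i where "i = (LEAST k. n < m * q (Suc (k0 + k)))"
    define k where "k = k0 + i"
    have less: "n < m * q (Suc k)" unfolding k_def i_def by (rule LeastI_ex) fact
    have ge: "m * q k \<le> n"
    proof (cases i)
      case 0
      then show ?thesis using n by (simp add: k_def)
    next
      case (Suc j)
      then have "\<not> n < m * q (Suc (k0 + j))"
        unfolding i_def by (metis lessI not_less_Least)
      then show ?thesis by (simp add: k_def Suc)
    qed
    have "k \<ge> k0" by (simp add: k_def)
    note * = k0_1[OF this] k0_2[OF this, of n] k0_3[OF this, of n]
    define \<eta> where "\<eta> = 1 / real (q (Suc k))"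
    define d where "d = int_dist (y + of_nat n * \<alpha>)"
    have "\<eta> > 0" using q(1) by (simp add: \<eta>_def)
    show ?thesis
    proof (cases "d \<ge> \<eta>")
      case True
      have "harm (Suc m) - 1 \<le> int_dist (y + of_nat n * \<alpha>) * rotation_sum \<alpha> y n"
        by (rule int_dist_rotation_sum_ge_large[of "q k" _ "p k" \<eta>])
          (use q pq ge nz True \<open>\<eta> > 0\<close> in \<open>auto simp: \<eta>_def d_def\<close>)
      then show ?thesis using m by simp
    next
      case False
      \<comment> \<open>As \<open>d < \<eta>\<close>, the first excluded event forces
        \<open>n \<ge> sqrt (A k) * q k\<close>, so \<open>M + 1 \<ge> sqrt (A k)\<close>. The root
        halves the logarithm, and \<open>ln (A k) \<ge> 4\<close> lets half of the rest absorb the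
        \<open>- 1\<close> next to \<open>harm\<close>.\<close>
      define M where "M = n div q k"
      have "sqrt (A k) * real (q k) \<le> real n"
        using *(2) False unfolding d_def \<eta>_def by linarith
      also have "\<dots> \<le> real (Suc M * q k)"
        using q(1)[of k] by (simp only: of_nat_le_iff M_def) (simp add: dividend_less_times_div less_imp_le mult.commute)
      finally have "sqrt (A k) \<le> real (Suc M)" using q(1)[of k]
        by (simp only: of_nat_mult mult_le_cancel_right)
      then have "ln (sqrt (A k)) \<le> ln (real (Suc M) + 1)"
        using *(1) by (subst ln_le_cancel_iff) (auto intro: add_nonneg_pos)
      then have "ln (A k) / 2 \<le> ln (real (Suc M) + 1)"
        using *(1) by (simp add: ln_sqrt)
      also have "\<dots> \<le> harm (Suc M)" by (rule ln_le_harm)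
      finally have hM: "harm (Suc M) - 1 \<ge> ln (A k) / 4" using *(1) by simp
      have "rotation_sum \<alpha> y n \<ge> (harm (Suc M) - 1) / \<eta>"
        by (rule int_dist_rotation_sum_ge_small[of "q k" _ "p k" \<eta>])
          (use q pq nz False \<open>\<eta> > 0\<close> in \<open>auto simp: \<eta>_def d_def M_def\<close>)
      moreover have "(harm (Suc M) - 1) / \<eta> \<ge> ln (A k) / 4 / \<eta>"
        using hM \<open>\<eta> > 0\<close> by (intro divide_right_mono) auto
      ultimately have S: "rotation_sum \<alpha> y n \<ge> ln (A k) / 4 / \<eta>" by linarith
      \<comment> \<open>The threshold of the second event was chosen to make the product of the two
        lower bounds exactly \<open>K\<close>.\<close>
      have "d \<ge> 4 * K * \<eta> / ln (A k)" using *(3)[OF less] by (simp add: d_def \<eta>_def)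
      then have "(4 * K * \<eta> / ln (A k)) * (ln (A k) / 4 / \<eta>) \<le> d * rotation_sum \<alpha> y n"
        using S *(1) \<open>\<eta> > 0\<close> by (intro mult_mono) (auto simp: d_def)
      also have "(4 * K * \<eta> / ln (A k)) * (ln (A k) / 4 / \<eta>) = K"
        using *(1) \<open>\<eta> > 0\<close> by simp
      finally show ?thesis by (simp add: d_def)
    qed
  qed
  then show ?thesis unfolding eventually_sequentially by (intro exI[of _ "m * q k0"] allI impI)
qed

text \<open>Borel-Cantelli for hits of a shrinking target. The bound by \<open>c\<close> is asked
  for only eventually, because \<open>1 / ln (A k)\<close> is no useful bound for the first few
  \<open>k\<close>.\<close>

lemma AE_eventually_not_rotation_hit:
  assumes "summable c" "\<And>k. N k \<ge> 0" "\<And>k. \<delta> k \<ge> 0"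
    "eventually (\<lambda>k. (N k + 1) * \<delta> k \<le> c k) sequentially"
  shows "AE y in lborel. y \<in> {0..1} \<longrightarrow>
    eventually (\<lambda>k. \<not> (\<exists>n. real n < N k \<and> int_dist (y + of_nat n * \<alpha>) < \<delta> k)) sequentially"
proof -
  define B where "B k = {y \<in> {0..1}. \<exists>n. real n < N k \<and> int_dist (y + of_nat n * \<alpha>) < \<delta> k}" for k
  have meas [measurable]: "B k \<in> sets lborel" for k unfolding B_def by measurable
  have le: "emeasure lborel (B k) \<le> ennreal (8 * (N k + 1) * \<delta> k)" for k
    unfolding B_def by (rule emeasure_exists_int_dist_less) (use assms in auto)
  have fin: "emeasure lborel (B k) < \<infinity>" for k
    using le[of k] by (metis ennreal_less_top infinity_ennreal_def le_less_trans)
  have m: "measure lborel (B k) \<le> 8 * ((N k + 1) * \<delta> k)" for k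
    using le[of k] assms(2,3)[of k] unfolding measure_def
    by (intro enn2real_leI) (auto simp: algebra_simps)
  have "summable (\<lambda>k. measure lborel (B k))"
  proof (rule summable_comparison_test_ev)
    show "eventually (\<lambda>k. norm (measure lborel (B k)) \<le> 8 * c k) sequentially"
      using assms(4) proof eventually_elim
      case (elim k)
      then show ?case using m[of k] by simp
    qed
    show "summable (\<lambda>k. 8 * c k)" using assms(1) by (rule summable_mult)
  qed
  from borel_cantelli_AE1[OF meas fin this]
  have "AE y in lborel. eventually (\<lambda>k. y \<in> space lborel - B k) sequentially" by simp
  then show ?thesis
  proof eventually_elim
    case (elim y)
    show ?case
    proof
      assume y: "y \<in> {0..1}"
      from elim show "\<forall>\<^sub>F k in sequentially. \<not> (\<exists>n. real n < N k \<and> int_dist (y + of_nat n * \<alpha>) < \<delta> k)"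
        by eventually_elim (use y in \<open>auto simp: B_def\<close>)
    qed
  qed
qed

text \<open>Brings the first bad event, whose probability is of order \<open>1 / sqrt (A k)\<close>,
  under the summable bound \<open>1 / ln (A k)\<close>.\<close>

lemma ln_le_two_sqrt: "x > 0 \<Longrightarrow> ln x \<le> 2 * sqrt (x::real)"
  using ln_le_minus_one[of "sqrt x"] by (simp add: ln_sqrt)

text \<open>The first event has about \<open>sqrt (A k) * q k\<close> targets of size
  \<open>1 / q (Suc k)\<close>, where \<open>q (Suc k) \<ge> A k * q k\<close>. The second has
  \<open>m * q (Suc k)\<close> targets of size \<open>4 * K / (q (Suc k) * ln (A k))\<close>, and
  there \<open>q (Suc k)\<close> cancels.\<close>

lemma AE_rotation_sum_dominates:
  fixes q :: "nat \<Rightarrow> nat" and A :: "nat \<Rightarrow> real"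
  assumes q: "\<And>k. q k > 0" "\<And>k. real (q (Suc k)) \<ge> A k * real (q k)"
    and pq: "\<And>k. \<bar>of_nat (q k) * \<alpha> - of_int (p k)\<bar> \<le> 1 / of_nat (q (Suc k))"
    and qlim: "filterlim q at_top sequentially"
    and A: "eventually (\<lambda>k. A k \<ge> 2) sequentially" "summable (\<lambda>k. 1 / ln (A k))"
    and "K > 0"
  shows "AE y in lborel. y \<in> {0..1} \<longrightarrow> (\<forall>j. y + of_nat j * \<alpha> \<notin> \<int>) \<longrightarrow>
    eventually (\<lambda>n. int_dist (y + of_nat n * \<alpha>) * rotation_sum \<alpha> y n \<ge> K) sequentially"
proof -
  \<comment> \<open>The terms of a convergent series tend to 0, so \<open>ln (A k)\<close>
    eventually exceeds the 4 required by \<open>rotation_sum_dominates\<close>.\<close>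
  have "eventually (\<lambda>k. norm (1 / ln (A k)) < 1/4) sequentially"
    using order_tendstoD(2)[OF tendsto_norm_zero[OF summable_LIMSEQ_zero[OF A(2)]], of "1/4"] by simp
  with A(1) have A4: "eventually (\<lambda>k. ln (A k) \<ge> 4 \<and> A k > 1) sequentially"
  proof eventually_elim
    case (elim k)
    then have "ln (A k) > 0" by simp
    with elim show ?case by (simp add: field_simps)
  qed
  have "filterlim (\<lambda>m. harm (Suc m) :: real) at_top sequentially"
    using harm_at_top filterlim_Suc by (rule filterlim_compose)
  then have "eventually (\<lambda>m. harm (Suc m) \<ge> K + 1) sequentially" by (simp add: filterlim_at_top)
  then obtain m where m: "harm (Suc m) \<ge> K + 1" by (auto simp: eventually_sequentially)
  \<comment> \<open>The \<open>max 0\<close>, here and in the second event, secures the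
    nonnegativity demanded for every \<open>k\<close>; it is removed again below.\<close>
  have 1: "AE y in lborel. y \<in> {0..1} \<longrightarrow> eventually (\<lambda>k. \<not> (\<exists>n. real n < sqrt (max 0 (A k)) * real (q k) \<and>
        int_dist (y + of_nat n * \<alpha>) < 1 / real (q (Suc k)))) sequentially"
  proof (rule AE_eventually_not_rotation_hit)
    show "summable (\<lambda>k. 4 * (1 / ln (A k)))" by (rule summable_mult[OF A(2)])
    show "eventually (\<lambda>k. (sqrt (max 0 (A k)) * real (q k) + 1) * (1 / real (q (Suc k))) \<le> 4 * (1 / ln (A k))) sequentially"
      using A4
    proof eventually_elim
      case (elim k)
      have q1: "real (q k) \<ge> 1" using q(1)[of k] by linarith
      have s1: "sqrt (A k) \<ge> 1" using elim by simp
      have "1 \<le> sqrt (A k) * real (q k)" using mult_mono[OF s1 q1] elim by simp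
      then have "1 \<le> real (q k) * sqrt (A k)" by (simp add: mult.commute)
      then have "(sqrt (A k) * real (q k) + 1) * ln (A k) \<le> (2 * sqrt (A k) * real (q k)) * (2 * sqrt (A k))"
        using ln_le_two_sqrt[of "A k"] elim q1 by (intro mult_mono) (auto intro!: mult_nonneg_nonneg)
      also have "\<dots> = 4 * (A k * real (q k))" using elim by simp
      also have "\<dots> \<le> 4 * real (q (Suc k))" using q(2)[of k] by simp
      finally show ?case using elim q(1)[of "Suc k"] by (simp add: field_simps)
    qed
  qed auto
  have 2: "AE y in lborel. y \<in> {0..1} \<longrightarrow> eventually (\<lambda>k. \<not> (\<exists>n. real n < real (m * q (Suc k)) \<and>
        int_dist (y + of_nat n * \<alpha>) < max 0 (4 * K / (real (q (Suc k)) * ln (A k))))) sequentially"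
  proof (rule AE_eventually_not_rotation_hit)
    show "summable (\<lambda>k. (4 * K * (m + 1)) * (1 / ln (A k)))" by (rule summable_mult[OF A(2)])
    show "eventually (\<lambda>k. (real (m * q (Suc k)) + 1) * max 0 (4 * K / (real (q (Suc k)) * ln (A k)))
        \<le> (4 * K * (m + 1)) * (1 / ln (A k))) sequentially"
      using A4
    proof eventually_elim
      case (elim k)
      have q1: "real (q (Suc k)) \<ge> 1" using q(1)[of "Suc k"] by linarith
      have mx: "max 0 (4 * K / (real (q (Suc k)) * ln (A k))) = 4 * K / (real (q (Suc k)) * ln (A k))"
        using elim q1 \<open>K > 0\<close> by (intro max_absorb2) auto
      have "(real (m * q (Suc k)) + 1) * (4 * K / (real (q (Suc k)) * ln (A k)))
        \<le> (real (m * q (Suc k)) + real (q (Suc k))) * (4 * K / (real (q (Suc k)) * ln (A k)))"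
        using q1 elim \<open>K > 0\<close> by (intro mult_right_mono) auto
      also have "\<dots> = (4 * K * (m + 1)) * (1 / ln (A k))"
        using elim q1 by (simp add: field_simps)
      finally show ?case unfolding mx .
    qed
  qed auto
  from 1 2 show ?thesis
  proof eventually_elim
    case (elim y)
    show ?case
    proof (intro impI)
      assume y: "y \<in> {0..1}" and nz: "\<forall>j. y + of_nat j * \<alpha> \<notin> \<int>"
      show "eventually (\<lambda>n. int_dist (y + of_nat n * \<alpha>) * rotation_sum \<alpha> y n \<ge> K) sequentially"
      proof (rule rotation_sum_dominates[OF q pq qlim A4])
        show "harm (Suc m) - 1 \<ge> K" using m by simp
        show "\<forall>\<^sub>F k in sequentially. \<not> (\<exists>n. real n < sqrt (A k) * real (q k) \<and> int_dist (y + of_nat n * \<alpha>) < 1 / real (q (Suc k)))"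
          using elim(1)[rule_format, OF y] A4 by eventually_elim (simp add: max_def)
        show "\<forall>\<^sub>F k in sequentially. \<not> (\<exists>n. real n < real (m * q (Suc k)) \<and> int_dist (y + of_nat n * \<alpha>) < 4 * K / (real (q (Suc k)) * ln (A k)))"
          using elim(2)[rule_format, OF y] by eventually_elim (simp add: less_max_iff_disj)
      qed (use nz \<open>K > 0\<close> in auto)
    qed
  qed
qed

lemma rotation_sum_add_int: "rotation_sum \<alpha> (y + of_int m) n = rotation_sum \<alpha> y n"
proof -
  have "int_dist (y + of_int m + of_nat j * \<alpha>) = int_dist (y + of_nat j * \<alpha>)" for j
    using int_dist_add_int[of "y + of_nat j * \<alpha>" m] by (simp add: algebra_simps)
  then show ?thesis by (simp add: rotation_sum_def)
qed

lemma AE_lborel_shift: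
  assumes "AE x in lborel. P (x::real)"
  shows "AE x in lborel. P (c + x)"
proof -
  have "AE x in distr lborel borel ((+) c). P x"
    using assms unfolding lborel_distr_plus .
  then show ?thesis by (rule AE_distrD[rotated]) simp
qed

lemma AE_lborel_of_unit_interval:
  assumes "AE x in lborel. x \<in> {0..1} \<longrightarrow> P (x::real)"
    and "\<And>x m. P (x + of_int m) \<Longrightarrow> P x"
  shows "AE x in lborel. P x"
proof -
  have "AE x in lborel. \<forall>m. of_int m + x \<in> {0..1} \<longrightarrow> P (of_int m + x)"
    unfolding AE_all_countable using AE_lborel_shift[OF assms(1)] by blast
  then show ?thesis
  proof eventually_elim
    case (elim x)
    have "of_int (- \<lfloor>x\<rfloor>) + x \<in> {0..1}" using floor_correct[of x] by simp linarith
    then have "P (x + of_int (- \<lfloor>x\<rfloor>))" using elim by (metis add.commute)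
    then show ?case by (rule assms(2))
  qed
qed

text \<open>Negative \<open>j\<close> are included because later the whole line, in both directions
  of time, has to miss the stopping points. The exceptional set is countable.\<close>

lemma AE_rotation_not_int: "AE y in lborel. \<forall>j::int. y + of_int j * \<alpha> \<notin> (\<int>::real set)"
proof -
  have "countable ((\<lambda>(m, j). of_int m - of_int j * \<alpha>) ` (UNIV :: (int \<times> int) set))" by simp
  then have "((\<lambda>(m, j). of_int m - of_int j * \<alpha>) ` (UNIV :: (int \<times> int) set)) \<in> null_sets lborel"
    by (rule countable_imp_null_set_lborel)
  from AE_not_in[OF this] show ?thesis
  proof eventually_elim
    case (elim y)
    show ?case
    proof (intro allI notI)
      fix j :: int assume "y + of_int j * \<alpha> \<in> \<int>"
      then obtain m where "y + of_int j * \<alpha> = of_int m" by (auto elim: Ints_cases)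
      then have "y = (\<lambda>(m, j). of_int m - of_int j * \<alpha>) (m, j)" by simp
      then show False using elim by blast
    qed
  qed
qed

text \<open>\<open>large\<close> excludes \<open>a n = 1\<close>, where \<open>1 / ln 1\<close>
  evaluates to 0 and would go unnoticed by \<open>summable\<close>.\<close>

locale log_summable_rotation =
  fixes \<alpha> :: real and a :: "nat \<Rightarrow> int"
  assumes irrational: "\<alpha> \<notin> \<rat>"
    and expansion: "is_cfrac_expansion a \<alpha>"
    and large: "eventually (\<lambda>n. a n \<ge> 2) sequentially"
    and summable: "summable (\<lambda>n. 1 / ln (real_of_int (a n)))"
begin

definition denom :: "nat \<Rightarrow> nat" where "denom k = nat (cfrac_denominator a k)"

lemma a_ge_1: "n \<ge> 1 \<Longrightarrow> a n \<ge> 1"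
  using expansion by (simp add: is_cfrac_expansion_def)

lemma int_denom: "int (denom k) = cfrac_denominator a k"
  using cfrac_denominator_pos[OF a_ge_1] by (simp add: denom_def less_imp_le)

lemma denom_pos: "denom k > 0"
  using cfrac_denominator_pos[OF a_ge_1] by (simp add: denom_def)

lemma denom_approx: "\<bar>of_nat (denom k) * \<alpha> - of_int (cfrac_numerator a k)\<bar> \<le> 1 / of_nat (denom (Suc k))"
  using cfrac_approximation[OF expansion irrational, of k] by (simp flip: int_denom)

lemma denom_Suc_ge: "real (denom (Suc k)) \<ge> of_int (a (Suc k)) * real (denom k)"
proof -
  have "int (denom (Suc k)) \<ge> a (Suc k) * int (denom k)"
    unfolding int_denom using a_ge_1 by (rule cfrac_denominator_Suc_ge)
  then have "real_of_int (int (denom (Suc k))) \<ge> real_of_int (a (Suc k) * int (denom k))"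
    by (simp only: of_int_le_iff)
  then show ?thesis by simp
qed

lemma denom_mono: "denom k \<le> denom (Suc k)"
proof -
  have "1 * real (denom k) \<le> of_int (a (Suc k)) * real (denom k)"
    using a_ge_1[of "Suc k"] by (intro mult_right_mono) auto
  then show ?thesis using denom_Suc_ge[of k] by simp
qed

lemma denom_approx_self: "\<bar>of_nat (denom k) * \<alpha> - of_int (cfrac_numerator a k)\<bar> \<le> 1 / of_nat (denom k)"
proof -
  have "1 / real (denom (Suc k)) \<le> 1 / real (denom k)"
    using denom_mono[of k] denom_pos[of k] by (intro divide_left_mono) auto
  then show ?thesis using denom_approx[of k] by linarith
qed

lemma denom_at_top: "filterlim denom at_top sequentially"
proof (rule filterlim_at_top_mono)
  have "denom (Suc n) \<ge> Suc n" for n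
  proof (induction n)
    case (Suc n)
    have "int (denom (Suc (Suc n))) = a (Suc (Suc n)) * int (denom (Suc n)) + int (denom n)"
      by (simp add: int_denom)
    also have "\<dots> \<ge> 1 * int (denom (Suc n)) + 1"
      using a_ge_1[of "Suc (Suc n)"] denom_pos[of n] by (intro add_mono mult_right_mono) auto
    finally show ?case using Suc by simp
  qed (use denom_pos[of 1] in simp)
  then show "eventually (\<lambda>n. n \<le> denom n) sequentially"
    by (intro always_eventually allI) (metis not0_implies_Suc le0)
qed (rule filterlim_ident)

lemma rotation_sum_superlinear_cfrac:
  assumes "\<And>j. y + of_nat j * \<alpha> \<notin> \<int>"
  shows "filterlim (\<lambda>n. rotation_sum \<alpha> y n / of_nat n) at_top sequentially"
proof (rule rotation_sum_superlinear[OF denom_pos denom_at_top _ denom_approx_self assms])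
  show "coprime (cfrac_numerator a k) (int (denom k))" for k
    unfolding int_denom by (rule cfrac_coprime)
qed

text \<open>Domination for all natural \<open>K\<close> is a countable intersection of full-measure
  sets and makes \<open>d n * S n\<close> tend to infinity. Both conclusions have period 1 in
  \<open>y\<close>, so the unit interval is enough.\<close>

lemma AE_rotation_sum_ratio:
  "AE y in lborel. (\<forall>j::int. y + of_int j * \<alpha> \<notin> \<int>) \<and>
    (\<lambda>n. rotation_sum \<alpha> y (Suc n) / rotation_sum \<alpha> y n) \<longlonglongrightarrow> 1"
proof -
  have "AE y in lborel. y \<in> {0..1} \<longrightarrow> (\<forall>j. y + of_nat j * \<alpha> \<notin> \<int>) \<longrightarrow>
      (\<forall>K. eventually (\<lambda>n. int_dist (y + of_nat n * \<alpha>) * rotation_sum \<alpha> y n \<ge> real (Suc K)) sequentially)"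
  proof -
    have "AE y in lborel. \<forall>K. y \<in> {0..1} \<longrightarrow> (\<forall>j. y + of_nat j * \<alpha> \<notin> \<int>) \<longrightarrow>
      (eventually (\<lambda>n. int_dist (y + of_nat n * \<alpha>) * rotation_sum \<alpha> y n \<ge> real (Suc K)) sequentially)"
      unfolding AE_all_countable
      using AE_rotation_sum_dominates[OF denom_pos denom_Suc_ge denom_approx denom_at_top
          eventually_sequentially_Suc[THEN iffD2, OF eventually_mono[OF large]] summable[THEN summable_Suc_iff[THEN iffD2]]]
      by simp
    then show ?thesis by eventually_elim blast
  qed
  then have "AE y in lborel. y \<in> {0..1} \<longrightarrow> (\<forall>j::int. y + of_int j * \<alpha> \<notin> \<int>) \<longrightarrow>
    (\<lambda>n. rotation_sum \<alpha> y (Suc n) / rotation_sum \<alpha> y n) \<longlonglongrightarrow> 1"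
  proof eventually_elim
    case (elim y)
    show ?case
    proof (intro impI)
      assume y: "y \<in> {0..1}" and nz: "\<forall>j::int. y + of_int j * \<alpha> \<notin> \<int>"
      define S where "S = rotation_sum \<alpha> y"
      define d where "d n = int_dist (y + of_nat n * \<alpha>)" for n
      have nz': "y + of_nat j * \<alpha> \<notin> \<int>" for j using nz[rule_format, of "int j"] by simp
      have d: "d n > 0" for n using nz' by (simp add: d_def int_dist_pos_iff)
      have S1: "S (Suc n) = S n + 1 / d n" for n by (simp add: S_def rotation_sum_def d_def)
      have S0: "S n \<ge> 0" for n unfolding S_def by (rule rotation_sum_nonneg)
      have Spos: "S (Suc n) > 0" for n using S1[of n] S0[of n] d[of n] by (simp add: add_nonneg_pos)
      have ev: "eventually (\<lambda>n. d n * S n \<ge> real (Suc K)) sequentially" for K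
        using elim y nz' unfolding S_def d_def by blast
      have lim: "(\<lambda>n. 1 / (d n * S n)) \<longlonglongrightarrow> 0"
      proof (rule LIMSEQ_I)
        fix r :: real assume "r > 0"
        then obtain K where K: "inverse (real (Suc K)) < r" using reals_Archimedean by blast
        from ev[of K] obtain N where N: "\<And>n. n \<ge> N \<Longrightarrow> d n * S n \<ge> real (Suc K)"
          unfolding eventually_sequentially by blast
        show "\<exists>N. \<forall>n\<ge>N. norm (1 / (d n * S n) - 0) < r"
        proof (intro exI allI impI)
          fix n assume "N \<le> n"
          then have "d n * S n \<ge> real (Suc K)" by (rule N)
          then have "1 / (d n * S n) \<le> 1 / real (Suc K)" 
            by (intro divide_left_mono) (auto intro!: mult_pos_pos intro: less_le_trans[of _ "real (Suc K)"])
          moreover have "1 / (d n * S n) \<ge> 0" using d[of n] S0[of n] by simp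
          ultimately show "norm (1 / (d n * S n) - 0) < r" using K by (simp add: inverse_eq_divide)
        qed
      qed
      have "(\<lambda>n. 1 + 1 / (d n * S n)) \<longlonglongrightarrow> 1 + 0" by (intro tendsto_add tendsto_const lim)
      moreover have "eventually (\<lambda>n. 1 + 1 / (d n * S n) = S (Suc n) / S n) sequentially"
        using eventually_gt_at_top[of 0]
      proof eventually_elim
        case (elim n)
        then obtain k where "n = Suc k" by (cases n) auto
        then have "S n > 0" using Spos by simp
        then show ?case unfolding S1 using d[of n] by (simp add: field_simps)
      qed
      ultimately have "(\<lambda>n. S (Suc n) / S n) \<longlonglongrightarrow> 1"
        by (auto intro: Lim_transform_eventually)
      then show "(\<lambda>n. rotation_sum \<alpha> y (Suc n) / rotation_sum \<alpha> y n) \<longlonglongrightarrow> 1"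
        by (simp add: S_def)
    qed
  qed
  then have "AE y in lborel. (\<forall>j::int. y + of_int j * \<alpha> \<notin> \<int>) \<longrightarrow>
    (\<lambda>n. rotation_sum \<alpha> y (Suc n) / rotation_sum \<alpha> y n) \<longlonglongrightarrow> 1"
  proof (rule AE_lborel_of_unit_interval)
    fix x m assume *: "(\<forall>j::int. x + of_int m + of_int j * \<alpha> \<notin> \<int>) \<longrightarrow>
      (\<lambda>n. rotation_sum \<alpha> (x + of_int m) (Suc n) / rotation_sum \<alpha> (x + of_int m) n) \<longlonglongrightarrow> 1"
    have "x + of_int m + of_int j * \<alpha> \<in> \<int> \<longleftrightarrow> x + of_int j * \<alpha> \<in> \<int>" for j :: int
    proof -
      have "x + of_int m + of_int j * \<alpha> = x + of_int j * \<alpha> + of_int m" by simp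
      then show ?thesis by (metis Ints_add Ints_diff Ints_of_int add_diff_cancel_right')
    qed
    then show "(\<forall>j::int. x + of_int j * \<alpha> \<notin> \<int>) \<longrightarrow>
      (\<lambda>n. rotation_sum \<alpha> x (Suc n) / rotation_sum \<alpha> x n) \<longlonglongrightarrow> 1"
      using * by (simp add: rotation_sum_add_int)
  qed
  with AE_rotation_not_int[of \<alpha>] show ?thesis by eventually_elim blast
qed

end

section \<open>Second order expansion at a stopping point\<close>

lemma C_k_Suc_imp: "C_k (Suc k) f \<Longrightarrow> C_k k f"
proof (induction k arbitrary: f)
  case 0
  then show ?case
    by (auto intro!: continuous_at_imp_continuous_on differentiable_imp_continuous_within)
next
  case (Suc k)
  then show ?case by (metis C_k.simps(2))
qed

definition second_deriv :: "('a::real_normed_vector \<Rightarrow> real) \<Rightarrow> 'a \<Rightarrow> 'a \<Rightarrow> 'a \<Rightarrow> real" where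
  "second_deriv f v w z = frechet_derivative (\<lambda>x. frechet_derivative f (at x) v) (at z) w"

text \<open>The mixed difference over a parallelogram. It is symmetric in \<open>v\<close> and
  \<open>w\<close>, which is what the classical proof of the symmetry of second derivatives
  exploits.\<close>

definition second_diff :: "('a::real_normed_vector \<Rightarrow> real) \<Rightarrow> 'a \<Rightarrow> 'a \<Rightarrow> 'a \<Rightarrow> real \<Rightarrow> real" where
  "second_diff f z v w h = f (z + h *\<^sub>R v + h *\<^sub>R w) - f (z + h *\<^sub>R v) - f (z + h *\<^sub>R w) + f z"

context
  fixes f :: "'a::real_normed_vector \<Rightarrow> real"
  assumes C2: "C_k 2 f"
begin

lemma C2_derivative: "(f has_derivative frechet_derivative f (at z)) (at z)"
  using C2 by (simp add: numeral_2_eq_2 frechet_derivative_works)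

lemma C2_second_derivative:
  "((\<lambda>x. frechet_derivative f (at x) v) has_derivative (\<lambda>w. second_deriv f v w z)) (at z)"
  using C2 unfolding second_deriv_def by (simp add: numeral_2_eq_2 frechet_derivative_works[symmetric] eta_contract_eq)

lemma continuous_second_deriv: "continuous_on UNIV (second_deriv f v w)"
  using C2 by (simp add: numeral_2_eq_2 second_deriv_def[abs_def])

lemma deriv_along_line:
  "((\<lambda>t. f (z + t *\<^sub>R v)) has_real_derivative frechet_derivative f (at (z + t *\<^sub>R v)) v) (at t)"
proof -
  have "((\<lambda>t. f (z + t *\<^sub>R v)) has_derivative (\<lambda>h. frechet_derivative f (at (z + t *\<^sub>R v)) (h *\<^sub>R v))) (at t)"
    by (rule has_derivative_compose[OF _ C2_derivative]) (auto intro!: derivative_eq_intros)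
  then show ?thesis
    by (simp add: has_field_derivative_def linear_scale[OF has_derivative_linear[OF C2_derivative]] mult_commute_abs)
qed

lemma second_deriv_along_line:
  "((\<lambda>t. frechet_derivative f (at (z + t *\<^sub>R w)) v) has_real_derivative second_deriv f v w (z + t *\<^sub>R w)) (at t)"
proof -
  have "((\<lambda>t. frechet_derivative f (at (z + t *\<^sub>R w)) v) has_derivative (\<lambda>h. second_deriv f v (h *\<^sub>R w) (z + t *\<^sub>R w))) (at t)"
    by (rule has_derivative_compose[OF _ C2_second_derivative]) (auto intro!: derivative_eq_intros)
  then show ?thesis
    by (simp add: has_field_derivative_def linear_scale[OF has_derivative_linear[OF C2_second_derivative]] mult_commute_abs)
qed

text \<open>The mean value theorem is used twice: in direction \<open>v\<close> for the difference
  \<open>g\<close> of two parallel sides, then in direction \<open>w\<close> for the derivative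
  along \<open>v\<close>.\<close>

lemma second_difference:
  fixes h :: real
  assumes "h > 0"
  shows "\<exists>s t. 0 < s \<and> s < h \<and> 0 < t \<and> t < h \<and>
    second_diff f z v w h = h\<^sup>2 * second_deriv f v w (z + s *\<^sub>R v + t *\<^sub>R w)"
proof -
  define g where "g s = f (z + h *\<^sub>R w + s *\<^sub>R v) - f (z + s *\<^sub>R v)" for s
  have "\<exists>s. 0 < s \<and> s < h \<and> g h - g 0 = (h - 0) *
      (frechet_derivative f (at (z + h *\<^sub>R w + s *\<^sub>R v)) v - frechet_derivative f (at (z + s *\<^sub>R v)) v)"
    using assms unfolding g_def
    by (intro MVT2) (auto intro!: derivative_intros deriv_along_line)
  then obtain s where s: "0 < s" "s < h" "g h - g 0 = h *
      (frechet_derivative f (at (z + h *\<^sub>R w + s *\<^sub>R v)) v - frechet_derivative f (at (z + s *\<^sub>R v)) v)" by auto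
  have "\<exists>t. 0 < t \<and> t < h \<and> frechet_derivative f (at (z + s *\<^sub>R v + h *\<^sub>R w)) v -
      frechet_derivative f (at (z + s *\<^sub>R v + 0 *\<^sub>R w)) v = (h - 0) * second_deriv f v w (z + s *\<^sub>R v + t *\<^sub>R w)"
    using assms by (intro MVT2) (auto intro!: second_deriv_along_line)
  then obtain t where t: "0 < t" "t < h" "frechet_derivative f (at (z + s *\<^sub>R v + h *\<^sub>R w)) v -
      frechet_derivative f (at (z + s *\<^sub>R v)) v = h * second_deriv f v w (z + s *\<^sub>R v + t *\<^sub>R w)" by auto
  have "second_diff f z v w h = g h - g 0"
    by (simp add: second_diff_def g_def algebra_simps)
  also have "\<dots> = h\<^sup>2 * second_deriv f v w (z + s *\<^sub>R v + t *\<^sub>R w)"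
    using s(3) t(3) by (simp add: algebra_simps power2_eq_square)
  finally show ?thesis using s t by blast
qed

lemma second_difference_limit:
  "((\<lambda>h. second_diff f z v w h / h\<^sup>2) \<longlongrightarrow> second_deriv f v w z) (at_right 0)"
proof -
  define s t where "s h = (SOME s. \<exists>t. 0 < s \<and> s < h \<and> 0 < t \<and> t < h \<and>
    second_diff f z v w h = h\<^sup>2 * second_deriv f v w (z + s *\<^sub>R v + t *\<^sub>R w))"
    and "t h = (SOME t. 0 < s h \<and> s h < h \<and> 0 < t \<and> t < h \<and>
    second_diff f z v w h = h\<^sup>2 * second_deriv f v w (z + s h *\<^sub>R v + t *\<^sub>R w))" for h :: real
  have st: "0 < s h \<and> s h < h \<and> 0 < t h \<and> t h < h \<and>
    second_diff f z v w h = h\<^sup>2 * second_deriv f v w (z + s h *\<^sub>R v + t h *\<^sub>R w)"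
    if "h > 0" for h
    unfolding t_def by (rule someI_ex) (unfold s_def, rule someI_ex[OF second_difference[OF that]])
  have ev: "eventually (\<lambda>h::real. h > 0) (at_right 0)" by (rule eventually_at_right_less)
  have hh: "((\<lambda>h::real. h) \<longlongrightarrow> 0) (at_right 0)" by (rule tendsto_ident_at)
  have s0: "(s \<longlongrightarrow> 0) (at_right 0)" and t0: "(t \<longlongrightarrow> 0) (at_right 0)"
    by (rule tendsto_sandwich[OF _ _ tendsto_const hh]; use ev in eventually_elim; use st in force)+
  have "((\<lambda>h. z + s h *\<^sub>R v + t h *\<^sub>R w) \<longlongrightarrow> z + 0 *\<^sub>R v + 0 *\<^sub>R w) (at_right 0)"
    by (intro tendsto_intros s0 t0)
  then have "((\<lambda>h. second_deriv f v w (z + s h *\<^sub>R v + t h *\<^sub>R w)) \<longlongrightarrow> second_deriv f v w z) (at_right 0)"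
    using continuous_second_deriv[of v w] 
    by (intro isCont_tendsto_compose[of z "second_deriv f v w"]) (auto simp: continuous_on_eq_continuous_at)
  then show ?thesis
  proof (rule Lim_transform_eventually)
    show "eventually (\<lambda>h. second_deriv f v w (z + s h *\<^sub>R v + t h *\<^sub>R w) =
        second_diff f z v w h / h\<^sup>2) (at_right 0)"
      using ev by eventually_elim (use st in simp)
  qed
qed

text \<open>Both sides are limits of the same quotient, as \<open>second_diff\<close> does not
  change when \<open>v\<close> and \<open>w\<close> are exchanged.\<close>

lemma second_deriv_sym: "second_deriv f v w z = second_deriv f w v z"
proof (rule tendsto_unique[OF _ second_difference_limit[of z v w]])
  show "((\<lambda>h. second_diff f z v w h / h\<^sup>2) \<longlongrightarrow> second_deriv f w v z) (at_right 0)"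
    using second_difference_limit[of z w v] by (simp add: second_diff_def algebra_simps)
qed simp

lemma second_deriv_linear_right: "linear (\<lambda>w. second_deriv f v w z)"
  by (rule has_derivative_linear[OF C2_second_derivative])

lemma second_deriv_linear_left: "linear (\<lambda>v. second_deriv f v w z)"
  unfolding second_deriv_sym[of _ w] by (rule second_deriv_linear_right)

lemma taylor2:
  "\<exists>t. 0 < t \<and> t < 1 \<and> f (z + v) = f z + frechet_derivative f (at z) v + second_deriv f v v (z + t *\<^sub>R v) / 2"
proof -
  define diff where "diff m t = (if m = 0 then f (z + t *\<^sub>R v)
    else if m = 1 then frechet_derivative f (at (z + t *\<^sub>R v)) v else second_deriv f v v (z + t *\<^sub>R v))" for m :: nat and t :: real
  have "\<exists>t. 0 < t \<and> t < 1 \<and> diff 0 1 = (\<Sum>m<2. diff m 0 / fact m * 1 ^ m) + diff 2 t / fact 2 * 1 ^ 2"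
  proof (rule Maclaurin)
    show "\<forall>m t. m < 2 \<and> 0 \<le> t \<and> t \<le> 1 \<longrightarrow> (diff m has_real_derivative diff (Suc m) t) (at t)"
      by (auto simp: less_2_cases_iff diff_def[abs_def] deriv_along_line second_deriv_along_line)
  qed auto
  then show ?thesis by (simp add: diff_def numeral_2_eq_2)
qed

end

lemma quadratic_form_2:
  fixes H :: "real^2^2"
  shows "v \<bullet> (H *v v) = H$1$1 * (v$1)\<^sup>2 + (H$1$2 + H$2$1) * v$1 * v$2 + H$2$2 * (v$2)\<^sup>2"
  by (simp add: inner_vec_def matrix_vector_mult_def sum_2 power2_eq_square algebra_simps)

lemma hessian_eq_second_deriv: "hessian f z $ i $ j = second_deriv f (axis j 1) (axis i 1) z"
  unfolding hessian_def second_deriv_def partial_deriv_def by simp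

lemma vec2_eq_axis: "(v :: real^2) = v$1 *\<^sub>R axis 1 1 + v$2 *\<^sub>R axis 2 1"
  by (simp add: vec_eq_iff forall_2 axis_def)

context
  fixes f :: "real^2 \<Rightarrow> real"
  assumes C2: "C_k 2 f"
begin

lemma hessian_sym: "hessian f z $ i $ j = hessian f z $ j $ i"
  unfolding hessian_eq_second_deriv by (rule second_deriv_sym[OF C2])

lemma second_deriv_eq_hessian: "second_deriv f v v z = v \<bullet> (hessian f z *v v)"
proof -
  have L: "second_deriv f (a *\<^sub>R x + b *\<^sub>R y) w z = a * second_deriv f x w z + b * second_deriv f y w z"
    and R: "second_deriv f w (a *\<^sub>R x + b *\<^sub>R y) z = a * second_deriv f w x z + b * second_deriv f w y z"
    for a b x y w
    using second_deriv_linear_left[OF C2] second_deriv_linear_right[OF C2]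
    by (simp_all add: linear_iff)
  have "second_deriv f v v z = second_deriv f (v$1 *\<^sub>R axis 1 1 + v$2 *\<^sub>R axis 2 1) (v$1 *\<^sub>R axis 1 1 + v$2 *\<^sub>R axis 2 1) z"
    using vec2_eq_axis[of v] by simp
  also have "\<dots> = v \<bullet> (hessian f z *v v)"
    unfolding L R quadratic_form_2 hessian_eq_second_deriv
    by (simp add: algebra_simps power2_eq_square)
  finally show ?thesis .
qed

lemma continuous_hessian: "continuous_on UNIV (\<lambda>z. hessian f z $ i $ j)"
  unfolding hessian_eq_second_deriv using continuous_second_deriv[OF C2] by (simp add: eta_contract_eq)

text \<open>\<open>P\<close> is a minimum of \<open>f\<close>, so the linear term of the Taylor
  formula vanishes; the Hessian at the intermediate point is then compared with that at
  \<open>P\<close> by continuity.\<close>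

lemma hessian_quadratic_approx:
  assumes zero: "f P = 0" and nonneg: "\<And>z. f z \<ge> 0" and "\<epsilon> > 0"
  shows "\<exists>\<delta>>0. \<forall>v. norm v < \<delta> \<longrightarrow> \<bar>f (P + v) - v \<bullet> (hessian f P *v v) / 2\<bar> \<le> \<epsilon> * (norm v)\<^sup>2"
proof -
  have "frechet_derivative f (at P) = (\<lambda>v. 0)"
    by (rule differential_zero_maxmin[OF _ open_UNIV C2_derivative[OF C2]]) (use zero nonneg in auto)
  then have D0: "frechet_derivative f (at P) v = 0" for v by simp
  have "\<forall>i j. \<exists>\<delta>>0. \<forall>z. dist z P < \<delta> \<longrightarrow> \<bar>hessian f z $ i $ j - hessian f P $ i $ j\<bar> < \<epsilon> / 2"
  proof (intro allI)
    fix i j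
    have "continuous (at P) (\<lambda>z. hessian f z $ i $ j)"
      using continuous_hessian by (simp add: continuous_on_eq_continuous_at)
    then show "\<exists>\<delta>>0. \<forall>z. dist z P < \<delta> \<longrightarrow> \<bar>hessian f z $ i $ j - hessian f P $ i $ j\<bar> < \<epsilon> / 2"
      unfolding continuous_at_eps_delta dist_real_def using \<open>\<epsilon> > 0\<close> half_gt_zero by blast
  qed
  then obtain \<delta> where \<delta>: "\<And>i j. \<delta> i j > 0"
    "\<And>i j z. dist z P < \<delta> i j \<Longrightarrow> \<bar>hessian f z $ i $ j - hessian f P $ i $ j\<bar> < \<epsilon> / 2" by metis
  define d where "d = Min (range (\<lambda>(i, j). \<delta> i j))"
  have d: "d > 0" "d \<le> \<delta> i j" for i j
    unfolding d_def using \<delta>(1) by (auto simp: Min_gr_iff intro!: Min_le)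
  show ?thesis
  proof (intro exI[of _ d] conjI allI impI)
    show "d > 0" by fact
    fix v :: "real^2" assume v: "norm v < d"
    obtain t where t: "0 < t" "t < 1" "f (P + v) = f P + frechet_derivative f (at P) v + second_deriv f v v (P + t *\<^sub>R v) / 2"
      using taylor2[OF C2] by blast
    define z where "z = P + t *\<^sub>R v"
    define M where "M i j = hessian f z $ i $ j - hessian f P $ i $ j" for i j
    have "dist z P \<le> norm v" using t by (simp add: z_def dist_norm mult_left_le_one_le)
    then have M: "\<bar>M i j\<bar> \<le> \<epsilon> / 2" for i j
      using \<delta>(2)[of z i j] d(2)[of i j] v by (force simp: M_def)
    have nv: "(norm v)\<^sup>2 = (v$1)\<^sup>2 + (v$2)\<^sup>2"
      by (simp add: norm_vec_def L2_set_def sum_2)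
    have "f (P + v) - v \<bullet> (hessian f P *v v) / 2 = (M 1 1 * (v$1)\<^sup>2 + (M 1 2 + M 2 1) * (v$1 * v$2) + M 2 2 * (v$2)\<^sup>2) / 2"
      using t(3) zero D0[of v] unfolding second_deriv_eq_hessian quadratic_form_2 z_def[symmetric]
      by (simp add: M_def field_simps)
    also have "\<bar>\<dots>\<bar> \<le> (\<epsilon>/2 * (v$1)\<^sup>2 + (\<epsilon>/2 + \<epsilon>/2) * \<bar>v$1 * v$2\<bar> + \<epsilon>/2 * (v$2)\<^sup>2) / 2"
    proof -
      have "\<bar>M 1 1 * (v$1)\<^sup>2\<bar> \<le> \<epsilon>/2 * (v$1)\<^sup>2" "\<bar>M 2 2 * (v$2)\<^sup>2\<bar> \<le> \<epsilon>/2 * (v$2)\<^sup>2"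
        using mult_right_mono[OF M[of 1 1], of "(v$1)\<^sup>2"] mult_right_mono[OF M[of 2 2], of "(v$2)\<^sup>2"]
        by (simp_all add: abs_mult)
      moreover have "\<bar>(M 1 2 + M 2 1) * (v$1 * v$2)\<bar> \<le> (\<epsilon>/2 + \<epsilon>/2) * \<bar>v$1 * v$2\<bar>"
        unfolding abs_mult[of "M 1 2 + M 2 1"] using M[of 1 2] M[of 2 1] by (intro mult_right_mono) auto
      moreover have "\<bar>(a + b + c) / 2\<bar> \<le> (x + y + z) / 2"
        if "\<bar>a\<bar> \<le> x" "\<bar>c\<bar> \<le> z" "\<bar>b\<bar> \<le> y" for a b c x y z :: real
        using that by (auto simp: abs_le_iff)
      ultimately show ?thesis by blast
    qed
    also have "\<dots> \<le> \<epsilon> * (norm v)\<^sup>2"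
    proof -
      have "2 * \<bar>v$1 * v$2\<bar> \<le> (v$1)\<^sup>2 + (v$2)\<^sup>2"
        using sum_squares_bound[of "\<bar>v$1\<bar>" "\<bar>v$2\<bar>"] by (simp add: abs_mult)
      then have "\<epsilon> * (2 * \<bar>v$1 * v$2\<bar>) \<le> \<epsilon> * ((v$1)\<^sup>2 + (v$2)\<^sup>2)" 
        using \<open>\<epsilon> > 0\<close> by (intro mult_left_mono) auto
      moreover have "\<epsilon> * ((v$1)\<^sup>2 + (v$2)\<^sup>2) \<ge> 0" using \<open>\<epsilon> > 0\<close> by simp
      ultimately show ?thesis unfolding nv by (simp add: algebra_simps)
    qed
    finally show "\<bar>f (P + v) - v \<bullet> (hessian f P *v v) / 2\<bar> \<le> \<epsilon> * (norm v)\<^sup>2" .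
  qed
qed

text \<open>The form is at least \<open>c * (norm v)\<^sup>2\<close>, where \<open>c > 0\<close> is
  its minimum on the unit sphere. This turns the absolute error into a relative one, which is what
  survives when reciprocals are taken.\<close>

lemma hessian_ratio_approx:
  assumes zero: "f P = 0" and nonneg: "\<And>z. f z \<ge> 0" and pd: "positive_definite (hessian f P)" and "\<epsilon> > 0"
  shows "\<exists>\<delta>>0. \<forall>v. norm v < \<delta> \<longrightarrow> \<bar>f (P + v) - v \<bullet> (hessian f P *v v) / 2\<bar> \<le> \<epsilon> * (v \<bullet> (hessian f P *v v) / 2)"
proof -
  let ?Q = "\<lambda>v. v \<bullet> (hessian f P *v v)"
  have "continuous_on (sphere 0 1) ?Q"
    unfolding quadratic_form_2 by (intro continuous_intros)
  then have "\<exists>x\<in>sphere 0 1. \<forall>y\<in>sphere 0 1. ?Q x \<le> ?Q y"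
    by (rule continuous_attains_inf[rotated 2]) auto
  then obtain x where x: "norm x = 1" "\<And>y. norm y = 1 \<Longrightarrow> ?Q x \<le> ?Q y" by (auto simp: dist_norm)
  define c where "c = ?Q x"
  have "c > 0" using pd x(1) unfolding positive_definite_def c_def by (metis norm_zero zero_neq_one)
  have c: "c * (norm v)\<^sup>2 \<le> ?Q v" for v
  proof (cases "v = 0")
    case False
    have "c \<le> ?Q (v /\<^sub>R norm v)" unfolding c_def by (rule x(2)) (use False in simp)
    also have "\<dots> = ?Q v / (norm v)\<^sup>2"
      unfolding quadratic_form_2 using False by (simp add: field_simps power2_eq_square)
    finally show ?thesis using False by (simp add: field_simps)
  qed simp
  obtain \<delta> where \<delta>: "\<delta> > 0" "\<And>v. norm v < \<delta> \<Longrightarrow> \<bar>f (P + v) - ?Q v / 2\<bar> \<le> (\<epsilon> * c / 2) * (norm v)\<^sup>2"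
    using hessian_quadratic_approx[OF zero nonneg, of "\<epsilon> * c / 2"] \<open>c > 0\<close> \<open>\<epsilon> > 0\<close> by auto
  have "(\<epsilon> * c / 2) * (norm v)\<^sup>2 \<le> \<epsilon> * (?Q v / 2)" for v
    using mult_left_mono[OF c[of v], of "\<epsilon>/2"] \<open>\<epsilon> > 0\<close> by simp
  with \<delta> show ?thesis by (meson order_trans)
qed

end

text \<open>The basis formed by \<open>linear_field \<alpha>\<close> and the second unit vector
  arises from the standard one by a shear of determinant 1. Hence the discriminant is still
  \<open>det H\<close>, and the passage time involves the determinant but not
  \<open>\<alpha>\<close>.\<close>

lemma quadratic_sheared:
  fixes H :: "real^2^2"
  assumes sym: "H$1$2 = H$2$1" and pd: "positive_definite H"
  shows "\<exists>A B C. A > 0 \<and> A * C - B\<^sup>2 = det H \<and> det H > 0 \<and>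
    (\<forall>u y. (u *\<^sub>R linear_field \<alpha> + y *\<^sub>R axis 2 1) \<bullet> (H *v (u *\<^sub>R linear_field \<alpha> + y *\<^sub>R axis 2 1)) =
      A * u\<^sup>2 + 2 * B * u * y + C * y\<^sup>2)"
proof -
  define A where "A = H$1$1 + 2 * \<alpha> * H$1$2 + \<alpha>\<^sup>2 * H$2$2"
  define B where "B = H$1$2 + \<alpha> * H$2$2"
  define C where "C = H$2$2"
  define w where "w u y = u *\<^sub>R linear_field \<alpha> + y *\<^sub>R axis 2 (1::real)" for u y
  have w: "w u y $ 1 = u" "w u y $ 2 = u * \<alpha> + y" for u y
    by (simp_all add: w_def linear_field_def axis_def)
  have Q: "w u y \<bullet> (H *v w u y) = A * u\<^sup>2 + 2 * B * u * y + C * y\<^sup>2" for u y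
    unfolding quadratic_form_2 w sym[symmetric] by (simp add: A_def B_def C_def algebra_simps power2_eq_square)
  have D: "A * C - B\<^sup>2 = det H"
    unfolding det_2 sym[symmetric] by (simp add: A_def B_def C_def algebra_simps power2_eq_square)
  have pos: "A * u\<^sup>2 + 2 * B * u * y + C * y\<^sup>2 > 0" if "u \<noteq> 0 \<or> y \<noteq> 0" for u y
  proof -
    have "w u y \<noteq> 0"
    proof
      assume "w u y = 0"
      then have "w u y $ 1 = 0" "w u y $ 2 = 0" by simp_all
      then show False using that by (auto simp: w)
    qed
    then show ?thesis using pd unfolding positive_definite_def Q[symmetric] by blast
  qed
  have A: "A > 0" using pos[of 1 0] by simp
  \<comment> \<open>At \<open>u = -B\<close>, \<open>y = A\<close> the completed square
    \<open>A * u + B * y\<close> vanishes and only the discriminant is left.\<close>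
  have "A * (A * C - B\<^sup>2) > 0" using pos[of "-B" A] A by (simp add: algebra_simps power2_eq_square)
  then have "det H > 0" using A D by (simp add: zero_less_mult_iff)
  then show ?thesis using A D Q unfolding w_def by blast
qed

lemma quadratic_pos:
  fixes A B C :: real
  assumes "A > 0" "A * C - B\<^sup>2 > 0" "y \<noteq> 0"
  shows "A * u\<^sup>2 + 2 * B * u * y + C * y\<^sup>2 > 0"
proof -
  have "A * (A * u\<^sup>2 + 2 * B * u * y + C * y\<^sup>2) = (A * u + B * y)\<^sup>2 + (A * C - B\<^sup>2) * y\<^sup>2"
    by (simp add: algebra_simps power2_eq_square)
  also have "\<dots> > 0" using assms by (intro add_nonneg_pos) auto
  finally show ?thesis using assms(1) by (simp add: zero_less_mult_iff)
qed

text \<open>The 2 stems from the speed being about half the quadratic form. \<open>A\<close> times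
  the form equals \<open>(A * u + B * y)\<^sup>2 + s\<^sup>2\<close>, hence the arctangent.\<close>

lemma integral_inverse_quadratic:
  fixes A B C y \<delta> :: real
  assumes "A > 0" "A * C - B\<^sup>2 > 0" "y \<noteq> 0" "\<delta> > 0"
  defines "s \<equiv> sqrt (A * C - B\<^sup>2) * \<bar>y\<bar>"
  shows "((\<lambda>u. 2 / (A * u\<^sup>2 + 2 * B * u * y + C * y\<^sup>2)) has_integral
    (2 / s) * (arctan ((A * \<delta> + B * y) / s) - arctan ((A * (- \<delta>) + B * y) / s))) {-\<delta>..\<delta>}"
proof -
  have s: "s > 0" "s\<^sup>2 = (A * C - B\<^sup>2) * y\<^sup>2" using assms by (auto simp: s_def power_mult_distrib)
  have der: "((\<lambda>u. (2 / s) * arctan ((A * u + B * y) / s)) has_vector_derivative 2 / (A * u\<^sup>2 + 2 * B * u * y + C * y\<^sup>2)) (at u within {-\<delta>..\<delta>})" for u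
  proof -
    have Q: "A * u\<^sup>2 + 2 * B * u * y + C * y\<^sup>2 > 0" by (rule quadratic_pos) fact+
    have "1 + ((A * u + B * y) / s)\<^sup>2 = (s\<^sup>2 + (A * u + B * y)\<^sup>2) / s\<^sup>2"
      using s(1) by (simp add: field_simps)
    also have "s\<^sup>2 + (A * u + B * y)\<^sup>2 = A * (A * u\<^sup>2 + 2 * B * u * y + C * y\<^sup>2)"
      unfolding s(2) by (simp add: algebra_simps power2_eq_square)
    finally have *: "1 + ((A * u + B * y) / s)\<^sup>2 = A * (A * u\<^sup>2 + 2 * B * u * y + C * y\<^sup>2) / s\<^sup>2" .
    have "(2 / s) * (inverse (1 + ((A * u + B * y) / s)\<^sup>2) * (A / s)) = 2 / (A * u\<^sup>2 + 2 * B * u * y + C * y\<^sup>2)"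
      unfolding * using s(1) Q assms(1) by (simp add: divide_simps power2_eq_square)
    moreover have "((\<lambda>u. (2 / s) * arctan ((A * u + B * y) / s)) has_real_derivative (2 / s) * (inverse (1 + ((A * u + B * y) / s)\<^sup>2) * (A / s))) (at u within {-\<delta>..\<delta>})"
      using s(1) by (auto intro!: derivative_eq_intros simp: inverse_eq_divide mult.commute mult.left_commute)
    ultimately show ?thesis by (simp add: has_real_derivative_iff_has_vector_derivative)
  qed
  have "((\<lambda>u. 2 / (A * u\<^sup>2 + 2 * B * u * y + C * y\<^sup>2)) has_integral
    (2 / s) * arctan ((A * \<delta> + B * y) / s) - (2 / s) * arctan ((A * (- \<delta>) + B * y) / s)) {-\<delta>..\<delta>}"
    by (rule fundamental_theorem_of_calculus[of "-\<delta>" \<delta> "\<lambda>u. (2 / s) * arctan ((A * u + B * y) / s)"]) (use assms(4) der in auto)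
  then show ?thesis by (simp add: right_diff_distrib)
qed

text \<open>The two arctangents tend to plus and minus \<open>pi / 2\<close> for every
  \<open>\<delta>\<close>, so the size of the window does not affect the leading term.\<close>

lemma integral_inverse_quadratic_limit:
  fixes A B C \<delta> :: real
  assumes "A > 0" "A * C - B\<^sup>2 > 0" "\<delta> > 0"
  shows "((\<lambda>y. \<bar>y\<bar> * integral {-\<delta>..\<delta>} (\<lambda>u. 2 / (A * u\<^sup>2 + 2 * B * u * y + C * y\<^sup>2))) \<longlongrightarrow> 2 * pi / sqrt (A * C - B\<^sup>2)) (at 0)"
proof -
  define D where "D = sqrt (A * C - B\<^sup>2)"
  have D: "D > 0" using assms by (simp add: D_def)
  have abs0: "filterlim (\<lambda>y::real. D * \<bar>y\<bar>) (at_right 0) (at 0)"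
    unfolding filterlim_at using D
    by (auto intro!: tendsto_eq_intros simp: eventually_at_filter)
  have top: "filterlim (\<lambda>y. (A * \<delta> + B * y) / (D * \<bar>y\<bar>)) at_top (at 0)"
    by (rule filterlim_compose[OF _ filterlim_ident], subst divide_inverse, rule filterlim_tendsto_pos_mult_at_top[where c="A * \<delta>"])
      (use assms in \<open>auto intro!: tendsto_eq_intros filterlim_compose[OF filterlim_inverse_at_top_right abs0] simp del: inverse_mult_distrib\<close>)
  have bot: "filterlim (\<lambda>y. (A * (-\<delta>) + B * y) / (D * \<bar>y\<bar>)) at_bot (at 0)"
    by (rule filterlim_compose[OF _ filterlim_ident], subst divide_inverse, rule filterlim_tendsto_neg_mult_at_bot[where c="A * (-\<delta>)"])
      (use assms in \<open>auto intro!: tendsto_eq_intros filterlim_compose[OF filterlim_inverse_at_top_right abs0] simp: mult_less_0_iff simp del: inverse_mult_distrib\<close>)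
  have "((\<lambda>y. (2 / D) * (arctan ((A * \<delta> + B * y) / (D * \<bar>y\<bar>)) - arctan ((A * (- \<delta>) + B * y) / (D * \<bar>y\<bar>)))) \<longlongrightarrow> (2 / D) * (pi / 2 - (- (pi / 2)))) (at 0)"
    by (intro tendsto_intros filterlim_compose[OF tendsto_arctan_at_top top] filterlim_compose[OF tendsto_arctan_at_bot bot])
  then have "((\<lambda>y. (2 / D) * (arctan ((A * \<delta> + B * y) / (D * \<bar>y\<bar>)) - arctan ((A * (- \<delta>) + B * y) / (D * \<bar>y\<bar>)))) \<longlongrightarrow> 2 * pi / D) (at 0)"
    by simp
  then show ?thesis unfolding D_def[symmetric]
  proof (rule Lim_transform_eventually)
    show "eventually (\<lambda>y. (2 / D) * (arctan ((A * \<delta> + B * y) / (D * \<bar>y\<bar>)) - arctan ((A * (- \<delta>) + B * y) / (D * \<bar>y\<bar>))) =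
      \<bar>y\<bar> * integral {-\<delta>..\<delta>} (\<lambda>u. 2 / (A * u\<^sup>2 + 2 * B * u * y + C * y\<^sup>2))) (at 0)"
      unfolding eventually_at_filter
    proof (intro always_eventually allI impI)
      fix y :: real assume "y \<noteq> 0"
      from integral_unique[OF integral_inverse_quadratic[OF assms(1,2) this assms(3)]] this D
      show "(2 / D) * (arctan ((A * \<delta> + B * y) / (D * \<bar>y\<bar>)) - arctan ((A * (- \<delta>) + B * y) / (D * \<bar>y\<bar>))) =
        \<bar>y\<bar> * integral {-\<delta>..\<delta>} (\<lambda>u. 2 / (A * u\<^sup>2 + 2 * B * u * y + C * y\<^sup>2))"
        by (simp add: D_def)
    qed
  qed
qed

section \<open>Time spent near a stopping point\<close>

text \<open>Plane coordinates adapted to the linear flow: the transverse offset \<open>y\<close> from the orbit of \<open>P\<close>,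
  and the time \<open>u\<close> elapsed since the section through \<open>P\<close>.\<close>

definition line_point :: "real \<Rightarrow> real^2 \<Rightarrow> real \<Rightarrow> real \<Rightarrow> real^2" where
  "line_point \<alpha> P y u = P + (u *\<^sub>R linear_field \<alpha> + y *\<^sub>R axis 2 1)"

lemma line_point_nth [simp]:
  "line_point \<alpha> P y u $ 1 = P $ 1 + u" "line_point \<alpha> P y u $ 2 = P $ 2 + (u * \<alpha> + y)"
  by (simp_all add: line_point_def linear_field_def axis_def)

lemma abs_line_point_add_int:
  "abs_torus (line_point \<alpha> P (y + of_int m) u) = abs_torus (line_point \<alpha> P y u)"
  by (simp add: abs_torus_eq_iff forall_2)

lemma abs_line_point_shift:
  "abs_torus (line_point \<alpha> P (y + of_int j * \<alpha>) u) = abs_torus (line_point \<alpha> P y (u + of_int j))"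
  by (simp add: abs_torus_eq_iff forall_2 algebra_simps)

lemma abs_line_point_eq_base:
  "abs_torus (line_point \<alpha> P y u) = abs_torus P \<longleftrightarrow> u \<in> \<int> \<and> u * \<alpha> + y \<in> \<int>"
  by (simp add: abs_torus_eq_iff forall_2)

lemma line_point_base_shift:
  "line_point \<alpha> (P + r *\<^sub>R linear_field \<alpha>) y u = line_point \<alpha> P y (u + r)"
  by (simp add: line_point_def algebra_simps)

lemma continuous_on_line_point:
  "continuous_on S f \<Longrightarrow> continuous_on S g \<Longrightarrow> continuous_on S (\<lambda>x. line_point \<alpha> P (f x) (g x))"
  unfolding line_point_def by (intro continuous_intros)

text \<open>Isolates one singularity: \<open>P\<close> is a lift of the stopping point under study
  and \<open>q\<close> is the other zero. The locale is interpreted twice, with the roles exchanged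
  and \<open>\<psi>\<close> replaced by \<open>1 - \<psi>\<close>.\<close>

locale stop_point =
  fixes \<alpha> :: real and \<phi> :: "torus \<Rightarrow> real" and P :: "real^2" and q :: torus and \<psi> :: "torus \<Rightarrow> real"
  assumes C2: "C_k 2 (\<lambda>z. \<phi> (abs_torus z))"
    and zero: "\<phi> (abs_torus P) = 0"
    and nonneg: "\<And>x. \<phi> x \<ge> 0"
    and zeros: "\<And>x. \<phi> x = 0 \<Longrightarrow> x = abs_torus P \<or> x = q"
    and pd: "positive_definite (torus_hessian \<phi> (abs_torus P))"
    and chi_cont: "continuous_on UNIV \<psi>"
    and chi_range: "\<And>x. 0 \<le> \<psi> x" "\<And>x. \<psi> x \<le> 1"
    and near_P: "\<exists>U. open U \<and> abs_torus P \<in> U \<and> (\<forall>x\<in>U. \<psi> x = 1)"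
    and near_q: "\<exists>V. open V \<and> q \<in> V \<and> (\<forall>x\<in>V. \<psi> x = 0)"
begin

text \<open>The leading term of the time needed for a passage with transverse offset \<open>y\<close> is \<open>mass / \<bar>y\<bar>\<close>.\<close>

definition mass :: real where
  "mass = 2 * pi / sqrt (det (torus_hessian \<phi> (abs_torus P)))"

abbreviation speed :: "real \<Rightarrow> real \<Rightarrow> real" where
  "speed y u \<equiv> \<phi> (abs_torus (line_point \<alpha> P y u))"

text \<open>The time of the reparametrized flow per unit of linear time, weighted by the cutoff so
  that only the singularity at \<open>P\<close> is seen.\<close>

definition slowness :: "real \<Rightarrow> real \<Rightarrow> real" where
  "slowness y u = \<psi> (abs_torus (line_point \<alpha> P y u)) / speed y u"

lemma slowness_nonneg: "slowness y u \<ge> 0"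
  by (simp add: slowness_def chi_range nonneg)

lemma hessian_torus: "torus_hessian \<phi> (abs_torus P) = hessian (\<lambda>z. \<phi> (abs_torus z)) P"
  by (rule torus_hessian_abs)

lemma det_pos: "det (torus_hessian \<phi> (abs_torus P)) > 0"
  using quadratic_sheared[OF hessian_sym[OF C2], of P] pd unfolding hessian_torus by blast

lemma mass_pos: "mass > 0"
  using det_pos by (simp add: mass_def)

lemma continuous_on_phi_abs: "continuous_on S (\<lambda>z. \<phi> (abs_torus z))"
proof -
  have "C_k 0 (\<lambda>z. \<phi> (abs_torus z))"
    using C2 C_k_Suc_imp by (metis numeral_2_eq_2)
  then show ?thesis by (auto intro: continuous_on_subset)
qed

lemma continuous_on_chi_abs: "continuous_on S (\<lambda>z. \<psi> (abs_torus z))"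
  by (rule continuous_on_compose2[OF chi_cont continuous_on_abs_torus]) auto

lemma continuous_on_slowness:
  assumes "\<And>u. u \<in> S \<Longrightarrow> speed y u > 0"
  shows "continuous_on S (slowness y)"
  unfolding slowness_def
  by (intro continuous_on_divide continuous_on_compose2[OF continuous_on_chi_abs[of UNIV]]
      continuous_on_compose2[OF continuous_on_phi_abs[of UNIV]] continuous_on_line_point continuous_intros)
    (use assms in force)+

text \<open>At \<open>q\<close> the quotient defining \<open>slowness\<close> is \<open>0 / 0 = 0\<close>, which does no harm as \<open>\<psi>\<close> vanishes nearby.\<close>

lemma slowness_bounded_off_point:
  assumes "\<delta> > 0"
  shows "\<exists>C>0. \<forall>u y. \<bar>u\<bar> \<le> 1/2 \<longrightarrow> \<bar>y\<bar> \<le> 1/2 \<longrightarrow> \<delta> \<le> \<bar>u\<bar> \<or> \<delta> \<le> \<bar>y\<bar> \<longrightarrow> slowness y u \<le> C"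
proof -
  obtain V where V: "open V" "q \<in> V" "\<And>x. x \<in> V \<Longrightarrow> \<psi> x = 0" using near_q by blast
  define X where "X z = line_point \<alpha> P (snd z) (fst z)" for z :: "real \<times> real"
  have X: "continuous_on S X" for S
    unfolding X_def by (intro continuous_on_line_point continuous_intros)
  \<comment> \<open>The cell without a box around its centre and without the region near
    \<open>q\<close> where \<open>slowness\<close> is 0. The centre is the only point of the cell
    over \<open>abs_torus P\<close>, so the speed has a positive minimum on
    \<open>K\<close>.\<close>
  define K where "K = (({-1/2..1/2} \<times> {-1/2..1/2}) \<inter> {z. \<delta> \<le> \<bar>fst z\<bar> \<or> \<delta> \<le> \<bar>snd z\<bar>}) \<inter> - ((\<lambda>z. abs_torus (X z)) -` V)"
  have "compact K"
    unfolding K_def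
  proof (intro compact_Int_closed compact_Times compact_Icc)
    show "closed {z :: real \<times> real. \<delta> \<le> \<bar>fst z\<bar> \<or> \<delta> \<le> \<bar>snd z\<bar>}"
      by (intro closed_Collect_disj closed_Collect_le continuous_intros)
    have "continuous_on UNIV (\<lambda>z. abs_torus (X z))"
      by (rule continuous_on_compose2[OF continuous_on_abs_torus X]) auto
    then show "closed (- ((\<lambda>z. abs_torus (X z)) -` V))"
      using V(1) by (intro closed_Compl open_vimage)
  qed
  have pos: "\<phi> (abs_torus (X z)) > 0" if "z \<in> K" for z
  proof (rule ccontr)
    obtain u y where z: "z = (u, y)" by (cases z)
    assume "\<not> \<phi> (abs_torus (X z)) > 0"
    then have "\<phi> (abs_torus (X z)) = 0" using nonneg[of "abs_torus (X z)"] by simp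
    moreover have "abs_torus (X z) \<noteq> q" using that V(2) by (auto simp: K_def)
    ultimately have "abs_torus (X z) = abs_torus P" using zeros by blast
    then have *: "u \<in> \<int>" "u * \<alpha> + y \<in> \<int>" by (auto simp: X_def z abs_line_point_eq_base)
    have small: "t = 0" if "t \<in> \<int>" "\<bar>t\<bar> \<le> 1/2" for t :: real
      using that by (auto elim!: Ints_cases)
    have "\<bar>u\<bar> \<le> 1/2" "\<bar>y\<bar> \<le> 1/2" using that by (auto simp: K_def z abs_le_iff)
    with * have "u = 0" "y = 0" using small[of u] small[of y] by auto
    then show False using that assms by (auto simp: K_def z)
  qed
  have "\<exists>c>0. \<forall>z\<in>K. c \<le> \<phi> (abs_torus (X z))"
  proof (cases "K = {}")
    case False
    have "continuous_on K (\<lambda>z. \<phi> (abs_torus (X z)))"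
      by (rule continuous_on_compose2[OF continuous_on_phi_abs[of UNIV] X]) auto
    from continuous_attains_inf[OF \<open>compact K\<close> False this] show ?thesis using pos by blast
  qed (auto intro: exI[of _ 1])
  then obtain c where c: "c > 0" "\<And>z. z \<in> K \<Longrightarrow> c \<le> \<phi> (abs_torus (X z))" by blast
  show ?thesis
  proof (intro exI[of _ "1 / c"] conjI allI impI)
    show "1 / c > 0" using c by simp
    fix u y :: real assume *: "\<bar>u\<bar> \<le> 1/2" "\<bar>y\<bar> \<le> 1/2" "\<delta> \<le> \<bar>u\<bar> \<or> \<delta> \<le> \<bar>y\<bar>"
    show "slowness y u \<le> 1 / c"
    proof (cases "abs_torus (X (u, y)) \<in> V")
      case True
      then show ?thesis using V(3) c(1) by (simp add: slowness_def X_def)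
    next
      case False
      then have "(u, y) \<in> K" using * by (auto simp: K_def abs_le_iff)
      then have "c \<le> \<phi> (abs_torus (X (u, y)))" by (rule c(2))
      then show ?thesis unfolding slowness_def using c(1) chi_range
        by (intro frac_le) (auto simp: X_def)
    qed
  qed
qed

text \<open>Near \<open>P\<close> the speed is half the quadratic form up to a factor between
  \<open>1 - e\<close> and \<open>1 + e\<close>, so the integral is compared with the arctangent
  integral. Everything else is bounded and enters \<open>C\<close>.\<close>

lemma cell_integral_asymptotic:
  assumes "\<epsilon> > 0"
  shows "\<exists>C\<ge>0. \<forall>y. y \<noteq> 0 \<longrightarrow> \<bar>y\<bar> \<le> 1/2 \<longrightarrow>
    (\<forall>u\<in>{-1/2..1/2}. speed y u > 0) \<longrightarrow>
    \<bar>integral {-1/2..1/2} (slowness y) - mass / \<bar>y\<bar>\<bar> \<le> \<epsilon> / \<bar>y\<bar> + C"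
proof -
  let ?H = "hessian (\<lambda>z. \<phi> (abs_torus z)) P"
  \<comment> \<open>The same \<open>e\<close> serves as relative error of the speed and as error of
    \<open>\<bar>y\<bar> * I y\<close>. Together they yield \<open>(mass + e) / (1 - e)\<close> and
    \<open>(mass - e) / (1 + e)\<close> as bounds.\<close>
  have "((\<lambda>e. (mass + e) / (1 - e)) \<longlongrightarrow> (mass + 0) / (1 - 0)) (at_right 0)"
    and "((\<lambda>e. (mass - e) / (1 + e)) \<longlongrightarrow> (mass - 0) / (1 + 0)) (at_right 0)"
    by (intro tendsto_intros; simp)+
  then have "eventually (\<lambda>e. (mass + e) / (1 - e) < mass + \<epsilon>) (at_right 0)"
    "eventually (\<lambda>e. (mass - e) / (1 + e) > mass - \<epsilon>) (at_right 0)"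
    using assms by (auto elim!: order_tendstoD)
  moreover have "eventually (\<lambda>e::real. e \<in> {0<..<1}) (at_right 0)"
    by (rule eventually_at_right_real) simp
  ultimately have "eventually (\<lambda>e. (mass + e) / (1 - e) < mass + \<epsilon> \<and> (mass - e) / (1 + e) > mass - \<epsilon> \<and> e \<in> {0<..<1}) (at_right 0)"
    by (intro eventually_conj)
  then obtain e where e: "(mass + e) / (1 - e) < mass + \<epsilon>" "(mass - e) / (1 + e) > mass - \<epsilon>" "0 < e" "e < 1"
    using eventually_happens'[OF trivial_limit_at_right_real] by (metis (no_types, lifting) greaterThanLessThan_iff)
  obtain \<delta>0 where \<delta>0: "\<delta>0 > 0" "\<And>v. norm v < \<delta>0 \<Longrightarrow>
      \<bar>\<phi> (abs_torus (P + v)) - v \<bullet> (?H *v v) / 2\<bar> \<le> e * (v \<bullet> (?H *v v) / 2)"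
    using hessian_ratio_approx[OF C2 zero nonneg pd[unfolded hessian_torus] e(3)] by blast
  obtain U where U: "open U" "abs_torus P \<in> U" "\<And>x. x \<in> U \<Longrightarrow> \<psi> x = 1" using near_P by blast
  have "open (abs_torus -` U)" using U(1) by (simp add: open_torus_def)
  then obtain \<delta>1 where \<delta>1: "\<delta>1 > 0" "\<And>v. norm v < \<delta>1 \<Longrightarrow> abs_torus (P + v) \<in> U"
    using U(2) unfolding open_contains_ball
    by (metis (no_types, lifting) ball_subset_cball dist_norm dist_commute diff_add_cancel add_diff_cancel_left' mem_ball subsetD vimage_eq)
  obtain A B C where ABC: "A > 0" "A * C - B\<^sup>2 = det ?H" "det ?H > 0"
    "\<And>u y. (u *\<^sub>R linear_field \<alpha> + y *\<^sub>R axis 2 1) \<bullet> (?H *v (u *\<^sub>R linear_field \<alpha> + y *\<^sub>R axis 2 1)) =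
      A * u\<^sup>2 + 2 * B * u * y + C * y\<^sup>2"
    using quadratic_sheared[OF hessian_sym[OF C2] pd[unfolded hessian_torus], of \<alpha>] by metis
  have ACB: "A * C - B\<^sup>2 > 0" using ABC by simp
  define N where "N = norm (linear_field \<alpha>) + 1"
  \<comment> \<open>The box of half side \<open>\<delta>\<close> lies in the cell and is mapped to
    where the quadratic approximation holds and \<open>\<psi>\<close> is 1.\<close>
  define \<delta> where "\<delta> = min (1/2) (min \<delta>0 \<delta>1 / (2 * N))"
  have N: "N \<ge> 1" by (simp add: N_def)
  have \<delta>: "\<delta> > 0" "\<delta> \<le> 1/2" using \<delta>0(1) \<delta>1(1) N by (auto simp: \<delta>_def)
  have small: "norm (u *\<^sub>R linear_field \<alpha> + y *\<^sub>R axis 2 1) < min \<delta>0 \<delta>1" if "\<bar>u\<bar> \<le> \<delta>" "\<bar>y\<bar> \<le> \<delta>" for u y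
  proof -
    have "norm (u *\<^sub>R linear_field \<alpha> + y *\<^sub>R axis 2 1) \<le> \<bar>u\<bar> * norm (linear_field \<alpha>) + \<bar>y\<bar>"
      by (rule order_trans[OF norm_triangle_ineq]) simp
    also have "\<dots> \<le> \<delta> * norm (linear_field \<alpha>) + \<delta>" using that by (intro add_mono mult_right_mono) auto
    also have "\<dots> = \<delta> * N" by (simp add: N_def algebra_simps)
    also have "\<dots> \<le> min \<delta>0 \<delta>1 / (2 * N) * N" using N by (intro mult_right_mono) (auto simp: \<delta>_def)
    also have "\<dots> = min \<delta>0 \<delta>1 / 2" using N by simp
    also have "\<dots> < min \<delta>0 \<delta>1" using \<delta>0(1) \<delta>1(1) by linarith
    finally show ?thesis .
  qed
  define Q where "Q u y = A * u\<^sup>2 + 2 * B * u * y + C * y\<^sup>2" for u y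
  define I where "I y = integral {-\<delta>..\<delta>} (\<lambda>u. 2 / Q u y)" for y
  have "((\<lambda>y. \<bar>y\<bar> * I y) \<longlongrightarrow> mass) (at 0)"
    using integral_inverse_quadratic_limit[OF ABC(1) ACB \<delta>(1)] unfolding I_def Q_def ABC(2) mass_def hessian_torus .
  then have "eventually (\<lambda>y. dist (\<bar>y\<bar> * I y) mass < e) (at 0)" using e(3) by (rule tendstoD)
  then obtain \<delta>2 where \<delta>2: "\<delta>2 > 0" "\<And>y. y \<noteq> 0 \<Longrightarrow> \<bar>y\<bar> < \<delta>2 \<Longrightarrow> \<bar>\<bar>y\<bar> * I y - mass\<bar> < e"
    unfolding eventually_at by (auto simp: dist_real_def)
  \<comment> \<open>Below \<open>\<delta>3\<close> the limit for \<open>I y\<close> applies; from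
    \<open>\<delta>3\<close> on both the integral and \<open>mass / \<bar>y\<bar>\<close> are
    bounded.\<close>
  define \<delta>3 where "\<delta>3 = min \<delta> \<delta>2"
  have \<delta>3: "\<delta>3 > 0" "\<delta>3 \<le> \<delta>" "\<delta>3 \<le> \<delta>2" using \<delta> \<delta>2 by (auto simp: \<delta>3_def)
  obtain C1 where C1: "C1 > 0" "\<And>u y. \<bar>u\<bar> \<le> 1/2 \<Longrightarrow> \<bar>y\<bar> \<le> 1/2 \<Longrightarrow> \<delta>3 \<le> \<bar>u\<bar> \<or> \<delta>3 \<le> \<bar>y\<bar> \<Longrightarrow> slowness y u \<le> C1"
    using slowness_bounded_off_point[OF \<delta>3(1)] by metis
  show ?thesis
  proof (intro exI[of _ "C1 + mass / \<delta>3"] conjI allI impI)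
    show "0 \<le> C1 + mass / \<delta>3" using C1 mass_pos \<delta>3 by simp
    fix y :: real assume y: "y \<noteq> 0" "\<bar>y\<bar> \<le> 1/2" and
      pos: "\<forall>u\<in>{-1/2..1/2}. speed y u > 0"
    have cont: "continuous_on {-1/2..1/2} (slowness y)" by (rule continuous_on_slowness) (use pos in auto)
    have int: "slowness y integrable_on {a..b}" if "-1/2 \<le> a" "b \<le> 1/2" for a b
      by (rule integrable_continuous_real, rule continuous_on_subset[OF cont]) (use that in auto)
    let ?J = "integral {-1/2..1/2} (slowness y)"
    have J0: "?J \<ge> 0" by (rule integral_nonneg[OF int]) (auto simp: slowness_nonneg)
    show "\<bar>?J - mass / \<bar>y\<bar>\<bar> \<le> \<epsilon> / \<bar>y\<bar> + (C1 + mass / \<delta>3)"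
    proof (cases "\<bar>y\<bar> < \<delta>3")
      case False
      have "?J \<le> integral {-1/2..1/2::real} (\<lambda>u. C1)"
        by (rule integral_le[OF int]) (use False y C1 in \<open>auto simp: abs_le_iff\<close>)
      then have "?J \<le> C1" by simp
      moreover have "mass / \<bar>y\<bar> \<le> mass / \<delta>3"
        using False \<delta>3 mass_pos y by (intro divide_left_mono) (auto simp: mult_pos_pos)
      moreover have "mass / \<bar>y\<bar> \<ge> 0" "mass / \<delta>3 \<ge> 0" "\<epsilon> / \<bar>y\<bar> \<ge> 0" using mass_pos assms \<delta>3 by auto
      ultimately show ?thesis using J0 C1(1) by linarith
    next
      case True
      have Q: "Q u y > 0" for u
        unfolding Q_def by (rule quadratic_pos[OF ABC(1) ACB y(1)])
      have intI: "(\<lambda>u. 2 / Q u y) integrable_on {-\<delta>..\<delta>}"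
        using integral_inverse_quadratic[OF ABC(1) ACB y(1) \<delta>(1)] unfolding Q_def by blast
      let ?K = "integral {-\<delta>..\<delta>} (slowness y)"
      have split: "?J = integral {-1/2..-\<delta>} (slowness y) + ?K + integral {\<delta>..1/2} (slowness y)"
        using Henstock_Kurzweil_Integration.integral_combine[of "-1/2" "-\<delta>" "1/2" "slowness y"]
          Henstock_Kurzweil_Integration.integral_combine[of "-\<delta>" \<delta> "1/2" "slowness y"] \<delta> int by simp
      have out: "0 \<le> integral {a..b} (slowness y) \<and> integral {a..b} (slowness y) \<le> C1 / 2"
        if ab: "-1/2 \<le> a" "a \<le> b" "b \<le> 1/2" "b - a \<le> 1/2" "\<And>u. u \<in> {a..b} \<Longrightarrow> \<delta> \<le> \<bar>u\<bar>" for a b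
      proof
        show "0 \<le> integral {a..b} (slowness y)"
          by (rule integral_nonneg[OF int]) (use ab in \<open>auto simp: slowness_nonneg\<close>)
        have "integral {a..b} (slowness y) \<le> integral {a..b} (\<lambda>u. C1)"
          by (rule integral_le[OF int]) (use ab \<delta>3 y in \<open>auto intro!: C1(2) intro: order_trans simp: abs_le_iff\<close>)
        also have "\<dots> = (b - a) * C1" using ab by simp
        also have "\<dots> \<le> 1/2 * C1" using ab C1(1) by (intro mult_right_mono) auto
        finally show "integral {a..b} (slowness y) \<le> C1 / 2" by simp
      qed
      have out1: "0 \<le> integral {-1/2..-\<delta>} (slowness y)" "integral {-1/2..-\<delta>} (slowness y) \<le> C1 / 2"
        using out[of "-1/2" "-\<delta>"] \<delta> by auto
      have out2: "0 \<le> integral {\<delta>..1/2} (slowness y)" "integral {\<delta>..1/2} (slowness y) \<le> C1 / 2"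
        using out[of "\<delta>" "1/2"] \<delta> by auto
      have dens: "(1 / (1 + e)) * (2 / Q u y) \<le> slowness y u \<and> slowness y u \<le> (1 / (1 - e)) * (2 / Q u y)"
        if u: "u \<in> {-\<delta>..\<delta>}" for u
      proof -
        define v where "v = u *\<^sub>R linear_field \<alpha> + y *\<^sub>R axis 2 (1::real)"
        have Lv: "line_point \<alpha> P y u = P + v" by (simp add: line_point_def v_def)
        have sv: "norm v < min \<delta>0 \<delta>1" unfolding v_def by (rule small) (use u True \<delta>3 in auto)
        have "\<psi> (abs_torus (P + v)) = 1" using sv by (intro U(3) \<delta>1(2)) auto
        moreover have "\<bar>\<phi> (abs_torus (P + v)) - Q u y / 2\<bar> \<le> e * (Q u y / 2)"
          using \<delta>0(2)[of v] sv ABC(4)[of u y] by (simp add: v_def Q_def)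
        then have b: "(1 - e) * (Q u y / 2) \<le> \<phi> (abs_torus (P + v))" "\<phi> (abs_torus (P + v)) \<le> (1 + e) * (Q u y / 2)"
          unfolding abs_le_iff by (simp_all add: algebra_simps)
        have "(1 - e) * (Q u y / 2) > 0" using Q[of u] e by simp
        with b(1) have "\<phi> (abs_torus (P + v)) > 0" by linarith
        then have "1 / ((1 + e) * (Q u y / 2)) \<le> 1 / \<phi> (abs_torus (P + v))"
          using b(2) by (intro divide_left_mono) (auto intro!: mult_pos_pos simp: Q e add_pos_pos)
        moreover have "1 / \<phi> (abs_torus (P + v)) \<le> 1 / ((1 - e) * (Q u y / 2))"
          using b(1) \<open>(1 - e) * (Q u y / 2) > 0\<close> by (intro divide_left_mono) auto
        ultimately show ?thesis by (simp add: slowness_def Lv)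
      qed
      have K1: "(1 / (1 + e)) * I y \<le> ?K"
        unfolding I_def integral_mult_right[symmetric]
        by (rule integral_le[OF integrable_on_mult_right[OF intI] int]) (use dens \<delta> in auto)
      have K2: "?K \<le> (1 / (1 - e)) * I y"
        unfolding I_def integral_mult_right[symmetric]
        by (rule integral_le[OF int integrable_on_mult_right[OF intI]]) (use dens \<delta> in auto)
      have Iy: "\<bar>\<bar>y\<bar> * I y - mass\<bar> < e" using True \<delta>3 y by (intro \<delta>2(2)) auto
      have ay: "\<bar>y\<bar> > 0" using y by simp
      have "\<bar>y\<bar> * ?K \<le> (\<bar>y\<bar> * I y) / (1 - e)" using mult_left_mono[OF K2, of "\<bar>y\<bar>"] by simp
      also have "\<dots> \<le> (mass + e) / (1 - e)" using Iy e by (intro divide_right_mono) auto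
      also have "\<dots> \<le> mass + \<epsilon>" using e by simp
      finally have up: "?K \<le> (mass + \<epsilon>) / \<bar>y\<bar>" using ay by (simp add: field_simps)
      have "mass - \<epsilon> \<le> (mass - e) / (1 + e)" using e by simp
      also have "\<dots> \<le> (\<bar>y\<bar> * I y) / (1 + e)" using Iy e by (intro divide_right_mono) auto
      also have "\<dots> \<le> \<bar>y\<bar> * ?K" using mult_left_mono[OF K1, of "\<bar>y\<bar>"] by simp
      finally have "(mass - \<epsilon>) / \<bar>y\<bar> \<le> ?K" using ay by (simp add: field_simps)
      with up have "\<bar>?K - mass / \<bar>y\<bar>\<bar> \<le> \<epsilon> / \<bar>y\<bar>"
        unfolding add_divide_distrib diff_divide_distrib by linarith
      moreover have "mass / \<delta>3 \<ge> 0" using mass_pos \<delta>3 by simp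
      ultimately show ?thesis using split out1 out2 by linarith
    qed
  qed
qed

lemma cell_integral_asymptotic_int_dist:
  assumes "\<epsilon> > 0"
  shows "\<exists>C\<ge>0. \<forall>y. y \<notin> \<int> \<longrightarrow>
    (\<forall>u\<in>{-1/2..1/2}. speed y u > 0) \<longrightarrow>
    \<bar>integral {-1/2..1/2} (slowness y) - mass * (1 / int_dist y)\<bar> \<le> \<epsilon> * (1 / int_dist y) + C"
proof -
  obtain C where C: "C \<ge> 0" "\<And>y. y \<noteq> 0 \<Longrightarrow> \<bar>y\<bar> \<le> 1/2 \<Longrightarrow>
    (\<forall>u\<in>{-1/2..1/2}. speed y u > 0) \<Longrightarrow>
    \<bar>integral {-1/2..1/2} (slowness y) - mass / \<bar>y\<bar>\<bar> \<le> \<epsilon> / \<bar>y\<bar> + C"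
    using cell_integral_asymptotic[OF assms] by blast
  show ?thesis
  proof (intro exI[of _ C] conjI allI impI C(1))
    fix y :: real assume y: "y \<notin> \<int>" and pos: "\<forall>u\<in>{-1/2..1/2}. speed y u > 0"
    define y0 where "y0 = y - of_int (round y)"
    have y_eq: "y = y0 + of_int (round y)" by (simp add: y0_def)
    have eq: "abs_torus (line_point \<alpha> P y u) = abs_torus (line_point \<alpha> P y0 u)" for u
      by (subst y_eq) (rule abs_line_point_add_int)
    have d: "slowness y = slowness y0" unfolding slowness_def by (rule ext) (simp only: eq)
    have i: "int_dist y = \<bar>y0\<bar>" by (simp add: int_dist_def y0_def)
    have "y0 \<noteq> 0" using y y_eq by (metis Ints_of_int add_0)
    moreover have "\<bar>y0\<bar> \<le> 1/2" using of_int_round_abs_le[of y] by (simp add: y0_def abs_minus_commute)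
    ultimately show "\<bar>integral {-1/2..1/2} (slowness y) - mass * (1 / int_dist y)\<bar> \<le> \<epsilon> * (1 / int_dist y) + C"
      using C(2)[of y0] pos unfolding d i eq by simp
  qed
qed

end

text \<open>The additive errors sum up to \<open>C * n\<close>, which is negligible against a
  superlinear sum; the relative error is arbitrarily small.\<close>

lemma sum_ratio_limit:
  fixes J c :: "nat \<Rightarrow> real"
  assumes "\<And>\<epsilon>. \<epsilon> > 0 \<Longrightarrow> \<exists>C. \<forall>j. \<bar>J j - k * c j\<bar> \<le> \<epsilon> * c j + C"
    and superlinear: "filterlim (\<lambda>n. (\<Sum>j<n. c j) / real n) at_top sequentially"
  shows "(\<lambda>n. (\<Sum>j<n. J j) / (\<Sum>j<n. c j)) \<longlonglongrightarrow> k"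
proof (rule LIMSEQ_I)
  fix r :: real assume "r > 0"
  define S where "S n = (\<Sum>j<n. c j)" for n
  obtain C where C: "\<And>j. \<bar>J j - k * c j\<bar> \<le> r / 2 * c j + C"
    using assms(1)[of "r/2"] \<open>r > 0\<close> by auto
  have "eventually (\<lambda>n. S n / real n \<ge> 2 * (\<bar>C\<bar> + 1) / r) sequentially"
    using superlinear by (simp add: filterlim_at_top S_def)
  then obtain N where N: "\<And>n. n \<ge> N \<Longrightarrow> S n / real n \<ge> 2 * (\<bar>C\<bar> + 1) / r"
    by (auto simp: eventually_sequentially)
  show "\<exists>N. \<forall>n\<ge>N. norm ((\<Sum>j<n. J j) / (\<Sum>j<n. c j) - k) < r"
  proof (intro exI[of _ "max N 1"] allI impI)
    fix n assume n: "max N 1 \<le> n"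
    then have "S n / real n \<ge> 2 * (\<bar>C\<bar> + 1) / r" by (intro N) simp
    then have Sn: "r / 2 * S n \<ge> (\<bar>C\<bar> + 1) * n" using n \<open>r > 0\<close> by (simp add: field_simps)
    then have "r / 2 * S n > 0" using n
      by (intro less_le_trans[OF _ Sn]) (auto intro!: mult_pos_pos)
    then have S0: "S n > 0" using \<open>r > 0\<close> by (simp add: zero_less_mult_iff)
    have "(\<Sum>j<n. J j) - k * S n = (\<Sum>j<n. J j - k * c j)"
      by (simp add: S_def sum_subtractf sum_distrib_left)
    also have "\<bar>\<dots>\<bar> \<le> (\<Sum>j<n. r / 2 * c j + C)"
      by (rule order_trans[OF sum_abs]) (intro sum_mono C)
    also have "\<dots> = r / 2 * S n + C * n"
      by (simp add: S_def sum.distrib sum_distrib_left)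
    also have "\<dots> < r * S n"
    proof -
      have "C * n < (\<bar>C\<bar> + 1) * n" using n by (intro mult_strict_right_mono) auto
      then show ?thesis using Sn by (simp add: field_simps)
    qed
    finally have "\<bar>(\<Sum>j<n. J j) - k * S n\<bar> < r * S n" .
    moreover have "(\<Sum>j<n. J j) / S n - k = ((\<Sum>j<n. J j) - k * S n) / S n" using S0 by (simp add: field_simps)
    ultimately show "norm ((\<Sum>j<n. J j) / (\<Sum>j<n. c j) - k) < r"
      using S0 by (simp add: S_def[symmetric] pos_divide_less_eq)
  qed
qed

lemma ratio_shift_limit:
  fixes S :: "nat \<Rightarrow> real"
  assumes "(\<lambda>n. S (Suc n) / S n) \<longlonglongrightarrow> 1" "eventually (\<lambda>n. S n > 0) sequentially"
  shows "(\<lambda>n. S (n + k) / S n) \<longlonglongrightarrow> 1"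
proof (induction k)
  case 0
  have "(\<lambda>n. 1::real) \<longlonglongrightarrow> 1" by simp
  then show ?case
    by (rule Lim_transform_eventually) (use assms(2) in eventually_elim, simp)
next
  case (Suc k)
  have "(\<lambda>n. S (Suc (n + k)) / S (n + k)) \<longlonglongrightarrow> 1"
    using LIMSEQ_ignore_initial_segment[OF assms(1), of k] by simp
  from tendsto_mult[OF this Suc] have "(\<lambda>n. S (Suc (n + k)) / S (n + k) * (S (n + k) / S n)) \<longlonglongrightarrow> 1" by simp
  then show ?case
  proof (rule Lim_transform_eventually)
    have "eventually (\<lambda>n. S (n + k) > 0) sequentially"
      using assms(2) by (simp add: eventually_sequentially_seg[of "\<lambda>n. S n > 0"])
    then show "eventually (\<lambda>n. S (Suc (n + k)) / S (n + k) * (S (n + k) / S n) = S (n + Suc k) / S n) sequentially"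
      by eventually_elim simp
  qed
qed

lemma nat_floor_at_top: "filterlim (\<lambda>v::real. nat \<lfloor>v\<rfloor>) at_top at_top"
  by (rule filterlim_compose[OF filterlim_nat_sequentially filterlim_floor_sequentially])

context stop_point
begin

text \<open>Following a line for \<open>j\<close> units amounts to changing its offset by
  \<open>j * \<alpha>\<close>, so every unit cell of one line is the central cell of
  another.\<close>

lemma cell_integral_shift:
  assumes "\<And>u. u \<in> {of_int j - 1/2 .. of_int j + 1/2} \<Longrightarrow> speed y u > 0"
    and "\<And>u. u \<in> {of_int j - 1/2 .. of_int j + 1/2} \<Longrightarrow> (E has_real_derivative slowness y u) (at u)"
  shows "E (of_int j + 1/2) - E (of_int j - 1/2) = integral {-1/2..1/2} (slowness (y + of_int j * \<alpha>))"
proof -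
  have "(slowness y has_integral E (of_int j + 1/2) - E (of_int j - 1/2)) {of_int j - 1/2 .. of_int j + 1/2}"
    by (rule fundamental_theorem_of_calculus)
      (use assms(2) in \<open>auto simp: has_real_derivative_iff_has_vector_derivative[symmetric] intro: has_field_derivative_at_within\<close>)
  then have "E (of_int j + 1/2) - E (of_int j - 1/2) = integral {- 1/2 + of_int j .. 1/2 + of_int j} (slowness y)"
    by (simp add: integral_unique algebra_simps)
  also have "\<dots> = integral {-1/2..1/2} (slowness y \<circ> (\<lambda>u. u + of_int j))"
    by (rule integral_shift[symmetric], rule continuous_on_slowness) (use assms(1) in auto)
  also have "slowness y \<circ> (\<lambda>u. u + of_int j) = slowness (y + of_int j * \<alpha>)"
    by (auto simp: slowness_def abs_line_point_shift)
  finally show ?thesis .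
qed

text \<open>\<open>E\<close> measures the time spent near \<open>P\<close> as a function of linear
  time. Passages happen near integers, so cells are cut at half-integers and each contributes one
  term of \<open>rotation_sum\<close>.\<close>

lemma antiderivative_asymptotic:
  assumes pos: "\<And>u. u \<ge> - 1/2 \<Longrightarrow> speed y u > 0"
    and E: "\<And>u. u \<ge> - 1/2 \<Longrightarrow> (E has_real_derivative slowness y u) (at u)"
    and superlinear: "filterlim (\<lambda>n. rotation_sum \<alpha> y n / real n) at_top sequentially"
  shows "(\<lambda>n. (E (real n - 1/2) - E (- 1/2)) / rotation_sum \<alpha> y n) \<longlonglongrightarrow> mass"
proof -
  define J where "J j = integral {-1/2..1/2} (slowness (y + of_nat j * \<alpha>))" for j :: nat
  define c where "c j = 1 / int_dist (y + of_nat j * \<alpha>)" for j :: nat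
  have Jdiff: "E (real j + 1/2) - E (real j - 1/2) = J j" for j
    using cell_integral_shift[of "int j" y E] pos E by (simp add: J_def)
  have Jsum: "E (real n - 1/2) - E (- 1/2) = (\<Sum>j<n. J j)" for n
  proof (induction n)
    case (Suc n)
    have "real (Suc n) - 1/2 = real n + 1/2" by simp
    with Suc Jdiff[of n] show ?case by (simp add: algebra_simps)
  qed simp
  have nz: "y + of_nat j * \<alpha> \<notin> \<int>" for j
  proof
    assume "y + of_nat j * \<alpha> \<in> \<int>"
    then have "abs_torus (line_point \<alpha> P y (of_nat j)) = abs_torus P"
      unfolding abs_line_point_eq_base by (simp add: add.commute)
    then show False using pos[of "of_nat j"] zero by simp
  qed
  have pos': "speed (y + of_nat j * \<alpha>) u > 0" if "u \<in> {-1/2..1/2}" for u j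
    using abs_line_point_shift[of \<alpha> P y "int j" u] pos[of "u + of_nat j"] that by simp
  have "(\<lambda>n. (\<Sum>j<n. J j) / (\<Sum>j<n. c j)) \<longlonglongrightarrow> mass"
  proof (rule sum_ratio_limit)
    fix \<epsilon> :: real assume "\<epsilon> > 0"
    from cell_integral_asymptotic_int_dist[OF this] obtain C where
      "\<And>y. y \<notin> \<int> \<Longrightarrow> (\<forall>u\<in>{-1/2..1/2}. speed y u > 0) \<Longrightarrow>
       \<bar>integral {-1/2..1/2} (slowness y) - mass * (1 / int_dist y)\<bar> \<le> \<epsilon> * (1 / int_dist y) + C"
      by blast
    then show "\<exists>C. \<forall>j. \<bar>J j - mass * c j\<bar> \<le> \<epsilon> * c j + C"
      unfolding J_def c_def using nz pos' by blast
  qed (use superlinear in \<open>simp add: rotation_sum_def c_def\<close>)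
  then show ?thesis by (simp only: Jsum rotation_sum_def c_def)
qed

lemma antiderivative_mono:
  assumes E: "\<And>u. u \<ge> u0 \<Longrightarrow> (E has_real_derivative slowness y u) (at u)" and "u0 \<le> u" "u \<le> v"
  shows "E u \<le> E v"
  by (rule DERIV_nonneg_imp_nondecreasing[OF assms(3)]) (meson E assms(2) order_trans slowness_nonneg)

text \<open>Positivity is asked for on a half-line only, so this covers all orbits that never stop
  in forward time and not just generic ones.\<close>

lemma antiderivative_superlinear:
  assumes pos: "\<And>u. u \<ge> - 1/2 \<Longrightarrow> speed y u > 0"
    and E: "\<And>u. u \<ge> - 1/2 \<Longrightarrow> (E has_real_derivative slowness y u) (at u)"
    and superlinear: "filterlim (\<lambda>n. rotation_sum \<alpha> y n / real n) at_top sequentially"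
  shows "filterlim (\<lambda>v. E v / v) at_top at_top"
proof -
  have lim: "(\<lambda>n. (E (real n - 1/2) - E (- 1/2)) / rotation_sum \<alpha> y n) \<longlonglongrightarrow> mass"
    by (rule antiderivative_asymptotic) fact+
  have "filterlim (\<lambda>n. (E (real n - 1/2) - E (- 1/2)) / rotation_sum \<alpha> y n * (rotation_sum \<alpha> y n / real n)) at_top sequentially"
    by (rule filterlim_tendsto_pos_mult_at_top[OF lim mass_pos superlinear])
  then have *: "filterlim (\<lambda>n. (E (real n - 1/2) - E (- 1/2)) / real n) at_top sequentially"
  proof (rule filterlim_mono_eventually[OF _ order_refl order_refl])
    have "eventually (\<lambda>n. rotation_sum \<alpha> y n / real n > 0) sequentially"
      using superlinear by (simp add: filterlim_at_top_dense)
    then show "eventually (\<lambda>n. (E (real n - 1/2) - E (- 1/2)) / rotation_sum \<alpha> y n * (rotation_sum \<alpha> y n / real n) =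
        (E (real n - 1/2) - E (- 1/2)) / real n) sequentially"
      by eventually_elim auto
  qed
  show ?thesis
    unfolding filterlim_at_top
  proof
    fix Z :: real
    \<comment> \<open>The factor 2 pays for \<open>v \<le> 2 * n\<close>, and the second summand for
      the constant \<open>E (- 1/2)\<close>, as \<open>n \<ge> 1\<close>.\<close>
    let ?Z = "2 * \<bar>Z\<bar> + \<bar>E (- 1/2)\<bar>"
    have "filterlim (\<lambda>v::real. (E (real (nat \<lfloor>v\<rfloor>) - 1/2) - E (- 1/2)) / real (nat \<lfloor>v\<rfloor>)) at_top at_top"
      by (rule filterlim_compose[OF * nat_floor_at_top])
    then have "eventually (\<lambda>v::real. (E (real (nat \<lfloor>v\<rfloor>) - 1/2) - E (- 1/2)) / real (nat \<lfloor>v\<rfloor>) \<ge> ?Z) at_top"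
      unfolding filterlim_at_top by (rule spec)
    with eventually_ge_at_top[of 1] show "eventually (\<lambda>v. Z \<le> E v / v) at_top"
    proof eventually_elim
      case (elim v)
      define n where "n = nat \<lfloor>v\<rfloor>"
      have n: "real n \<ge> 1" "real n \<le> v" "v < real n + 1" using elim(1) by (auto simp: n_def)
      have "?Z * real n \<le> E (real n - 1/2) - E (- 1/2)" using elim(2) n(1) by (simp add: n_def[symmetric] field_simps)
      moreover have "E (real n - 1/2) \<le> E v" by (rule antiderivative_mono[OF E]) (use n in auto)
      moreover have "\<bar>E (- 1/2)\<bar> \<le> \<bar>E (- 1/2)\<bar> * real n" using mult_left_mono[OF n(1), of "\<bar>E (- 1/2)\<bar>"] by simp
      ultimately have "2 * \<bar>Z\<bar> * real n \<le> E v" by (simp add: algebra_simps)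
      moreover have "Z * v \<le> \<bar>Z\<bar> * (2 * real n)" using n by (intro mult_mono) auto
      ultimately have "Z * v \<le> E v" by simp
      then show ?case using elim(1) by (simp add: pos_le_divide_eq)
    qed
  qed
qed

text \<open>The shift \<open>c\<close> and the rounding of \<open>v\<close> displace the endpoint by
  a bounded number of cells. By \<open>ratio\<close> this changes the sum by a factor tending to 1,
  so the monotone \<open>E\<close> can be sandwiched.\<close>

lemma antiderivative_asymptotic_real:
  assumes pos: "\<And>u. speed y u > 0"
    and E: "\<And>u. (E has_real_derivative slowness y u) (at u)"
    and superlinear: "filterlim (\<lambda>n. rotation_sum \<alpha> y n / real n) at_top sequentially"
    and ratio: "(\<lambda>n. rotation_sum \<alpha> y (Suc n) / rotation_sum \<alpha> y n) \<longlonglongrightarrow> 1"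
  shows "((\<lambda>v. E (v + c) / rotation_sum \<alpha> y (nat \<lfloor>v\<rfloor>)) \<longlongrightarrow> mass) at_top"
proof -
  define S where "S = rotation_sum \<alpha> y"
  have Spos: "eventually (\<lambda>n. S n > 0) sequentially"
  proof -
    have "eventually (\<lambda>n. S n / real n > 0) sequentially"
      using superlinear by (simp add: filterlim_at_top_dense S_def)
    then show ?thesis by eventually_elim (auto simp: zero_less_divide_iff)
  qed
  have S_top: "filterlim S at_top sequentially"
  proof -
    have "filterlim (\<lambda>n. S n / real n * real n) at_top sequentially"
      using superlinear unfolding S_def
      by (rule filterlim_at_top_mult_at_top[OF _ filterlim_real_sequentially])
    then show ?thesis
      by (rule filterlim_mono_eventually[OF _ order_refl order_refl])
        (use eventually_gt_at_top[of 0] in eventually_elim, simp)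
  qed
  have shift: "(\<lambda>n. S (n + k) / S n) \<longlonglongrightarrow> 1" for k
    by (rule ratio_shift_limit[OF _ Spos]) (use ratio in \<open>simp add: S_def\<close>)
  have lim0: "(\<lambda>n. (E (real n - 1/2) - E (- 1/2)) / S n) \<longlonglongrightarrow> mass"
    unfolding S_def by (rule antiderivative_asymptotic[OF pos E superlinear])
  have const0: "(\<lambda>n. b / S n) \<longlonglongrightarrow> 0" for b
    by (rule tendsto_divide_0[OF tendsto_const]) (rule filterlim_at_top_imp_at_infinity[OF S_top])
  have lim: "(\<lambda>n. E (real n - 1/2) / S n) \<longlonglongrightarrow> mass"
    using tendsto_add[OF lim0 const0[of "E (- 1/2)"]] by (simp add: diff_divide_distrib)
  \<comment> \<open>The extra 2 covers the fractional part of \<open>v\<close> and the half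
    cell.\<close>
  define k where "k = nat \<lceil>\<bar>c\<bar>\<rceil> + 2"
  have k: "real k \<ge> \<bar>c\<bar> + 2" by (simp add: k_def)
  have up: "(\<lambda>n. E (real (n + k) - 1/2) / S n) \<longlonglongrightarrow> mass"
  proof -
    have "(\<lambda>n. E (real (n + k) - 1/2) / S (n + k) * (S (n + k) / S n)) \<longlonglongrightarrow> mass * 1"
      by (intro tendsto_mult shift LIMSEQ_ignore_initial_segment[OF lim])
    then have "(\<lambda>n. E (real (n + k) - 1/2) / S (n + k) * (S (n + k) / S n)) \<longlonglongrightarrow> mass" by simp
    then show ?thesis
    proof (rule Lim_transform_eventually)
      have "eventually (\<lambda>n. S (n + k) > 0) sequentially"
        using Spos by (simp add: eventually_sequentially_seg[of "\<lambda>n. S n > 0"])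
      then show "eventually (\<lambda>n. E (real (n + k) - 1/2) / S (n + k) * (S (n + k) / S n) = E (real (n + k) - 1/2) / S n) sequentially"
        by eventually_elim simp
    qed
  qed
  have down: "(\<lambda>n. E (real n - real k - 1/2) / S n) \<longlonglongrightarrow> mass"
  proof (rule LIMSEQ_offset[of _ k])
    have "(\<lambda>n. E (real n - 1/2) / S n * inverse (S (n + k) / S n)) \<longlonglongrightarrow> mass * inverse 1"
      by (intro tendsto_mult lim tendsto_inverse shift) simp
    then have "(\<lambda>n. E (real n - 1/2) / S n * inverse (S (n + k) / S n)) \<longlonglongrightarrow> mass" by simp
    then show "(\<lambda>n. E (real (n + k) - real k - 1/2) / S (n + k)) \<longlonglongrightarrow> mass"
      by (rule Lim_transform_eventually) (use Spos in eventually_elim, simp)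
  qed
  show ?thesis
    unfolding S_def[symmetric]
  proof (rule tendsto_sandwich)
    show "((\<lambda>v::real. E (real (nat \<lfloor>v\<rfloor>) - real k - 1/2) / S (nat \<lfloor>v\<rfloor>)) \<longlongrightarrow> mass) at_top"
      by (rule filterlim_compose[OF down nat_floor_at_top])
    show "((\<lambda>v::real. E (real (nat \<lfloor>v\<rfloor> + k) - 1/2) / S (nat \<lfloor>v\<rfloor>)) \<longlongrightarrow> mass) at_top"
      by (rule filterlim_compose[OF up nat_floor_at_top])
    have n: "real (nat \<lfloor>v\<rfloor>) - real k - 1/2 \<le> v + c \<and> v + c \<le> real (nat \<lfloor>v\<rfloor> + k) - 1/2" if "v \<ge> 0" for v :: real
    proof -
      have "real (nat \<lfloor>v\<rfloor>) \<le> v" "v < real (nat \<lfloor>v\<rfloor>) + 1" using that by linarith+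
      then show ?thesis using k by simp linarith
    qed
    have mono: "E u \<le> E v" if "u \<le> v" for u v
      by (rule antiderivative_mono[of u]) (use that E in auto)
    show "eventually (\<lambda>v. E (real (nat \<lfloor>v\<rfloor>) - real k - 1/2) / S (nat \<lfloor>v\<rfloor>) \<le> E (v + c) / S (nat \<lfloor>v\<rfloor>)) at_top"
      using eventually_ge_at_top[of 0]
      by eventually_elim (use n in \<open>auto intro!: divide_right_mono mono simp: S_def rotation_sum_nonneg\<close>)
    show "eventually (\<lambda>v. E (v + c) / S (nat \<lfloor>v\<rfloor>) \<le> E (real (nat \<lfloor>v\<rfloor> + k) - 1/2) / S (nat \<lfloor>v\<rfloor>)) at_top"
      using eventually_ge_at_top[of 0]
    proof eventually_elim
      case (elim v)
      show ?case using n[OF elim] by (intro divide_right_mono mono) (auto simp: S_def rotation_sum_nonneg)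
    qed
  qed
qed

end

section \<open>Topology of the torus and weak-* limits\<close>

lemma torus_cases_cbox:
  fixes x :: torus
  obtains z where "x = abs_torus z" "z \<in> cbox 0 1"
proof -
  define w where "w = rep_torus x"
  define z :: "real^2" where "z = (\<chi> i. frac (w $ i))"
  have "abs_torus z = abs_torus w"
    by (simp add: abs_torus_eq_iff z_def frac_def)
  moreover have "z \<in> cbox 0 1"
    by (simp add: mem_box_cart z_def less_imp_le[OF frac_lt_1])
  ultimately show ?thesis by (intro that[of z]) (simp_all add: w_def)
qed

lemma compact_UNIV_torus: "compact (UNIV :: torus set)"
proof -
  have "UNIV = abs_torus ` cbox 0 1"
    using torus_cases_cbox by blast
  then show ?thesis
    using compact_continuous_image[OF continuous_on_abs_torus compact_cbox] by metis
qed

lemma continuous_on_torus_iff: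
  fixes f :: "torus \<Rightarrow> 'a::topological_space"
  shows "continuous_on UNIV f \<longleftrightarrow> continuous_on UNIV (\<lambda>z. f (abs_torus z))"
proof
  assume "continuous_on UNIV f"
  then show "continuous_on UNIV (\<lambda>z. f (abs_torus z))"
    by (rule continuous_on_compose2[OF _ continuous_on_abs_torus]) auto
next
  assume *: "continuous_on UNIV (\<lambda>z. f (abs_torus z))"
  show "continuous_on UNIV f"
    unfolding continuous_on_open_vimage[OF open_UNIV]
  proof (intro allI impI)
    fix B :: "'a set" assume "open B"
    with * have "open ((\<lambda>z. f (abs_torus z)) -` B)"
      by (simp add: continuous_on_open_vimage)
    then show "open (f -` B \<inter> UNIV)" by (simp add: open_torus_def vimage_def)
  qed
qed

text \<open>Stands in for a distance, since the torus is given just as a topological space. The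
  cosines make it independent of the representatives, hence continuous.\<close>

definition torus_sep :: "torus \<Rightarrow> torus \<Rightarrow> real" where
  "torus_sep p x = 2 - cos (2 * pi * (rep_torus x $ 1 - rep_torus p $ 1)) - cos (2 * pi * (rep_torus x $ 2 - rep_torus p $ 2))"

lemma torus_sep_nonneg: "torus_sep p x \<ge> 0"
proof -
  have "2 - cos a - cos b \<ge> 0" for a b :: real
    using cos_le_one[of a] cos_le_one[of b] by linarith
  then show ?thesis unfolding torus_sep_def .
qed

lemma torus_sep_eq_0_iff: "torus_sep p x = 0 \<longleftrightarrow> x = p"
proof
  assume "torus_sep p x = 0"
  moreover have "a = 1 \<and> b = 1" if "2 - a - b = 0" "a \<le> 1" "b \<le> 1" for a b :: real
    using that by linarith
  ultimately have "cos (2 * pi * (rep_torus x $ 1 - rep_torus p $ 1)) = 1 \<and> cos (2 * pi * (rep_torus x $ 2 - rep_torus p $ 2)) = 1"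
    unfolding torus_sep_def using cos_le_one by blast
  moreover have "t \<in> \<int>" if "cos (2 * pi * t) = 1" for t :: real
    using that unfolding cos_one_2pi_int by auto
  ultimately have "abs_torus (rep_torus x) = abs_torus (rep_torus p)"
    unfolding abs_torus_eq_iff forall_2 by blast
  then show "x = p" by simp
qed (simp add: torus_sep_def)

lemma torus_sep_pos: "x \<noteq> p \<Longrightarrow> torus_sep p x > 0"
  using torus_sep_nonneg[of p x] torus_sep_eq_0_iff[of p x] by linarith

lemma continuous_torus_sep: "continuous_on UNIV (torus_sep p)"
proof -
  have "torus_sep p (abs_torus z) = 2 - cos (2 * pi * (z $ 1 - rep_torus p $ 1)) - cos (2 * pi * (z $ 2 - rep_torus p $ 2))" for z
  proof -
    have "abs_torus (rep_torus (abs_torus z)) = abs_torus z" by simp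
    then have i: "rep_torus (abs_torus z) $ i - z $ i \<in> \<int>" for i
      unfolding abs_torus_eq_iff by blast
    have "cos (2 * pi * (rep_torus (abs_torus z) $ i - c)) = cos (2 * pi * (z $ i - c))" for i c
    proof -
      obtain n where "rep_torus (abs_torus z) $ i - z $ i = of_int n" using i[of i] by (auto elim: Ints_cases)
      then have "rep_torus (abs_torus z) $ i - c = z $ i - c + of_int n" by linarith
      then have "2 * pi * (rep_torus (abs_torus z) $ i - c) = 2 * pi * (z $ i - c) + 2 * pi * of_int n"
        by (simp only: distrib_left)
      then show ?thesis by (simp add: cos_add)
    qed
    then show ?thesis by (simp add: torus_sep_def)
  qed
  then show ?thesis unfolding continuous_on_torus_iff by (simp add: continuous_intros)
qed

lemma closed_singleton_torus: "closed {p :: torus}"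
proof -
  have "{p} = {x. torus_sep p x = 0}" by (auto simp: torus_sep_eq_0_iff)
  then show ?thesis using closed_Collect_eq[OF continuous_torus_sep continuous_on_const] by simp
qed

text \<open>Constancy on whole neighbourhoods matters: a cutoff that merely takes the value 0 at
  \<open>q\<close> need not keep \<open>\<psi> / \<phi>\<close> bounded there.\<close>

definition torus_cutoff :: "torus \<Rightarrow> torus \<Rightarrow> (torus \<Rightarrow> real) \<Rightarrow> bool" where
  "torus_cutoff p q \<psi> \<longleftrightarrow> continuous_on UNIV \<psi> \<and> (\<forall>x. 0 \<le> \<psi> x) \<and> (\<forall>x. \<psi> x \<le> 1) \<and>
    (\<exists>U. open U \<and> p \<in> U \<and> (\<forall>x\<in>U. \<psi> x = 1)) \<and> (\<exists>V. open V \<and> q \<in> V \<and> (\<forall>x\<in>V. \<psi> x = 0))"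

lemma torus_cutoffD:
  assumes "torus_cutoff p q \<psi>"
  shows "continuous_on UNIV \<psi>" "0 \<le> \<psi> x" "\<psi> x \<le> 1"
    "\<exists>U. open U \<and> p \<in> U \<and> (\<forall>x\<in>U. \<psi> x = 1)" "\<exists>V. open V \<and> q \<in> V \<and> (\<forall>x\<in>V. \<psi> x = 0)"
proof -
  note * = assms[unfolded torus_cutoff_def]
  show "continuous_on UNIV \<psi>" by (rule conjunct1[OF *])
  show "0 \<le> \<psi> x" by (rule conjunct1[OF conjunct2[OF *], rule_format])
  show "\<psi> x \<le> 1" by (rule conjunct1[OF conjunct2[OF conjunct2[OF *]], rule_format])
  show "\<exists>U. open U \<and> p \<in> U \<and> (\<forall>x\<in>U. \<psi> x = 1)"
    by (rule conjunct1[OF conjunct2[OF conjunct2[OF conjunct2[OF *]]]])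
  show "\<exists>V. open V \<and> q \<in> V \<and> (\<forall>x\<in>V. \<psi> x = 0)"
    by (rule conjunct2[OF conjunct2[OF conjunct2[OF conjunct2[OF *]]]])
qed

text \<open>\<open>\<rho>\<close> is an explicit Urysohn function; truncating
  \<open>2 * \<rho> - 1/2\<close> makes it constant where \<open>\<rho>\<close> exceeds 3/4 or is
  below 1/4.\<close>

lemma exists_torus_cutoff:
  assumes "p \<noteq> q"
  shows "\<exists>\<psi>. torus_cutoff p q \<psi>"
proof -
  define \<rho> where "\<rho> x = torus_sep q x / (torus_sep p x + torus_sep q x)" for x
  have pos: "torus_sep p x + torus_sep q x > 0" for x
  proof (cases "x = p")
    case True
    then have "x \<noteq> q" using assms by simp
    then show ?thesis using torus_sep_nonneg[of p x] torus_sep_pos[of x q] by linarith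
  next
    case False
    then show ?thesis using torus_sep_nonneg[of q x] torus_sep_pos[of x p] by linarith
  qed
  have ne: "torus_sep p x + torus_sep q x \<noteq> 0" for x using pos[of x] by simp
  have cont: "continuous_on UNIV \<rho>"
    unfolding \<rho>_def by (intro continuous_on_divide continuous_on_add continuous_torus_sep) (simp add: ne)
  have \<rho>: "\<rho> p = 1" "\<rho> q = 0"
    using pos[of p] by (simp_all add: \<rho>_def torus_sep_eq_0_iff[THEN iffD2])
  define \<psi> where "\<psi> x = max 0 (min 1 (2 * \<rho> x - 1/2))" for x
  have "torus_cutoff p q \<psi>"
    unfolding torus_cutoff_def
  proof (intro conjI allI)
    show "continuous_on UNIV \<psi>" unfolding \<psi>_def by (intro continuous_intros cont)
    have "open {x. 3/4 < \<rho> x}" "open {x. \<rho> x < 1/4}"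
      by (intro open_Collect_less cont continuous_on_const)+
    note op = this
    show "\<exists>U. open U \<and> p \<in> U \<and> (\<forall>x\<in>U. \<psi> x = 1)"
      by (rule exI[of _ "{x. 3/4 < \<rho> x}"]) (use op in \<open>auto simp: \<rho> \<psi>_def\<close>)
    show "\<exists>V. open V \<and> q \<in> V \<and> (\<forall>x\<in>V. \<psi> x = 0)"
      by (rule exI[of _ "{x. \<rho> x < 1/4}"]) (use op in \<open>auto simp: \<rho> \<psi>_def\<close>)
  qed (auto simp: \<psi>_def)
  then show ?thesis by (rule exI[of "torus_cutoff p q"])
qed

section \<open>Two-point measures and limits of empirical measures\<close>

lemma prob_space_eq_two_point_measure:
  fixes p q :: torus
  assumes "prob_space \<nu>" and sets: "sets \<nu> = sets borel" and "p \<noteq> q"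
    and mp: "measure \<nu> {p} = a" and mq: "measure \<nu> {q} = b" and ab: "a + b = 1"
  shows "\<nu> = two_point_measure a p b q"
proof (rule measure_eqI)
  interpret prob_space \<nu> by fact
  show "sets \<nu> = sets (two_point_measure a p b q)" by (simp add: sets sets_two_point_measure)
  fix A assume "A \<in> sets \<nu>"
  then have A: "A \<in> sets borel" by (simp add: sets)
  have sing [simp]: "{x} \<in> events" for x :: torus using closed_singleton_torus by (simp add: sets)
  have space: "space \<nu> = UNIV" using sets_eq_imp_space_eq[OF sets] by simp
  have "prob ({p} \<union> {q}) = prob {p} + prob {q}"
    using \<open>p \<noteq> q\<close> by (intro finite_measure_Union) auto
  then have "prob {p, q} = 1" using mp mq ab by (simp add: insert_commute)
  then have "AE x in \<nu>. x \<in> {p, q}" by (rule AE_prob_1)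
  then have "prob A = prob (A \<inter> {p} \<union> A \<inter> {q})"
    by (intro measure_eq_AE sets.Un sets.Int sing \<open>A \<in> sets \<nu>\<close>) (auto elim!: eventually_mono)
  also have "\<dots> = prob (A \<inter> {p}) + prob (A \<inter> {q})"
    using \<open>p \<noteq> q\<close> \<open>A \<in> sets \<nu>\<close> by (intro finite_measure_Union) auto
  also have "prob (A \<inter> {p}) = a * indicator A p" using mp by (simp add: Int_insert_right indicator_def)
  also have "prob (A \<inter> {q}) = b * indicator A q" using mq by (simp add: Int_insert_right indicator_def)
  finally have "prob A = a * indicator A p + b * indicator A q" .
  moreover have "a \<ge> 0" "b \<ge> 0" using mp mq measure_nonneg[of \<nu> "{p}"] measure_nonneg[of \<nu> "{q}"] by simp_all
  ultimately show "emeasure \<nu> A = emeasure (two_point_measure a p b q) A"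
    unfolding emeasure_two_point_measure[OF A] emeasure_eq_measure
    by (simp add: indicator_def)
qed

lemma two_point_measure_in:
  assumes "a \<ge> 0" "b \<ge> 0" "a + b = 1"
  shows "two_point_measure a p b q \<in> borel_prob_measures"
proof -
  have "space (two_point_measure a p b q) = UNIV"
    using sets_eq_imp_space_eq[OF sets_two_point_measure] by simp
  then have "prob_space (two_point_measure a p b q)"
    using assms by (intro prob_spaceI) (simp add: emeasure_two_point_measure flip: ennreal_plus)
  then show ?thesis by (simp add: borel_prob_measures_def sets_two_point_measure)
qed

lemma integral_two_point_measure:
  fixes f :: "torus \<Rightarrow> real"
  assumes "a \<ge> 0" "b \<ge> 0" "a + b = 1" "p \<noteq> q" and f: "continuous_on UNIV f"
  shows "(\<integral>x. f x \<partial>two_point_measure a p b q) = a * f p + b * f q"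
proof -
  let ?\<mu> = "two_point_measure a p b q"
  interpret prob_space ?\<mu>
    using two_point_measure_in[OF assms(1-3), of p q] by (simp add: borel_prob_measures_def)
  have s: "sets ?\<mu> = sets borel" by (rule sets_two_point_measure)
  have space: "space ?\<mu> = UNIV" using sets_eq_imp_space_eq[OF s] by simp
  have sing [simp]: "{x} \<in> events" for x :: torus using closed_singleton_torus by (simp add: s)
  have "{p, q} \<in> sets borel"
    using borel_closed[OF closed_Un[OF closed_singleton_torus[of p] closed_singleton_torus[of q]]] by (simp add: insert_commute)
  then have "emeasure ?\<mu> {p, q} = ennreal 1"
    using assms by (subst emeasure_two_point_measure) (auto simp flip: ennreal_plus)
  then have "prob {p, q} = 1" by (simp add: emeasure_eq_measure)
  then have AE: "AE x in ?\<mu>. x \<in> {p, q}" by (rule AE_prob_1)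
  have "(\<integral>x. f x \<partial>?\<mu>) = (\<integral>x. f p * indicator {p} x + f q * indicator {q} x \<partial>?\<mu>)"
  proof (rule integral_cong_AE)
    show "f \<in> borel_measurable ?\<mu>"
      using borel_measurable_continuous_onI[OF f] by (simp add: measurable_cong_sets[OF s refl])
    show "(\<lambda>x. f p * indicator {p} x + f q * indicator {q} x) \<in> borel_measurable ?\<mu>"
      by (intro borel_measurable_add borel_measurable_times borel_measurable_const borel_measurable_indicator sing)
    from AE show "AE x in ?\<mu>. f x = f p * indicator {p} x + f q * indicator {q} x"
      by eventually_elim (use \<open>p \<noteq> q\<close> in auto)
  qed
  also have "\<dots> = f p * prob {p} + f q * prob {q}"
    by (subst Bochner_Integration.integral_add) (auto simp: emeasure_eq_measure)
  also have "prob {p} = a"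
    using emeasure_two_point_measure[of "{p}" a p b q] assms closed_singleton_torus
    by (auto simp: emeasure_eq_measure)
  also have "prob {q} = b"
    using emeasure_two_point_measure[of "{q}" a p b q] assms closed_singleton_torus
    by (auto simp: emeasure_eq_measure)
  finally show ?thesis by (simp add: mult.commute)
qed

text \<open>The tent functions \<open>f n\<close> shrink to the indicator of \<open>p\<close>, and
  dominated convergence transfers the integral formula to it.\<close>

lemma measure_singleton_of_integrals:
  assumes "prob_space \<nu>" and sets: "sets \<nu> = sets borel"
    and int: "\<And>f :: torus \<Rightarrow> real. continuous_on UNIV f \<Longrightarrow> (\<integral>x. f x \<partial>\<nu>) = a * f p + b * f q"
    and "p \<noteq> q"
  shows "measure \<nu> {p} = a"
proof -
  interpret prob_space \<nu> by fact
  have space: "space \<nu> = UNIV" using sets_eq_imp_space_eq[OF sets] by simp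
  define f where "f n x = max 0 (1 - real n * torus_sep p x)" for n x
  have cont: "continuous_on UNIV (f n)" for n
    unfolding f_def by (intro continuous_intros continuous_torus_sep)
  have lim: "(\<lambda>n. f n x) \<longlonglongrightarrow> indicator {p} x" for x
  proof (cases "x = p")
    case True
    then show ?thesis by (simp add: f_def torus_sep_eq_0_iff[THEN iffD2])
  next
    case False
    obtain N where N: "real N * torus_sep p x > 1"
      using reals_Archimedean3[OF torus_sep_pos[OF False]] by blast
    have "f n x = 0" if "n \<ge> N" for n
    proof -
      have "real N * torus_sep p x \<le> real n * torus_sep p x"
        using that torus_sep_nonneg by (intro mult_right_mono) auto
      then show ?thesis using N by (simp add: f_def)
    qed
    then have "eventually (\<lambda>n. f n x = 0) sequentially" unfolding eventually_sequentially by blast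
    then show ?thesis using False by (simp add: tendsto_eventually)
  qed
  have meas: "f n \<in> borel_measurable \<nu>" for n
    using borel_measurable_continuous_onI[OF cont] by (simp add: measurable_cong_sets[OF sets refl])
  have "(\<lambda>n. \<integral>x. f n x \<partial>\<nu>) \<longlonglongrightarrow> (\<integral>x. indicator {p} x \<partial>\<nu>)"
  proof (rule integral_dominated_convergence[where w="\<lambda>_. 1"])
    show "AE x in \<nu>. norm (f n x) \<le> 1" for n
      using torus_sep_nonneg by (simp add: f_def)
    show "indicator {p} \<in> borel_measurable \<nu>"
      using closed_singleton_torus[of p] sets by (intro borel_measurable_indicator) simp
  qed (use lim meas in auto)
  moreover have "(\<lambda>n. \<integral>x. f n x \<partial>\<nu>) \<longlonglongrightarrow> a * 1 + b * 0"
    unfolding int[OF cont] using lim[of p] lim[of q] \<open>p \<noteq> q\<close> by (intro tendsto_intros) auto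
  ultimately have "(\<integral>x. indicator {p} x \<partial>\<nu>) = a * 1 + b * 0" by (rule LIMSEQ_unique)
  then show ?thesis using closed_singleton_torus[of p] by (simp add: space)
qed

text \<open>The topology is known only through its generators, so convergence is propagated by
  induction over \<open>generate_topology_on\<close>.\<close>

lemma weak_star_closureI:
  assumes "\<nu> \<in> borel_prob_measures" and "F \<noteq> bot"
    and "eventually (\<lambda>n. \<mu> n \<in> borel_prob_measures) F" "eventually (\<lambda>n. \<mu> n \<in> S) F"
    and lim: "\<And>f :: torus \<Rightarrow> real. continuous_on UNIV f \<Longrightarrow> ((\<lambda>n. \<integral>x. f x \<partial>\<mu> n) \<longlongrightarrow> (\<integral>x. f x \<partial>\<nu>)) F"
  shows "\<nu> \<in> weak_star_topology closure_of S"
  unfolding in_closure_of topspace_weak_star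
proof (intro conjI allI impI)
  fix O' assume O: "\<nu> \<in> O' \<and> openin weak_star_topology O'"
  then have "generate_topology_on {{\<mu> \<in> borel_prob_measures. (\<integral>x. f x \<partial>\<mu>) \<in> U} | (f :: torus \<Rightarrow> real) U.
        continuous_on UNIV f \<and> open U} O'"
    by (simp add: weak_star_topology_def openin_topology_generated_by_iff)
  then have "\<nu> \<in> O' \<longrightarrow> eventually (\<lambda>n. \<mu> n \<in> O') F"
  proof induction
    case (Basis O')
    then obtain f :: "torus \<Rightarrow> real" and U where O': "O' = {\<mu> \<in> borel_prob_measures. (\<integral>x. f x \<partial>\<mu>) \<in> U}" "continuous_on UNIV f" "open U"
      by blast
    show ?case
    proof
      assume "\<nu> \<in> O'"
      then have "eventually (\<lambda>n. (\<integral>x. f x \<partial>\<mu> n) \<in> U) F"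
        using topological_tendstoD[OF lim[OF O'(2)] O'(3)] O'(1) by simp
      with assms(3) show "eventually (\<lambda>n. \<mu> n \<in> O') F"
        by eventually_elim (simp add: O'(1))
    qed
  next
    case (Int a b)
    then show ?case by (auto intro: eventually_conj)
  next
    case (UN K)
    show ?case
    proof
      assume "\<nu> \<in> \<Union> K"
      then obtain k where k: "k \<in> K" "\<nu> \<in> k" by blast
      then have "eventually (\<lambda>n. \<mu> n \<in> k) F" using UN by blast
      then show "eventually (\<lambda>n. \<mu> n \<in> \<Union> K) F" by eventually_elim (use k in blast)
    qed
  qed simp
  then have "eventually (\<lambda>n. \<mu> n \<in> S \<and> \<mu> n \<in> O') F"
    using O assms(4) by (auto intro: eventually_conj)
  then show "\<exists>y. y \<in> S \<and> y \<in> O'" using eventually_happens'[OF assms(2)] by blast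
qed (rule assms(1))

text \<open>The filter is left general so that the lemma serves both for the full limit in time and
  for a sequence of times.\<close>

lemma p_omega_memberI:
  assumes "\<nu> \<in> borel_prob_measures" and orbit: "continuous_on UNIV (\<lambda>s. \<Phi> s x)"
    and t: "filterlim t at_top F" and "F \<noteq> bot"
    and lim: "\<And>f :: torus \<Rightarrow> real. continuous_on UNIV f \<Longrightarrow>
      ((\<lambda>n. (\<integral>y. f y \<partial>empirical_measure \<Phi> (t n) x)) \<longlongrightarrow> (\<integral>x. f x \<partial>\<nu>)) F"
  shows "\<nu> \<in> p_omega \<Phi> x"
  unfolding p_omega_def
proof
  fix T :: real assume T: "T \<in> {0<..}"
  have ev: "eventually (\<lambda>n. t n \<ge> T) F" using t by (simp add: filterlim_at_top)
  show "\<nu> \<in> weak_star_topology closure_of {empirical_measure \<Phi> t x |t. T \<le> t}"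
  proof (rule weak_star_closureI[where \<mu>="\<lambda>n. empirical_measure \<Phi> (t n) x" and F=F])
    show "eventually (\<lambda>n. empirical_measure \<Phi> (t n) x \<in> borel_prob_measures) F"
      using ev by eventually_elim (use T in \<open>auto intro!: empirical_measure_in orbit\<close>)
    show "eventually (\<lambda>n. empirical_measure \<Phi> (t n) x \<in> {empirical_measure \<Phi> t x |t. T \<le> t}) F"
      using ev by eventually_elim auto
  qed (fact assms(1), fact assms(4), rule lim)
qed

text \<open>Otherwise a small ball around the integral against \<open>\<nu>\<close> defines a weak-*
  neighbourhood of \<open>\<nu>\<close> that all late empirical measures miss.\<close>

lemma p_omega_integral:
  assumes \<nu>: "\<nu> \<in> p_omega \<Phi> x" and f: "continuous_on UNIV f"
    and lim: "((\<lambda>t. (\<integral>y. f y \<partial>empirical_measure \<Phi> t x)) \<longlongrightarrow> (l::real)) at_top"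
  shows "(\<integral>y. f y \<partial>\<nu>) = l"
proof (rule ccontr)
  assume ne: "(\<integral>y. f y \<partial>\<nu>) \<noteq> l"
  define e where "e = dist (\<integral>y. f y \<partial>\<nu>) l / 2"
  have e: "e > 0" using ne by (simp add: e_def)
  obtain T where T: "\<And>t. t \<ge> T \<Longrightarrow> dist (\<integral>y. f y \<partial>empirical_measure \<Phi> t x) l < e"
    using tendstoD[OF lim e] by (auto simp: eventually_at_top_linorder)
  \<comment> \<open>The intersection in \<open>p_omega\<close> runs over positive times, hence the
    maximum with 1.\<close>
  let ?S = "{empirical_measure \<Phi> t x |t. max T 1 \<le> t}"
  have "\<nu> \<in> weak_star_topology closure_of ?S"
    using \<nu> unfolding p_omega_def by (rule INT_D[where a = "max T 1"]) simp
  then have cl: "\<nu> \<in> borel_prob_measures \<and>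
      (\<forall>O'. \<nu> \<in> O' \<and> openin weak_star_topology O' \<longrightarrow> (\<exists>y. y \<in> ?S \<and> y \<in> O'))"
    unfolding in_closure_of topspace_weak_star .
  let ?O = "{\<mu> \<in> borel_prob_measures. (\<integral>x. f x \<partial>\<mu>) \<in> ball (\<integral>y. f y \<partial>\<nu>) e}"
  have "openin weak_star_topology ?O"
    unfolding weak_star_topology_def openin_topology_generated_by_iff
    using f by (intro generate_topology_on.Basis CollectI exI[of _ f] exI[of _ "ball (\<integral>y. f y \<partial>\<nu>) e"] conjI refl open_ball)
  moreover have "\<nu> \<in> ?O" using conjunct1[OF cl] e by simp
  ultimately have "\<exists>y. y \<in> ?S \<and> y \<in> ?O"
    by (intro conjunct2[OF cl, rule_format] conjI)
  then obtain y where y: "y \<in> ?S" "y \<in> ?O" by (elim exE conjE)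
  from y(1) obtain t where ty: "y = empirical_measure \<Phi> t x" "t \<ge> max T 1"
    unfolding mem_Collect_eq by (elim exE conjE)
  with y(2) have t: "t \<ge> max T 1" "empirical_measure \<Phi> t x \<in> ?O" by simp_all
  then have "dist (\<integral>y. f y \<partial>\<nu>) (\<integral>y. f y \<partial>empirical_measure \<Phi> t x) < e" by simp
  moreover have "dist (\<integral>y. f y \<partial>empirical_measure \<Phi> t x) l < e" using t T by simp
  ultimately have "dist (\<integral>y. f y \<partial>\<nu>) l < e + e"
    using dist_triangle[of "\<integral>y. f y \<partial>\<nu>" l "\<integral>y. f y \<partial>empirical_measure \<Phi> t x"] by linarith
  then show False by (simp add: e_def)
qed

lemma p_omega_subset: "p_omega \<Phi> x \<subseteq> borel_prob_measures"
proof
  fix \<nu> assume "\<nu> \<in> p_omega \<Phi> x"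
  then have "\<nu> \<in> weak_star_topology closure_of {empirical_measure \<Phi> t x |t. 1 \<le> t}"
    unfolding p_omega_def by (rule INT_D[where a = 1]) simp
  then show "\<nu> \<in> borel_prob_measures"
    unfolding in_closure_of topspace_weak_star by (rule conjunct1)
qed

section \<open>Orbits of the reparametrized flow\<close>

text \<open>Gronwall's inequality in differential form: \<open>v t * exp (- K * t)\<close> does not
  increase.\<close>

lemma exponential_bound:
  fixes v :: "real \<Rightarrow> real"
  assumes v: "\<And>t. t0 \<le> t \<Longrightarrow> (v has_real_derivative v' t) (at t)" "\<And>t. t0 \<le> t \<Longrightarrow> v' t \<le> K * v t"
    and "t0 \<le> t"
  shows "v t \<le> v t0 * exp (K * (t - t0))"
proof -
  have "v t * exp (- K * t) \<le> v t0 * exp (- K * t0)"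
  proof (rule DERIV_nonpos_imp_nonincreasing[OF \<open>t0 \<le> t\<close>])
    fix x assume x: "t0 \<le> x"
    have "((\<lambda>t. v t * exp (- K * t)) has_real_derivative v' x * exp (- K * x) + v x * (exp (- K * x) * (- K))) (at x)"
      by (auto intro!: derivative_eq_intros v(1)[OF x])
    moreover have "v' x * exp (- K * x) + v x * (exp (- K * x) * (- K)) \<le> 0"
      using mult_right_mono[OF v(2)[OF x], of "exp (- K * x)"] by (simp add: algebra_simps)
    ultimately show "\<exists>y. ((\<lambda>t. v t * exp (- K * t)) has_real_derivative y) (at x) \<and> y \<le> 0" by blast
  qed
  then have "v t * exp (- K * t) * exp (K * t) \<le> v t0 * exp (- K * t0) * exp (K * t)"
    by (rule mult_right_mono) simp
  then show ?thesis by (simp add: mult.assoc flip: exp_add) (simp add: algebra_simps)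
qed

lemma cesaro_limit:
  fixes h :: "real \<Rightarrow> real"
  assumes cont: "continuous_on UNIV h" and lim: "(h \<longlongrightarrow> l) at_top"
  shows "((\<lambda>t. integral {0..t} h / t) \<longlongrightarrow> l) at_top"
proof (rule tendstoI)
  fix e :: real assume e: "e > 0"
  have int: "h integrable_on {a..b}" for a b
    by (rule integrable_continuous_real, rule continuous_on_subset[OF cont]) auto
  obtain N0 where N0: "\<And>t. t \<ge> N0 \<Longrightarrow> dist (h t) l < e / 2"
    using tendstoD[OF lim, of "e/2"] e by (auto simp: eventually_at_top_linorder)
  define N where "N = max N0 1"
  define B where "B = \<bar>integral {0..N} h - N * l\<bar>"
  have "eventually (\<lambda>t. t > max N (2 * B / e)) at_top" by (rule eventually_gt_at_top)
  then show "eventually (\<lambda>t. dist (integral {0..t} h / t) l < e) at_top"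
  proof eventually_elim
    case (elim t)
    have t: "t > N" "t > 0" "2 * B / e < t" using elim by (auto simp: N_def)
    have split: "integral {0..t} h = integral {0..N} h + integral {N..t} h"
      using t by (intro Henstock_Kurzweil_Integration.integral_combine[symmetric] int) (auto simp: N_def)
    have "norm (integral {N..t} (\<lambda>s. h s - l)) \<le> integral {N..t} (\<lambda>s. e / 2)"
    proof (rule integral_norm_bound_integral)
      show "(\<lambda>s. h s - l) integrable_on {N..t}" by (intro integrable_diff int) auto
      show "norm (h s - l) \<le> e / 2" if "s \<in> {N..t}" for s
        using N0[of s] that by (auto simp: N_def dist_real_def)
    qed auto
    moreover have "integral {N..t} (\<lambda>s. h s - l) = integral {N..t} h - (t - N) * l"
      using t by (subst Henstock_Kurzweil_Integration.integral_diff) (auto intro: int)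
    ultimately have "\<bar>integral {N..t} h - (t - N) * l\<bar> \<le> (t - N) * (e / 2)" using t by simp
    moreover have "(t - N) * (e / 2) \<le> t * (e / 2)" using e by (intro mult_right_mono) (auto simp: N_def)
    moreover have "B < t * (e / 2)" using t(3) e by (simp add: field_simps)
    moreover have "integral {0..t} h - t * l = (integral {0..N} h - N * l) + (integral {N..t} h - (t - N) * l)"
      by (simp add: split algebra_simps)
    ultimately have "\<bar>integral {0..t} h - t * l\<bar> < t * (e / 2) + t * (e / 2)"
      unfolding B_def by linarith
    then have "\<bar>integral {0..t} h - t * l\<bar> < t * e" by (simp add: algebra_simps)
    moreover have "integral {0..t} h / t - l = (integral {0..t} h - t * l) / t" using t by (simp add: field_simps)
    ultimately show ?case using t by (simp add: dist_real_def pos_divide_less_eq mult.commute)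
  qed
qed

lemma exists_antiderivative:
  fixes g :: "real \<Rightarrow> real"
  assumes "continuous_on UNIV g"
  shows "\<exists>E. \<forall>u. (E has_real_derivative g u) (at u)"
proof -
  have "\<exists>E. \<forall>x :: real. -\<infinity> < ereal x \<longrightarrow> ereal x < \<infinity> \<longrightarrow> (E has_vector_derivative g x) (at x)"
    using assms by (intro einterval_antiderivative) (auto simp: continuous_on_eq_continuous_at)
  then show ?thesis by (auto simp: has_real_derivative_iff_has_vector_derivative)
qed

text \<open>The function is continued to the left by its value at 0, so that the derivative at 0
  exists from both sides.\<close>

lemma exists_antiderivative_halfline:
  fixes g :: "real \<Rightarrow> real"
  assumes "continuous_on {0..} g"
  shows "\<exists>E. \<forall>u\<ge>0. (E has_real_derivative g u) (at u)"
proof -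
  have "continuous_on UNIV (\<lambda>u. g (max u 0))"
    by (rule continuous_on_compose2[OF assms]) (auto intro!: continuous_intros)
  then obtain E where E: "\<forall>u. (E has_real_derivative g (max u 0)) (at u)"
    using exists_antiderivative by blast
  have "(E has_real_derivative g u) (at u)" if "u \<ge> 0" for u
    using E[rule_format, of u] that by (simp add: max_def)
  then show ?thesis by blast
qed

lemma abs_torus_add_cong: "abs_torus x = abs_torus y \<Longrightarrow> abs_torus (x + v) = abs_torus (y + v)"
  by (simp add: abs_torus_eq_iff)

section \<open>Orbits as motions on a line\<close>

locale stopped_linear_flow =
  fixes \<alpha> :: real and p q :: torus and \<phi> :: "torus \<Rightarrow> real" and \<Phi> :: "real \<Rightarrow> torus \<Rightarrow> torus"
  assumes flow: "reparametrized_linear_flow \<alpha> p q \<phi> \<Phi>"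
begin

definition lift :: "real^2 \<Rightarrow> real" where "lift z = \<phi> (abs_torus z)"

lemma pq: "p \<noteq> q" and phi_p: "\<phi> p = 0" and phi_q: "\<phi> q = 0"
  and phi_pos: "x \<noteq> p \<Longrightarrow> x \<noteq> q \<Longrightarrow> \<phi> x > 0"
  and hess_p: "positive_definite (torus_hessian \<phi> p)" and hess_q: "positive_definite (torus_hessian \<phi> q)"
  using flow by (auto simp: reparametrized_linear_flow_def)

lemma phi_nonneg: "\<phi> x \<ge> 0"
  using phi_p phi_q phi_pos[of x] by (cases "x = p \<or> x = q") auto

lemma phi_eq_0: "\<phi> x = 0 \<Longrightarrow> x = p \<or> x = q"
  using phi_pos[of x] by force

lemma lift_nonneg: "lift z \<ge> 0"
  by (simp add: lift_def phi_nonneg)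

lemma lift_C2: "C_k 2 lift"
proof -
  have "C_k (Suc 2) lift"
    using flow by (simp add: reparametrized_linear_flow_def torus_C_k_def lift_def[abs_def] numeral_3_eq_3 numeral_2_eq_2)
  then show ?thesis by (rule C_k_Suc_imp)
qed

lemma continuous_lift: "continuous_on S lift"
proof -
  have "C_k 1 lift" using C_k_Suc_imp[of 1 lift] lift_C2 by (simp add: numeral_2_eq_2)
  then have "C_k 0 lift" using C_k_Suc_imp[of 0 lift] by simp
  then show ?thesis by (auto intro: continuous_on_subset)
qed

lemma continuous_phi: "continuous_on UNIV \<phi>"
  unfolding continuous_on_torus_iff using continuous_lift[of UNIV] by (simp add: lift_def[abs_def])

lemma lift_periodic: "abs_torus x = abs_torus y \<Longrightarrow> lift x = lift y"
  by (simp add: lift_def)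

text \<open>The partial derivatives are continuous and periodic, hence bounded by their maxima on
  the unit square.\<close>

lemma lift_lipschitz: "\<exists>L>0. \<forall>x y. \<bar>lift x - lift y\<bar> \<le> L * norm (x - y)"
proof -
  have bounded: "\<exists>M. \<forall>z. \<bar>partial_deriv i lift z\<bar> \<le> M" for i
  proof -
    have "C_k 1 (\<lambda>z. frechet_derivative lift (at z) (axis i 1))"
      using lift_C2 by (simp add: numeral_2_eq_2)
    then have "C_k 0 (\<lambda>z. frechet_derivative lift (at z) (axis i 1))"
      unfolding One_nat_def by (rule C_k_Suc_imp)
    then have cont: "continuous_on (cbox 0 1) (partial_deriv i lift)"
      by (auto simp: partial_deriv_def[abs_def] intro: continuous_on_subset)
    from compact_imp_bounded[OF compact_continuous_image[OF this compact_cbox]]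
    obtain M where M: "\<And>z. z \<in> cbox 0 1 \<Longrightarrow> \<bar>partial_deriv i lift z\<bar> \<le> M"
      unfolding bounded_iff by auto
    have "\<bar>partial_deriv i lift z\<bar> \<le> M" for z
    proof -
      obtain w where w: "abs_torus z = abs_torus w" "w \<in> cbox 0 1" using torus_cases_cbox by blast
      define c where "c = z - w"
      have "lift (y + c) = lift y" for y
        using w(1) by (intro lift_periodic) (simp add: c_def abs_torus_eq_iff)
      then have "partial_deriv i lift (w + c) = partial_deriv i lift w" by (rule partial_deriv_periodic)
      then show ?thesis using M[OF w(2)] by (simp add: c_def)
    qed
    then show ?thesis by blast
  qed
  obtain M1 M2 where M: "\<And>z. \<bar>partial_deriv 1 lift z\<bar> \<le> M1" "\<And>z. \<bar>partial_deriv 2 lift z\<bar> \<le> M2"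
    using bounded[of 1] bounded[of 2] by blast
  have M0: "M1 \<ge> 0" "M2 \<ge> 0" using M[of 0] by linarith+
  have "\<bar>lift x - lift y\<bar> \<le> (M1 + M2 + 1) * norm (x - y)" for x y
  proof -
    define v where "v = x - y"
    have "\<exists>t. 0 < t \<and> t < 1 \<and> lift (y + 1 *\<^sub>R v) - lift (y + 0 *\<^sub>R v) = (1 - 0) * frechet_derivative lift (at (y + t *\<^sub>R v)) v"
      by (rule MVT2) (auto intro!: deriv_along_line[OF lift_C2])
    then obtain t where t: "lift x - lift y = frechet_derivative lift (at (y + t *\<^sub>R v)) v" by (auto simp: v_def)
    have "linear (frechet_derivative lift (at (y + t *\<^sub>R v)))"
      by (rule has_derivative_linear[OF C2_derivative[OF lift_C2]])
    then have "frechet_derivative lift (at (y + t *\<^sub>R v)) (v$1 *\<^sub>R axis 1 1 + v$2 *\<^sub>R axis 2 1) =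
        v$1 * partial_deriv 1 lift (y + t *\<^sub>R v) + v$2 * partial_deriv 2 lift (y + t *\<^sub>R v)"
      by (simp add: partial_deriv_def linear_add linear_scale)
    then have "lift x - lift y = v$1 * partial_deriv 1 lift (y + t *\<^sub>R v) + v$2 * partial_deriv 2 lift (y + t *\<^sub>R v)"
      unfolding t vec2_eq_axis[of v, symmetric] .
    also have "\<bar>\<dots>\<bar> \<le> \<bar>v$1\<bar> * \<bar>partial_deriv 1 lift (y + t *\<^sub>R v)\<bar> + \<bar>v$2\<bar> * \<bar>partial_deriv 2 lift (y + t *\<^sub>R v)\<bar>"
      by (rule order_trans[OF abs_triangle_ineq]) (simp add: abs_mult)
    also have "\<dots> \<le> norm v * M1 + norm v * M2"
      by (intro add_mono mult_mono M component_le_norm_cart) auto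
    also have "\<dots> \<le> (M1 + M2 + 1) * norm v" by (simp add: algebra_simps)
    finally show ?thesis by (simp add: v_def)
  qed
  then show ?thesis using M0 by (intro exI[of _ "M1 + M2 + 1"]) auto
qed

text \<open>The velocity is parallel to \<open>linear_field \<alpha>\<close>, so
  \<open>\<gamma> t $ 2 - \<alpha> * \<gamma> t $ 1\<close> is constant and a scalar
  \<open>s\<close> describes the motion. The given lift may start at another representative than
  \<open>z\<close>, which is corrected by an integer translation.\<close>

lemma lift_orbit:
  "\<exists>s. s 0 = 0 \<and> (\<forall>t. \<Phi> t (abs_torus z) = abs_torus (z + s t *\<^sub>R linear_field \<alpha>)) \<and>
    (\<forall>t. (s has_real_derivative lift (z + s t *\<^sub>R linear_field \<alpha>)) (at t))"
proof -
  let ?x = "abs_torus z"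
  have "\<Phi> 0 ?x = ?x" "is_integral_curve (\<lambda>x. \<phi> x *\<^sub>R linear_field \<alpha>) (\<lambda>t. \<Phi> t ?x)"
    using flow by (auto simp: reparametrized_linear_flow_def is_flow_of_def)
  then obtain \<gamma> where \<gamma>: "\<And>t. \<Phi> t ?x = abs_torus (\<gamma> t)"
    "\<And>t. (\<gamma> has_vector_derivative \<phi> (\<Phi> t ?x) *\<^sub>R linear_field \<alpha>) (at t)"
    and \<gamma>0: "abs_torus (\<gamma> 0) = ?x"
    unfolding is_integral_curve_def by metis
  have comp: "((\<lambda>t. \<gamma> t $ i) has_real_derivative (\<phi> (\<Phi> t ?x) *\<^sub>R linear_field \<alpha>) $ i) (at t)" for t i
    using bounded_linear.has_vector_derivative[OF bounded_linear_vec_nth \<gamma>(2)[of t], of i]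
    by (simp add: has_real_derivative_iff_has_vector_derivative)
  define s where "s t = \<gamma> t $ 1 - \<gamma> 0 $ 1" for t
  have s': "(s has_real_derivative \<phi> (\<Phi> t ?x)) (at t)" for t
    using comp[of 1 t] unfolding s_def
    by (auto intro!: derivative_eq_intros simp: linear_field_def)
  have "((\<lambda>t. \<gamma> t $ 2 - \<alpha> * \<gamma> t $ 1) has_real_derivative 0) (at t)" for t
    using comp[of 1 t] comp[of 2 t]
    by (auto intro!: derivative_eq_intros simp: linear_field_def)
  then have "\<gamma> t $ 2 - \<alpha> * \<gamma> t $ 1 = \<gamma> 0 $ 2 - \<alpha> * \<gamma> 0 $ 1" for t
    using DERIV_isconst_all[of "\<lambda>t. \<gamma> t $ 2 - \<alpha> * \<gamma> t $ 1" t 0] by blast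
  then have "\<gamma> t $ 2 - \<gamma> 0 $ 2 = \<alpha> * s t" for t
    by (simp add: s_def algebra_simps)
  then have "\<gamma> t = \<gamma> 0 + s t *\<^sub>R linear_field \<alpha>" for t
    by (simp add: vec_eq_iff forall_2 linear_field_def s_def algebra_simps)
  then have orb: "\<Phi> t ?x = abs_torus (z + s t *\<^sub>R linear_field \<alpha>)" for t
    using \<gamma>(1)[of t] abs_torus_add_cong[OF \<gamma>0] by metis
  show ?thesis
  proof (intro exI[of _ s] conjI allI)
    show "s 0 = 0" by (simp add: s_def)
    show "\<Phi> t ?x = abs_torus (z + s t *\<^sub>R linear_field \<alpha>)" for t by (rule orb)
    show "(s has_real_derivative lift (z + s t *\<^sub>R linear_field \<alpha>)) (at t)" for t
      using s'[of t] by (simp add: orb lift_def)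
  qed
qed

abbreviation ray :: "real^2 \<Rightarrow> real \<Rightarrow> real^2" where
  "ray z u \<equiv> z + u *\<^sub>R linear_field \<alpha>"

text \<open>The reparametrized flow moves \<open>z\<close> in time \<open>t\<close> as far as the linear flow does in time \<open>clock z t\<close>.\<close>

definition clock :: "real^2 \<Rightarrow> real \<Rightarrow> real" where
  "clock z = (SOME s. s 0 = 0 \<and> (\<forall>t. \<Phi> t (abs_torus z) = abs_torus (z + s t *\<^sub>R linear_field \<alpha>)) \<and>
    (\<forall>t. (s has_real_derivative lift (z + s t *\<^sub>R linear_field \<alpha>)) (at t)))"

lemma clock_0: "clock z 0 = 0"
  and flow_clock: "\<Phi> t (abs_torus z) = abs_torus (ray z (clock z t))"
  and clock_deriv: "(clock z has_real_derivative lift (ray z (clock z t))) (at t)"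
  using someI_ex[OF lift_orbit[of z]] unfolding clock_def[symmetric] by blast+

lemma clock_mono: "t \<le> t' \<Longrightarrow> clock z t \<le> clock z t'"
  by (rule DERIV_nonneg_imp_nondecreasing) (use clock_deriv lift_nonneg in blast)+

lemma continuous_clock: "continuous_on UNIV (clock z)"
  by (rule DERIV_continuous_on[OF has_field_derivative_at_within[OF clock_deriv]])

lemma orbit_continuous: "continuous_on UNIV (\<lambda>t. \<Phi> t x)"
proof -
  have "is_integral_curve (\<lambda>x. \<phi> x *\<^sub>R linear_field \<alpha>) (\<lambda>t. \<Phi> t x)"
    using flow by (auto simp: reparametrized_linear_flow_def is_flow_of_def)
  then show ?thesis by (rule continuous_is_integral_curve)
qed

text \<open>A flow is merely a family of integral curves here, so dependence on the initial point
  and permanence at a zero of the speed are derived from the Lipschitz bound. Squared differences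
  are used because they are differentiable.\<close>

lemma clock_gronwall:
  obtains K where "K \<ge> 0" "\<And>z z' t. t \<ge> 0 \<Longrightarrow> \<bar>clock z t - clock z' t\<bar> \<le> norm (z - z') * exp (K * t)"
    "\<And>z t0 t. t \<ge> t0 \<Longrightarrow> lift (ray z (clock z t0)) = 0 \<Longrightarrow> clock z t = clock z t0"
proof -
  obtain L where L: "L > 0" "\<And>x y. \<bar>lift x - lift y\<bar> \<le> L * norm (x - y)" using lift_lipschitz by blast
  define N where "N = norm (linear_field \<alpha>)"
  define K where "K = L * (1 + 2 * N)"
  have N: "N \<ge> 0" by (simp add: N_def)
  have K: "K \<ge> 0" using L N by (simp add: K_def)
  \<comment> \<open>The mixed term is split by
    \<open>2 * \<bar>w\<bar> * \<rho> \<le> w\<^sup>2 + \<rho>\<^sup>2\<close>, which explains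
    \<open>K\<close>; the square root taken later halves it. The case \<open>\<rho> = 0\<close>
    gives the permanence.\<close>
  have key: "2 * w * (lift x - lift y) \<le> K * (w\<^sup>2 + \<rho>\<^sup>2)" if "norm (x - y) \<le> \<rho> + \<bar>w\<bar> * N" "\<rho> \<ge> 0" for w \<rho> :: real and x y
  proof -
    have "2 * w * (lift x - lift y) \<le> 2 * \<bar>w\<bar> * \<bar>lift x - lift y\<bar>"
      by (metis abs_ge_self abs_mult abs_numeral)
    also have "\<dots> \<le> 2 * \<bar>w\<bar> * (L * (\<rho> + \<bar>w\<bar> * N))"
      using L(1) by (intro mult_left_mono order_trans[OF L(2) mult_left_mono[OF that(1)]]) auto
    also have "\<dots> = L * (2 * \<bar>w\<bar> * \<rho>) + 2 * L * N * w\<^sup>2"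
      by (simp add: algebra_simps power2_eq_square)
    also have "\<dots> \<le> L * (w\<^sup>2 + \<rho>\<^sup>2) + 2 * L * N * (w\<^sup>2 + \<rho>\<^sup>2)"
    proof (intro add_mono mult_left_mono)
      show "2 * \<bar>w\<bar> * \<rho> \<le> w\<^sup>2 + \<rho>\<^sup>2" using sum_squares_bound[of "\<bar>w\<bar>" \<rho>] by simp
    qed (use L N in auto)
    also have "\<dots> = K * (w\<^sup>2 + \<rho>\<^sup>2)" by (simp add: K_def algebra_simps)
    finally show ?thesis .
  qed
  show ?thesis
  proof (rule that[of "K / 2"])
    show "K / 2 \<ge> 0" using K by simp
    fix z z' :: "real^2" and t :: real assume t: "t \<ge> 0"
    define w where "w t = clock z t - clock z' t" for t
    define \<rho> where "\<rho> = norm (z - z')"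
    let ?x = "\<lambda>t. ray z (clock z t)" and ?y = "\<lambda>t. ray z' (clock z' t)"
    have der: "((\<lambda>t. (w t)\<^sup>2 + \<rho>\<^sup>2) has_real_derivative 2 * w t * (lift (?x t) - lift (?y t))) (at t)" for t
      unfolding w_def by (auto intro!: derivative_eq_intros clock_deriv)
    have "(w t)\<^sup>2 + \<rho>\<^sup>2 \<le> ((w 0)\<^sup>2 + \<rho>\<^sup>2) * exp (K * (t - 0))"
    proof (rule exponential_bound[OF der _ t])
      fix t
      have eq: "?x t - ?y t = (z - z') + w t *\<^sub>R linear_field \<alpha>" by (simp add: w_def algebra_simps)
      have "norm (?x t - ?y t) \<le> \<rho> + \<bar>w t\<bar> * N"
        unfolding eq \<rho>_def N_def using norm_triangle_ineq[of "z - z'" "w t *\<^sub>R linear_field \<alpha>"] by simp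
      then show "2 * w t * (lift (?x t) - lift (?y t)) \<le> K * ((w t)\<^sup>2 + \<rho>\<^sup>2)"
        by (rule key) (simp add: \<rho>_def)
    qed
    then have "(w t)\<^sup>2 + \<rho>\<^sup>2 \<le> \<rho>\<^sup>2 * exp (K * t)" by (simp add: w_def clock_0)
    then have "(w t)\<^sup>2 \<le> \<rho>\<^sup>2 * exp (K * t)" using zero_le_power2[of \<rho>] by linarith
    also have "\<dots> = (\<rho> * exp (K / 2 * t))\<^sup>2"
      by (simp add: power_mult_distrib flip: exp_double)
    finally have "\<bar>w t\<bar> \<le> \<bar>\<rho> * exp (K / 2 * t)\<bar>" by (simp only: abs_le_square_iff)
    then show "\<bar>clock z t - clock z' t\<bar> \<le> norm (z - z') * exp (K / 2 * t)"
      by (simp add: w_def \<rho>_def abs_mult)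
  next
    fix z :: "real^2" and t0 t :: real assume t: "t0 \<le> t" and zero: "lift (ray z (clock z t0)) = 0"
    define w where "w t = clock z t - clock z t0" for t
    let ?x = "\<lambda>t. ray z (clock z t)"
    have der: "((\<lambda>t. (w t)\<^sup>2) has_real_derivative 2 * w t * (lift (?x t) - lift (?x t0))) (at t)" for t
      unfolding w_def zero by (auto intro!: derivative_eq_intros clock_deriv)
    have "(w t)\<^sup>2 \<le> (w t0)\<^sup>2 * exp (K * (t - t0))"
    proof (rule exponential_bound[OF der _ t])
      fix t
      have "?x t - ?x t0 = w t *\<^sub>R linear_field \<alpha>" by (simp add: w_def algebra_simps)
      then have "norm (?x t - ?x t0) \<le> 0 + \<bar>w t\<bar> * N" by (simp add: N_def)
      from key[OF this] show "2 * w t * (lift (?x t) - lift (?x t0)) \<le> K * (w t)\<^sup>2" by simp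
    qed
    then have "(w t)\<^sup>2 \<le> 0" by (simp add: w_def)
    then show "clock z t = clock z t0" by (simp add: w_def)
  qed
qed

text \<open>An unbounded clock reaches \<open>u\<close> by the intermediate value theorem; with
  speed 0 there it would stay at \<open>u\<close> forever.\<close>

lemma clock_unbounded_lift_pos:
  assumes unb: "filterlim (clock z) at_top at_top" and "u \<ge> 0"
  shows "lift (ray z u) > 0"
proof (rule ccontr)
  assume "\<not> lift (ray z u) > 0"
  then have zero: "lift (ray z u) = 0" using lift_nonneg[of "ray z u"] by simp
  have "eventually (\<lambda>t. clock z t \<ge> u + 1 \<and> t \<ge> 0) at_top"
    using unb by (intro eventually_conj eventually_ge_at_top) (simp add: filterlim_at_top)
  then obtain T where T: "clock z T \<ge> u + 1" "T \<ge> 0"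
    by (auto simp: eventually_at_top_linorder)
  have "\<exists>t0\<ge>0. t0 \<le> T \<and> clock z t0 = u"
    by (rule IVT') (use T assms clock_0 continuous_on_subset[OF continuous_clock] in auto)
  then obtain t0 where t0: "0 \<le> t0" "t0 \<le> T" "clock z t0 = u" by blast
  have "clock z T = clock z t0"
    using clock_gronwall t0 zero by metis
  then show False using t0 T by simp
qed

lemma continuous_on_along_ray:
  fixes f :: "torus \<Rightarrow> real"
  assumes unb: "filterlim (clock z) at_top at_top" and f: "continuous_on UNIV f"
  shows "continuous_on {0..} (\<lambda>u. f (abs_torus (ray z u)) / lift (ray z u))"
proof (intro continuous_on_divide)
  have ray: "continuous_on {0..} (ray z)" by (intro continuous_intros)
  show "continuous_on {0..} (\<lambda>u. f (abs_torus (ray z u)))"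
    by (intro continuous_on_compose2[OF f] continuous_on_compose2[OF continuous_on_abs_torus[of UNIV]] ray) auto
  show "continuous_on {0..} (\<lambda>u. lift (ray z u))"
    by (rule continuous_on_compose2[OF continuous_lift[of UNIV] ray]) auto
qed (use clock_unbounded_lift_pos[OF unb] in force)

text \<open>A bounded clock is monotone and converges. If the speed at the limit were positive, the
  clock would advance at a definite rate and exceed its bound.\<close>

lemma clock_cases:
  assumes "\<not> filterlim (clock z) at_top at_top"
  obtains l where "l \<ge> 0" "(clock z \<longlongrightarrow> l) at_top" "lift (ray z l) = 0"
proof -
  obtain Z where Z: "\<not> eventually (\<lambda>t. clock z t \<ge> Z) at_top"
    using assms by (auto simp: filterlim_at_top)
  have bd: "clock z t < Z" for t
  proof (rule ccontr)
    assume "\<not> clock z t < Z"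
    then have "eventually (\<lambda>t'. clock z t' \<ge> Z) at_top"
      unfolding eventually_at_top_linorder by (metis clock_mono dual_order.trans linorder_not_less)
    then show False using Z by blast
  qed
  define l where "l = (SUP t. clock z t)"
  have bdd: "bdd_above (range (clock z))" by (rule bdd_aboveI[of _ Z]) (use bd less_imp_le in auto)
  have lim: "(clock z \<longlongrightarrow> l) at_top"
  proof (rule order_tendstoI)
    fix a assume "a < l"
    then obtain t where "a < clock z t" unfolding l_def using less_cSUP_iff[OF _ bdd] by auto
    then show "eventually (\<lambda>t. a < clock z t) at_top"
      unfolding eventually_at_top_linorder by (metis clock_mono less_le_trans)
  next
    fix a assume "l < a"
    have "clock z t \<le> l" for t unfolding l_def by (rule cSUP_upper[OF _ bdd]) simp
    then show "eventually (\<lambda>t. clock z t < a) at_top" using \<open>l < a\<close> by (auto intro: le_less_trans always_eventually)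
  qed
  have "l \<ge> 0" using cSUP_upper[OF _ bdd, of 0] by (simp add: l_def clock_0)
  define c where "c = lift (ray z l)"
  have "((\<lambda>t. ray z (clock z t)) \<longlongrightarrow> ray z l) at_top"
    by (intro tendsto_intros lim)
  then have lim': "((\<lambda>t. lift (ray z (clock z t))) \<longlongrightarrow> c) at_top"
    unfolding c_def using continuous_lift[of UNIV]
    by (intro isCont_tendsto_compose[of _ lift]) (auto simp: continuous_on_eq_continuous_at)
  have "c = 0"
  proof (rule ccontr)
    assume "c \<noteq> 0"
    then have c: "c > 0" using lift_nonneg[of "ray z l"] by (simp add: c_def)
    then have "eventually (\<lambda>t. lift (ray z (clock z t)) > c / 2) at_top"
      by (intro order_tendstoD(1)[OF lim']) simp
    then obtain T where T: "\<And>t. t \<ge> T \<Longrightarrow> lift (ray z (clock z t)) > c / 2"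
      by (auto simp: eventually_at_top_linorder)
    \<comment> \<open>At speed above \<open>c / 2\<close> the clock gains more than
      \<open>Z - clock z T\<close> by this time.\<close>
    define t where "t = T + 2 * (Z - clock z T) / c + 1"
    have "T < t" using bd[of T] c by (simp add: t_def add_nonneg_pos)
    from MVT2[OF this clock_deriv] obtain \<xi> where \<xi>: "T < \<xi>"
      "clock z t - clock z T = (t - T) * lift (ray z (clock z \<xi>))" by blast
    have "(t - T) * (c / 2) \<le> clock z t - clock z T"
      unfolding \<xi>(2) using T[of \<xi>] \<xi>(1) \<open>T < t\<close> by (intro mult_left_mono) auto
    moreover have "(t - T) * (c / 2) = (Z - clock z T) + c / 2" using c by (simp add: t_def field_simps)
    ultimately show False using bd[of t] c by simp
  qed
  then show ?thesis using that[OF \<open>l \<ge> 0\<close> lim] by (simp add: c_def)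
qed

text \<open>The substitution \<open>u = clock z s\<close>, whose derivative is the speed, turns an
  integral over the time of the flow into one over linear time.\<close>

lemma integral_along_orbit:
  assumes unb: "filterlim (clock z) at_top at_top"
    and E: "\<And>u. u \<ge> 0 \<Longrightarrow> (E has_real_derivative f (abs_torus (ray z u)) / lift (ray z u)) (at u)"
    and t: "t \<ge> 0"
  shows "integral {0..t} (\<lambda>s. f (\<Phi> s (abs_torus z))) = E (clock z t) - E 0"
proof -
  have "((\<lambda>s. f (\<Phi> s (abs_torus z))) has_integral E (clock z t) - E (clock z 0)) {0..t}"
  proof (rule fundamental_theorem_of_calculus[OF t])
    fix s assume s: "s \<in> {0..t}"
    then have "clock z s \<ge> 0" using clock_mono[of 0 s z] by (simp add: clock_0)
    note DERIV_chain2[OF E[OF this] clock_deriv[of z s]]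
    moreover have "lift (ray z (clock z s)) > 0"
      by (rule clock_unbounded_lift_pos[OF unb \<open>clock z s \<ge> 0\<close>])
    ultimately have "((\<lambda>s. E (clock z s)) has_real_derivative f (\<Phi> s (abs_torus z))) (at s)"
      by (simp add: flow_clock)
    then show "((\<lambda>s. E (clock z s)) has_vector_derivative f (\<Phi> s (abs_torus z))) (at s within {0..t})"
      by (simp add: has_real_derivative_iff_has_vector_derivative[symmetric] has_field_derivative_at_within)
  qed
  then show ?thesis by (simp add: integral_unique clock_0)
qed

end

section \<open>Time averages\<close>

locale same_orbit_flow = stopped_linear_flow \<alpha> p q \<phi> \<Phi> + log_summable_rotation \<alpha> a
  for \<alpha> :: real and a :: "nat \<Rightarrow> int" and p q :: torus and \<phi> :: "torus \<Rightarrow> real" and \<Phi> :: "real \<Rightarrow> torus \<Rightarrow> torus" +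
  assumes same_orbit: "same_linear_orbit \<alpha> p q"
begin

definition time_average :: "(torus \<Rightarrow> real) \<Rightarrow> real \<Rightarrow> torus \<Rightarrow> real" where
  "time_average f t x = integral {0..t} (\<lambda>s. f (\<Phi> s x)) / t"

definition P :: "real^2" where "P = rep_torus p"

definition r :: real where "r = (SOME r. q = p + abs_torus (r *\<^sub>R linear_field \<alpha>))"

text \<open>The lift of \<open>q\<close> on the line through \<open>P\<close>. A line then has the
  same transverse offset with respect to both, and the two parametrizations differ by the shift
  \<open>r\<close>.\<close>

definition Q :: "real^2" where "Q = P + r *\<^sub>R linear_field \<alpha>"

lemma abs_P: "abs_torus P = p"
  by (simp add: P_def)

lemma abs_Q: "abs_torus Q = q"
proof -
  have "q = p + abs_torus (r *\<^sub>R linear_field \<alpha>)"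
    using same_orbit unfolding same_linear_orbit_def r_def by (rule someI_ex)
  also have "\<dots> = abs_torus Q" by (simp only: Q_def plus_torus.abs_eq[symmetric] abs_P)
  finally show ?thesis by (rule sym)
qed

lemma phi_abs_C2: "C_k 2 (\<lambda>z. \<phi> (abs_torus z))"
  using lift_C2 unfolding lift_def[abs_def] .

lemma stop_point_p:
  assumes "torus_cutoff p q \<psi>"
  shows "stop_point \<phi> P q \<psi>"
proof (rule stop_point.intro)
  show "\<phi> (abs_torus P) = 0" by (simp add: abs_P phi_p)
  show "x = abs_torus P \<or> x = q" if "\<phi> x = 0" for x using phi_eq_0[OF that] by (simp add: abs_P)
  show "positive_definite (torus_hessian \<phi> (abs_torus P))" by (simp add: abs_P hess_p)
  show "\<exists>U. open U \<and> abs_torus P \<in> U \<and> (\<forall>x\<in>U. \<psi> x = 1)"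
    unfolding abs_P by (rule torus_cutoffD[OF assms])
qed (rule phi_abs_C2 phi_nonneg torus_cutoffD[OF assms])+

lemma stop_point_q:
  assumes "torus_cutoff p q \<psi>"
  shows "stop_point \<phi> Q p (\<lambda>x. 1 - \<psi> x)"
proof (rule stop_point.intro)
  show "\<phi> (abs_torus Q) = 0" by (simp add: abs_Q phi_q)
  show "x = abs_torus Q \<or> x = p" if "\<phi> x = 0" for x using phi_eq_0[OF that] by (auto simp: abs_Q)
  show "positive_definite (torus_hessian \<phi> (abs_torus Q))" by (simp add: abs_Q hess_q)
  show "continuous_on UNIV (\<lambda>x. 1 - \<psi> x)"
    by (intro continuous_on_diff continuous_on_const torus_cutoffD(1)[OF assms])
  show "0 \<le> 1 - \<psi> x" "1 - \<psi> x \<le> 1" for x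
    using torus_cutoffD(2,3)[OF assms, of x] by simp_all
  obtain U where "open U" "p \<in> U" "\<forall>x\<in>U. \<psi> x = 1" using torus_cutoffD(4)[OF assms] by (elim exE conjE)
  then show "\<exists>U. open U \<and> p \<in> U \<and> (\<forall>x\<in>U. 1 - \<psi> x = 0)" by (intro exI[of _ U]) simp
  obtain V where "open V" "q \<in> V" "\<forall>x\<in>V. \<psi> x = 0" using torus_cutoffD(5)[OF assms] by (elim exE conjE)
  then show "\<exists>V. open V \<and> abs_torus Q \<in> V \<and> (\<forall>x\<in>V. 1 - \<psi> x = 1)"
    unfolding abs_Q by (intro exI[of _ V]) simp
qed (rule phi_abs_C2 phi_nonneg)+

text \<open>Where \<open>\<bar>g\<bar> \<ge> \<epsilon>\<close> the compact torus leaves no zero of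
  \<open>\<phi>\<close>. The bound by \<open>\<phi>\<close> is useful because its integral over time
  is the advance of the clock.\<close>

lemma dominated_by_phi:
  assumes g: "continuous_on UNIV g" "g p = 0" "g q = 0" and "\<epsilon> > 0"
  shows "\<exists>C\<ge>0. \<forall>x. \<bar>g x\<bar> \<le> \<epsilon> + C * \<phi> x"
proof -
  define K where "K = {x. \<epsilon> \<le> \<bar>g x\<bar>}"
  have "closed K" unfolding K_def by (intro closed_Collect_le continuous_intros g)
  then have K: "compact K" using compact_Int_closed[OF compact_UNIV_torus] by simp
  have pos: "\<phi> x > 0" if "x \<in> K" for x
    using that g \<open>\<epsilon> > 0\<close> by (intro phi_pos) (auto simp: K_def)
  obtain M where M: "\<And>x. \<bar>g x\<bar> \<le> M"
    using compact_imp_bounded[OF compact_continuous_image[OF g(1) compact_UNIV_torus]] by (auto simp: bounded_iff)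
  have "\<exists>c>0. \<forall>x\<in>K. c \<le> \<phi> x"
  proof (cases "K = {}")
    case False
    from continuous_attains_inf[OF K False continuous_on_subset[OF continuous_phi]] show ?thesis using pos by blast
  qed (auto intro: exI[of _ 1])
  then obtain c where c: "c > 0" "\<And>x. x \<in> K \<Longrightarrow> c \<le> \<phi> x" by blast
  have M0: "M \<ge> 0" using M[of p] by simp
  show ?thesis
  proof (intro exI[of _ "M / c"] conjI allI)
    show "0 \<le> M / c" using M0 c by simp
    fix x
    show "\<bar>g x\<bar> \<le> \<epsilon> + M / c * \<phi> x"
    proof (cases "x \<in> K")
      case True
      have "M / c * c \<le> M / c * \<phi> x" using c(2)[OF True] M0 c(1) by (intro mult_left_mono) auto
      then show ?thesis using M[of x] c(1) \<open>\<epsilon> > 0\<close> by simp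
    next
      case False
      have "M / c * \<phi> x \<ge> 0" using M0 c(1) phi_nonneg by simp
      then show ?thesis using False by (simp add: K_def)
    qed
  qed
qed

definition offset :: "real^2 \<Rightarrow> real" where "offset z = z $ 1 - P $ 1"

text \<open>The transverse coordinate, constant along rays; \<open>leaf\<close> and
  \<open>offset\<close> invert \<open>line_point\<close>.\<close>

definition leaf :: "real^2 \<Rightarrow> real" where "leaf z = z $ 2 - P $ 2 - offset z * \<alpha>"

lemma line_point_leaf: "ray z u = line_point \<alpha> P (leaf z) (offset z + u)"
  by (simp add: vec_eq_iff forall_2 leaf_def offset_def linear_field_def algebra_simps)

text \<open>The time needed to travel \<open>u\<close> along the line is at least the part spent
  near \<open>p\<close>, and that part alone is superlinear in \<open>u\<close>.\<close>

lemma clock_sublinear: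
  assumes unb: "filterlim (clock z) at_top at_top"
  shows "((\<lambda>t. clock z t / t) \<longlongrightarrow> 0) at_top"
proof -
  obtain \<psi> where \<psi>: "torus_cutoff p q \<psi>" using exists_torus_cutoff[OF pq] by blast
  interpret P: stop_point \<alpha> \<phi> P q \<psi> by (rule stop_point_p[OF \<psi>])
  have pos: "lift (ray z u) > 0" if "u \<ge> 0" for u by (rule clock_unbounded_lift_pos[OF unb that])
  obtain E where E: "\<And>u. u \<ge> 0 \<Longrightarrow> (E has_real_derivative \<psi> (abs_torus (ray z u)) / lift (ray z u)) (at u)"
    using exists_antiderivative_halfline[OF continuous_on_along_ray[OF unb torus_cutoffD(1)[OF \<psi>]]] by blast
  obtain T where T: "\<And>u. u \<ge> 0 \<Longrightarrow> (T has_real_derivative 1 / lift (ray z u)) (at u)"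
    using exists_antiderivative_halfline[OF continuous_on_along_ray[OF unb continuous_on_const]] by blast
  \<comment> \<open>The origin is moved to a section ahead of the starting point, so that the
    half-line from \<open>- 1/2\<close> on belongs to the forward orbit; behind it the line may
    contain a zero of the speed.\<close>
  define j where "j = \<lceil>offset z\<rceil> + 1"
  define k where "k = of_int j - offset z"
  define y where "y = leaf z + of_int j * \<alpha>"
  have k: "k \<ge> 1" unfolding k_def j_def by linarith
  have eq: "abs_torus (line_point \<alpha> P y u) = abs_torus (ray z (u + k))" for u
  proof -
    have "abs_torus (line_point \<alpha> P y u) = abs_torus (line_point \<alpha> P (leaf z) (u + of_int j))"
      unfolding y_def by (rule abs_line_point_shift)
    also have "u + of_int j = offset z + (u + k)" by (simp add: k_def)
    finally show ?thesis by (simp only: line_point_leaf)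
  qed
  have posP: "\<phi> (abs_torus (line_point \<alpha> P y u)) > 0" if "u \<ge> - 1/2" for u
    unfolding eq using pos[of "u + k"] that k by (simp add: lift_def)
  have derP: "((\<lambda>u. E (u + k)) has_real_derivative P.slowness y u) (at u)" if "u \<ge> - 1/2" for u
    unfolding P.slowness_def eq
    using E[of "u + k"] that k by (simp add: DERIV_shift lift_def)
  have nz: "y + of_nat i * \<alpha> \<notin> \<int>" for i
  proof
    assume "y + of_nat i * \<alpha> \<in> \<int>"
    then have "abs_torus (line_point \<alpha> P y (of_nat i)) = abs_torus P"
      unfolding abs_line_point_eq_base by (simp add: add.commute)
    then show False using posP[of "of_nat i"] by (simp add: abs_P phi_p)
  qed
  have "filterlim (\<lambda>v. E (v + k) / v) at_top at_top"
    by (rule P.antiderivative_superlinear[OF posP derP rotation_sum_superlinear_cfrac[OF nz]])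
  then have "filterlim (\<lambda>u. E (u - k + k) / (u - k)) at_top at_top"
  proof (rule filterlim_compose)
    show "filterlim (\<lambda>u. u - k) at_top at_top"
      using filterlim_tendsto_add_at_top[OF tendsto_const[of "-k"] filterlim_ident] by simp
  qed
  moreover have "((\<lambda>u. (u - k) / u) \<longlongrightarrow> 1) at_top"
  proof -
    have "((\<lambda>u. 1 - k / u) \<longlongrightarrow> 1 - 0) at_top"
      by (intro tendsto_diff tendsto_const tendsto_divide_0[OF tendsto_const] filterlim_at_top_imp_at_infinity filterlim_ident)
    then have "((\<lambda>u. 1 - k / u) \<longlongrightarrow> 1) at_top" by simp
    then show ?thesis
      by (rule Lim_transform_eventually)
        (use eventually_gt_at_top[of 0] in eventually_elim, simp add: diff_divide_distrib)
  qed
  ultimately have "filterlim (\<lambda>u. (u - k) / u * (E (u - k + k) / (u - k))) at_top at_top"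
    by (intro filterlim_tendsto_pos_mult_at_top) auto
  then have Etop: "filterlim (\<lambda>u. E u / u) at_top at_top"
    by (rule filterlim_mono_eventually[OF _ order_refl order_refl])
      (use eventually_gt_at_top[of k] in eventually_elim, simp)
  have "filterlim (\<lambda>u. - E 0 / u + E u / u) at_top at_top"
    by (rule filterlim_tendsto_add_at_top[OF _ Etop])
      (rule tendsto_divide_0[OF tendsto_const filterlim_at_top_imp_at_infinity[OF filterlim_ident]])
  then have Ttop: "filterlim (\<lambda>u. (T u - T 0) / u) at_top at_top"
  proof (rule filterlim_at_top_mono)
    show "eventually (\<lambda>u. - E 0 / u + E u / u \<le> (T u - T 0) / u) at_top"
      using eventually_gt_at_top[of 0]
    proof eventually_elim
      case (elim u)
      have "T 0 - E 0 \<le> T u - E u"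
      proof (rule DERIV_nonneg_imp_nondecreasing[of 0 u "\<lambda>u. T u - E u"])
        fix x :: real assume x: "0 \<le> x"
        have "((\<lambda>u. T u - E u) has_real_derivative 1 / lift (ray z x) - \<psi> (abs_torus (ray z x)) / lift (ray z x)) (at x)"
          by (intro derivative_intros T E x)
        moreover have "\<psi> (abs_torus (ray z x)) / lift (ray z x) \<le> 1 / lift (ray z x)"
          using torus_cutoffD(3)[OF \<psi>] pos[OF x] by (intro divide_right_mono) auto
        ultimately show "\<exists>y. ((\<lambda>u. T u - E u) has_real_derivative y) (at x) \<and> 0 \<le> y"
          by (metis diff_ge_0_iff_ge)
      qed (use elim in auto)
      then have "E u - E 0 \<le> T u - T 0" by simp
      then have "(E u - E 0) / u \<le> (T u - T 0) / u" using elim by (intro divide_right_mono) auto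
      then show ?case by (simp add: diff_divide_distrib)
    qed
  qed
  have Tclock: "T (clock z t) - T 0 = t" if "t \<ge> 0" for t
    using integral_along_orbit[OF unb, of T "\<lambda>_. 1", OF T that] that by simp
  have "filterlim (\<lambda>t. (T (clock z t) - T 0) / clock z t) at_top at_top"
    by (rule filterlim_compose[OF Ttop unb])
  then have "((\<lambda>t. inverse ((T (clock z t) - T 0) / clock z t)) \<longlongrightarrow> 0) at_top"
    by (intro tendsto_inverse_0_at_top)
  then show ?thesis
    by (rule Lim_transform_eventually)
      (use eventually_ge_at_top[of 0] in eventually_elim, simp add: Tclock)
qed

text \<open>A bounded clock means convergence to a stopping point, where \<open>g\<close> is 0.
  Otherwise the integral up to time \<open>t\<close> is at most
  \<open>e / 2 * t + C * clock z t\<close>, and the clock is sublinear.\<close>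

lemma time_average_vanishing:
  assumes g: "continuous_on UNIV g" "g p = 0" "g q = 0"
  shows "((\<lambda>t. time_average g t x) \<longlongrightarrow> 0) at_top"
proof -
  obtain z where x: "x = abs_torus z" by (metis abs_rep_torus)
  show ?thesis
  proof (cases "filterlim (clock z) at_top at_top")
    case False
    then obtain l where l: "(clock z \<longlongrightarrow> l) at_top" "lift (ray z l) = 0" by (rule clock_cases)
    have "g (abs_torus (ray z l)) = 0" using l(2) phi_eq_0 g by (auto simp: lift_def)
    moreover have "((\<lambda>t. ray z (clock z t)) \<longlongrightarrow> ray z l) at_top" by (intro tendsto_intros l)
    then have "((\<lambda>t. g (abs_torus (ray z (clock z t)))) \<longlongrightarrow> g (abs_torus (ray z l))) at_top"
      using g(1)[unfolded continuous_on_torus_iff]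
      by (intro isCont_tendsto_compose[of _ "\<lambda>z. g (abs_torus z)"]) (auto simp: continuous_on_eq_continuous_at)
    ultimately have "((\<lambda>t. g (\<Phi> t x)) \<longlongrightarrow> 0) at_top" by (simp add: x flow_clock)
    then show ?thesis unfolding time_average_def
      by (intro cesaro_limit continuous_on_compose2[OF g(1) orbit_continuous]) auto
  next
    case True
    have pos: "lift (ray z u) > 0" if "u \<ge> 0" for u by (rule clock_unbounded_lift_pos[OF True that])
    obtain E where E: "\<And>u. u \<ge> 0 \<Longrightarrow> (E has_real_derivative g (abs_torus (ray z u)) / lift (ray z u)) (at u)"
      using exists_antiderivative_halfline[OF continuous_on_along_ray[OF True g(1)]] by blast
    obtain T where T: "\<And>u. u \<ge> 0 \<Longrightarrow> (T has_real_derivative 1 / lift (ray z u)) (at u)"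
      using exists_antiderivative_halfline[OF continuous_on_along_ray[OF True continuous_on_const]] by blast
    have Tclock: "T (clock z t) - T 0 = t" if "t \<ge> 0" for t
      using integral_along_orbit[OF True, of T "\<lambda>_. 1", OF T that] that by simp
    have Eclock: "E (clock z t) - E 0 = integral {0..t} (\<lambda>s. g (\<Phi> s x))" if "t \<ge> 0" for t
      using integral_along_orbit[OF True E that] by (simp add: x)
    show ?thesis
    proof (rule tendstoI)
      fix e :: real assume e: "e > 0"
      obtain C where C: "C \<ge> 0" "\<And>x. \<bar>g x\<bar> \<le> e / 2 + C * \<phi> x"
        using dominated_by_phi[OF g, of "e/2"] e by auto
      have bound: "\<bar>E u - E 0\<bar> \<le> e / 2 * (T u - T 0) + C * u" if u: "u \<ge> 0" for u
      proof -
        have g_le: "\<bar>g (abs_torus (ray z x)) / lift (ray z x)\<bar> \<le> e / 2 * (1 / lift (ray z x)) + C" if "x \<ge> 0" for x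
        proof -
          have "\<bar>g (abs_torus (ray z x)) / lift (ray z x)\<bar> = \<bar>g (abs_torus (ray z x))\<bar> / lift (ray z x)"
            using pos[OF that] by simp
          also have "\<dots> \<le> (e / 2 + C * lift (ray z x)) / lift (ray z x)"
            using C(2) pos[OF that] by (intro divide_right_mono) (auto simp: lift_def)
          also have "\<dots> = e / 2 * (1 / lift (ray z x)) + C" using pos[OF that] by (simp add: field_simps)
          finally show ?thesis .
        qed
        \<comment> \<open>The sign \<open>s\<close> provides the upper and the lower estimate of
          \<open>E u - E 0\<close> with one monotonicity argument.\<close>
        have "e / 2 * T 0 + C * 0 - s * E 0 \<le> e / 2 * T u + C * u - s * E u" if s: "s = 1 \<or> s = -1" for s :: real
        proof (rule DERIV_nonneg_imp_nondecreasing[OF u, of "\<lambda>u. e / 2 * T u + C * u - s * E u"])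
          fix x :: real assume x: "0 \<le> x"
          have "((\<lambda>u. e / 2 * T u + C * u - s * E u) has_real_derivative
              e / 2 * (1 / lift (ray z x)) + C * 1 - s * (g (abs_torus (ray z x)) / lift (ray z x))) (at x)"
            by (intro derivative_intros DERIV_cmult T E x)
          moreover have "0 \<le> e / 2 * (1 / lift (ray z x)) + C * 1 - s * (g (abs_torus (ray z x)) / lift (ray z x))"
            using g_le[OF x] s unfolding abs_le_iff by (elim disjE conjE) simp_all
          ultimately show "\<exists>y. ((\<lambda>u. e / 2 * T u + C * u - s * E u) has_real_derivative y) (at x) \<and> 0 \<le> y"
            by blast
        qed
        from this[of 1] this[of "-1"] show ?thesis by (simp add: abs_le_iff right_diff_distrib)
      qed
      have "((\<lambda>t. C * (clock z t / t)) \<longlongrightarrow> C * 0) at_top"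
        by (intro tendsto_mult tendsto_const clock_sublinear[OF True])
      then have "eventually (\<lambda>t. C * (clock z t / t) < e / 2) at_top"
        by (rule order_tendstoD) (use e in simp)
      then show "eventually (\<lambda>t. dist (time_average g t x) 0 < e) at_top"
        using eventually_gt_at_top[of 0]
      proof eventually_elim
        case (elim t)
        have c0: "clock z t \<ge> 0" using clock_mono[of 0 t z] elim by (simp add: clock_0)
        have "\<bar>integral {0..t} (\<lambda>s. g (\<Phi> s x))\<bar> \<le> e / 2 * t + C * clock z t"
          using bound[OF c0] Tclock[of t] Eclock[of t] elim by simp
        also have "\<dots> < e / 2 * t + e / 2 * t" using elim by (simp add: field_simps)
        also have "\<dots> = e * t" by simp
        finally show ?case using elim by (simp add: time_average_def pos_divide_less_eq)
      qed
    qed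
  qed
qed

text \<open>The mass of \<open>q\<close> in the limit. The determinant at \<open>p\<close> is in the
  numerator because passage times are inversely proportional to the square root of the
  determinant.\<close>

definition weight :: real where
  "weight = sqrt (det (torus_hessian \<phi> p)) / (sqrt (det (torus_hessian \<phi> p)) + sqrt (det (torus_hessian \<phi> q)))"

text \<open>\<open>MP\<close> and \<open>MQ\<close>, the times spent near \<open>p\<close> and near
  \<open>q\<close>, are asymptotic to multiples of the same sum \<open>S\<close>, since both refer
  to the offset \<open>leaf z\<close> and differ only in the shift of \<open>u\<close>. Their
  derivatives add up to \<open>1 / lift\<close>, so \<open>MP + MQ\<close> is the elapsed time up to
  a constant.\<close>

lemma time_average_generic:
  assumes \<psi>: "torus_cutoff p q \<psi>"
    and nz: "\<And>j::int. leaf z + of_int j * \<alpha> \<notin> \<int>"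
    and ratio: "(\<lambda>n. rotation_sum \<alpha> (leaf z) (Suc n) / rotation_sum \<alpha> (leaf z) n) \<longlonglongrightarrow> 1"
  shows "((\<lambda>t. time_average (\<lambda>x. 1 - \<psi> x) t (abs_torus z)) \<longlongrightarrow> weight) at_top"
proof -
  interpret P: stop_point \<alpha> \<phi> P q \<psi> by (rule stop_point_p[OF \<psi>])
  interpret Q: stop_point \<alpha> \<phi> Q p "\<lambda>x. 1 - \<psi> x" by (rule stop_point_q[OF \<psi>])
  define y where "y = leaf z"
  have QP: "line_point \<alpha> Q y u = line_point \<alpha> P y (u + r)" for u
    unfolding Q_def by (rule line_point_base_shift)
  have not_base: "abs_torus (line_point \<alpha> R y u) \<noteq> abs_torus R" for R u
  proof
    assume "abs_torus (line_point \<alpha> R y u) = abs_torus R"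
    then have "u \<in> \<int>" and u: "u * \<alpha> + y \<in> \<int>" by (simp_all add: abs_line_point_eq_base)
    then obtain j where "u = of_int j" by (auto elim: Ints_cases)
    then show False using nz[of j] u by (simp add: y_def add.commute)
  qed
  have posP: "\<phi> (abs_torus (line_point \<alpha> P y u)) > 0" for u
  proof (rule phi_pos)
    show "abs_torus (line_point \<alpha> P y u) \<noteq> p" using not_base[of P u] by (simp add: abs_P)
    show "abs_torus (line_point \<alpha> P y u) \<noteq> q" using not_base[of Q "u - r"] by (simp add: abs_Q QP)
  qed
  then have posQ: "\<phi> (abs_torus (line_point \<alpha> Q y u)) > 0" for u by (simp add: QP)
  have zP: "ray z u = line_point \<alpha> P y (u + offset z)" for u
    by (simp add: line_point_leaf y_def add.commute)
  have zQ: "ray z u = line_point \<alpha> Q y (u + (offset z - r))" for u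
    by (simp add: zP QP)
  have pos: "lift (ray z u) > 0" for u by (simp add: lift_def zP posP)
  have unb: "filterlim (clock z) at_top at_top"
  proof (rule ccontr)
    assume "\<not> filterlim (clock z) at_top at_top"
    then obtain l where "lift (ray z l) = 0" by (rule clock_cases)
    then show False using pos[of l] by simp
  qed
  have nz': "y + of_nat j * \<alpha> \<notin> \<int>" for j using nz[of "int j"] by (simp add: y_def)
  note superlinear = rotation_sum_superlinear_cfrac[OF nz']
  obtain EP where EP: "\<And>u. (EP has_real_derivative P.slowness y u) (at u)"
    using exists_antiderivative[OF P.continuous_on_slowness[OF posP]] by blast
  obtain EQ where EQ: "\<And>u. (EQ has_real_derivative Q.slowness y u) (at u)"
    using exists_antiderivative[OF Q.continuous_on_slowness[OF posQ]] by blast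
  define S where "S v = rotation_sum \<alpha> y (nat \<lfloor>v\<rfloor>)" for v :: real
  define MP where "MP u = EP (u + offset z)" for u
  define MQ where "MQ u = EQ (u + (offset z - r))" for u
  have limP: "((\<lambda>u. MP u / S u) \<longlongrightarrow> P.mass) at_top"
    unfolding MP_def S_def
    by (rule P.antiderivative_asymptotic_real[OF posP EP superlinear]) (use ratio in \<open>simp add: y_def\<close>)
  have limQ: "((\<lambda>u. MQ u / S u) \<longlongrightarrow> Q.mass) at_top"
    unfolding MQ_def S_def
    by (rule Q.antiderivative_asymptotic_real[OF posQ EQ superlinear]) (use ratio in \<open>simp add: y_def\<close>)
  have S_top: "filterlim S at_top at_top"
  proof -
    have "filterlim (\<lambda>n. rotation_sum \<alpha> y n / real n * real n) at_top sequentially"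
      by (rule filterlim_at_top_mult_at_top[OF superlinear filterlim_real_sequentially])
    then have "filterlim (rotation_sum \<alpha> y) at_top sequentially"
      by (rule filterlim_mono_eventually[OF _ order_refl order_refl])
        (use eventually_gt_at_top[of 0] in eventually_elim, simp)
    then show ?thesis unfolding S_def by (rule filterlim_compose[OF _ nat_floor_at_top])
  qed
  have derP: "(MP has_real_derivative \<psi> (abs_torus (ray z u)) / lift (ray z u)) (at u)" for u
    unfolding MP_def using EP[of "u + offset z"] by (simp add: DERIV_shift P.slowness_def zP lift_def)
  have derQ: "(MQ has_real_derivative (1 - \<psi> (abs_torus (ray z u))) / lift (ray z u)) (at u)" for u
    unfolding MQ_def using EQ[of "u + (offset z - r)"]
    by (simp add: DERIV_shift Q.slowness_def zQ lift_def)
  have derT: "((\<lambda>u. MP u + MQ u) has_real_derivative 1 / lift (ray z u)) (at u)" for u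
    using DERIV_add[OF derP derQ] by (simp add: add_divide_distrib[symmetric])
  have T: "(MP (clock z t) + MQ (clock z t)) - (MP 0 + MQ 0) = t" if "t \<ge> 0" for t
    using integral_along_orbit[OF unb, of "\<lambda>u. MP u + MQ u" "\<lambda>_. 1", OF derT that] that by simp
  have I: "MQ (clock z t) - MQ 0 = integral {0..t} (\<lambda>s. 1 - \<psi> (\<Phi> s (abs_torus z)))" if "t \<ge> 0" for t
    using integral_along_orbit[OF unb, of MQ "\<lambda>x. 1 - \<psi> x", OF derQ that] by simp
  have const: "((\<lambda>u. b / S u) \<longlongrightarrow> 0) at_top" for b
    by (rule tendsto_divide_0[OF tendsto_const filterlim_at_top_imp_at_infinity[OF S_top]])
  define ratio where "ratio u = (MQ u / S u - MQ 0 / S u) / ((MP u / S u + MQ u / S u) - (MP 0 + MQ 0) / S u)" for u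
  have "(ratio \<longlongrightarrow>
      (Q.mass - 0) / ((P.mass + Q.mass) - 0)) at_top"
    using P.mass_pos Q.mass_pos unfolding ratio_def by (intro tendsto_intros limP limQ const) simp
  then have "((\<lambda>t. ratio (clock z t)) \<longlongrightarrow>
      (Q.mass - 0) / ((P.mass + Q.mass) - 0)) at_top"
    by (rule filterlim_compose[OF _ unb])
  moreover have "(Q.mass - 0) / ((P.mass + Q.mass) - 0) = weight"
  proof -
    define a b where "a = sqrt (det (torus_hessian \<phi> p))" and "b = sqrt (det (torus_hessian \<phi> q))"
    have "a > 0" "b > 0" using P.det_pos Q.det_pos by (simp_all add: abs_P abs_Q a_def b_def)
    moreover from this have "2 * pi / a + 2 * pi / b = 2 * pi * (a + b) / (a * b)"
      by (simp add: field_simps)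
    ultimately have "(2 * pi / b - 0) / ((2 * pi / a + 2 * pi / b) - 0) = a / (a + b)"
      by simp
    then show ?thesis by (simp add: P.mass_def Q.mass_def weight_def abs_P abs_Q a_def b_def)
  qed
  ultimately have "((\<lambda>t. ratio (clock z t)) \<longlongrightarrow>
      weight) at_top" by simp
  then show ?thesis
  proof (rule Lim_transform_eventually)
    have "eventually (\<lambda>t. S (clock z t) > 0) at_top"
      using filterlim_compose[OF S_top unb] by (simp add: filterlim_at_top_dense)
    then show "eventually (\<lambda>t. ratio (clock z t) =
      time_average (\<lambda>x. 1 - \<psi> x) t (abs_torus z)) at_top"
      using eventually_ge_at_top[of 0]
    proof eventually_elim
      case (elim t)
      define s where "s = S (clock z t)"
      have s: "s > 0" using elim by (simp add: s_def)
      have "(MQ (clock z t) / s - MQ 0 / s) / ((MP (clock z t) / s + MQ (clock z t) / s) - (MP 0 + MQ 0) / s) =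
        ((MQ (clock z t) - MQ 0) / s) / (((MP (clock z t) + MQ (clock z t)) - (MP 0 + MQ 0)) / s)"
        by (simp only: add_divide_distrib diff_divide_distrib)
      also have "\<dots> = (MQ (clock z t) - MQ 0) / ((MP (clock z t) + MQ (clock z t)) - (MP 0 + MQ 0))"
        using s by simp
      also have "\<dots> = time_average (\<lambda>x. 1 - \<psi> x) t (abs_torus z)"
        unfolding T[OF elim(2)] I[OF elim(2)] time_average_def ..
      finally show ?case by (simp only: s_def ratio_def)
    qed
  qed
qed

end

section \<open>The physical measure\<close>

text \<open>Averages up to \<open>t\<close> and up to its integer part differ by at most
  \<open>1 / t\<close>. This makes membership in the basin a condition on countably many
  functions.\<close>

lemma time_average_limit_of_nat:
  fixes h :: "real \<Rightarrow> real"
  assumes cont: "continuous_on UNIV h" and range: "\<And>s. 0 \<le> h s" "\<And>s. h s \<le> 1"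
    and lim: "(\<lambda>n. integral {0..real n} h / real n) \<longlonglongrightarrow> l"
  shows "((\<lambda>t. integral {0..t} h / t) \<longlongrightarrow> l) at_top"
proof -
  have int: "h integrable_on {a..b}" for a b
    by (rule integrable_continuous_real, rule continuous_on_subset[OF cont]) auto
  define I where "I t = integral {0..t} h" for t
  have diff: "0 \<le> I t - I s \<and> I t - I s \<le> t - s" if "0 \<le> s" "s \<le> t" for s t
  proof -
    have eq: "I t - I s = integral {s..t} h"
      using Henstock_Kurzweil_Integration.integral_combine[OF that int] by (simp add: I_def)
    have "integral {s..t} h \<le> integral {s..t} (\<lambda>_. 1)"
      by (rule integral_le[OF int]) (use range in auto)
    moreover have "0 \<le> integral {s..t} h" by (rule integral_nonneg[OF int]) (use range in auto)
    ultimately show ?thesis using that by (simp add: eq)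
  qed
  have I0: "I 0 = 0" by (simp add: I_def)
  have "((\<lambda>t::real. I (real (nat \<lfloor>t\<rfloor>)) / real (nat \<lfloor>t\<rfloor>)) \<longlongrightarrow> l) at_top"
    using filterlim_compose[OF lim nat_floor_at_top] by (simp add: I_def)
  moreover have "((\<lambda>t::real. I t / t - I (real (nat \<lfloor>t\<rfloor>)) / real (nat \<lfloor>t\<rfloor>)) \<longlongrightarrow> 0) at_top"
  proof (rule Lim_null_comparison)
    show "((\<lambda>t::real. 1 / t) \<longlongrightarrow> 0) at_top"
      by (rule tendsto_divide_0[OF tendsto_const filterlim_at_top_imp_at_infinity[OF filterlim_ident]])
    show "eventually (\<lambda>t. norm (I t / t - I (real (nat \<lfloor>t\<rfloor>)) / real (nat \<lfloor>t\<rfloor>)) \<le> 1 / t) at_top"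
      using eventually_ge_at_top[of 1]
    proof eventually_elim
      case (elim t)
      define n where "n = real (nat \<lfloor>t\<rfloor>)"
      have "\<lfloor>t\<rfloor> \<ge> 1" using elim by simp
      then have n_eq: "n = of_int \<lfloor>t\<rfloor>" by (simp add: n_def)
      have n: "1 \<le> n" "n \<le> t" "t \<le> n + 1"
        using \<open>\<lfloor>t\<rfloor> \<ge> 1\<close> floor_correct[of t] unfolding n_eq by linarith+
      have d1: "0 \<le> I t - I n" "I t - I n \<le> 1" using diff[of n t] n by auto
      have d2: "0 \<le> I n" "I n \<le> n" using diff[of 0 n] n I0 by auto
      have "0 \<le> I n * (t - n) / n" using d2 n by simp
      moreover have "I n * (t - n) \<le> n * 1" using d2 n by (intro mult_mono) auto
      then have "I n * (t - n) / n \<le> 1" using n by (simp add: divide_le_eq)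
      ultimately have "\<bar>(I t - I n) - I n * (t - n) / n\<bar> \<le> 1" using d1 by linarith
      moreover have "I t / t - I n / n = ((I t - I n) - I n * (t - n) / n) / t"
        using n by (simp add: field_simps)
      ultimately show ?case using n by (simp add: n_def[symmetric] divide_right_mono)
    qed
  qed
  ultimately have "((\<lambda>t. I (real (nat \<lfloor>t\<rfloor>)) / real (nat \<lfloor>t\<rfloor>) + (I t / t - I (real (nat \<lfloor>t\<rfloor>)) / real (nat \<lfloor>t\<rfloor>))) \<longlongrightarrow> l + 0) at_top"
    by (rule tendsto_add)
  then show ?thesis by (simp add: I_def)
qed

lemma subsequence_avoiding_limit:
  fixes A :: "real \<Rightarrow> real"
  assumes range: "\<And>t. t \<ge> 1 \<Longrightarrow> A t \<in> {0..1}" and "\<not> (A \<longlongrightarrow> l) at_top"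
  obtains t :: "nat \<Rightarrow> real" and v where "filterlim t at_top sequentially" "v \<in> {0..1}" "v \<noteq> l"
    "(\<lambda>n. A (t n)) \<longlonglongrightarrow> v"
proof -
  obtain e where e: "e > 0" "\<not> eventually (\<lambda>t. dist (A t) l < e) at_top"
    using assms(2) unfolding tendsto_iff by blast
  then have "\<exists>t\<ge>real n + 1. e \<le> dist (A t) l" for n :: nat
    unfolding eventually_at_top_linorder by (meson linorder_not_less)
  then obtain s where s: "\<And>n. s n \<ge> real n + 1" "\<And>n. e \<le> dist (A (s n)) l" by metis
  have "A (s n) \<in> {0..1}" for n
  proof (rule range)
    show "1 \<le> s n" using s(1)[of n] by linarith
  qed
  then obtain v \<sigma> where v: "v \<in> {0..1}" "strict_mono \<sigma>" "((\<lambda>n. A (s n)) \<circ> \<sigma>) \<longlonglongrightarrow> v"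
    using compact_imp_seq_compact[OF compact_Icc[of 0 "1::real"]] unfolding seq_compact_def by metis
  show ?thesis
  proof (rule that[of "\<lambda>n. s (\<sigma> n)" v])
    show "filterlim (\<lambda>n. s (\<sigma> n)) at_top sequentially"
    proof (rule filterlim_at_top_mono[OF filterlim_real_sequentially])
      show "eventually (\<lambda>n. real n \<le> s (\<sigma> n)) sequentially"
        using s(1) seq_suble[OF v(2)] by (intro always_eventually allI) (smt (verit) of_nat_le_iff)
    qed
    have "e \<le> dist v l"
      by (rule tendsto_lowerbound[OF tendsto_dist[OF v(3) tendsto_const]]) (use s(2) in auto)
    then show "v \<noteq> l" using e(1) by auto
  qed (use v in \<open>simp_all add: o_def\<close>)
qed

context same_orbit_flow
begin

lemma orbit_function_continuous:
  fixes f :: "torus \<Rightarrow> real"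
  shows "continuous_on UNIV f \<Longrightarrow> continuous_on UNIV (\<lambda>s. f (\<Phi> s x))"
  by (rule continuous_on_compose2[OF _ orbit_continuous]) auto

lemma integral_empirical_eq_time_average:
  "continuous_on UNIV f \<Longrightarrow> t > 0 \<Longrightarrow> (\<integral>y. f y \<partial>empirical_measure \<Phi> t x) = time_average f t x"
  by (simp add: integral_empirical_measure[where \<Phi>=\<Phi>, OF orbit_continuous] time_average_def)

text \<open>On a bounded time interval \<open>clock_gronwall\<close> gives continuity in
  \<open>z\<close> uniformly in time, hence joint continuity of the clock; an integral with a
  parameter is then continuous.\<close>

lemma time_average_continuous:
  fixes f :: "torus \<Rightarrow> real"
  assumes f: "continuous_on UNIV f"
  shows "continuous_on UNIV (\<lambda>x. time_average f (real n) x)"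
proof -
  obtain K where K: "K \<ge> 0" "\<And>z z' t. t \<ge> 0 \<Longrightarrow> \<bar>clock z t - clock z' t\<bar> \<le> norm (z - z') * exp (K * t)"
    by (metis clock_gronwall)
  let ?S = "(UNIV :: (real^2) set) \<times> {0..real n}"
  have "continuous_on ?S (\<lambda>w. clock (fst w) (snd w))"
    unfolding continuous_on_def
  proof
    fix w0 :: "(real^2) \<times> real" assume "w0 \<in> ?S"
    then have w0: "0 \<le> snd w0" "snd w0 \<le> real n" by auto
    define g where "g w = norm (fst w - fst w0) * exp (K * real n) + \<bar>clock (fst w0) (snd w) - clock (fst w0) (snd w0)\<bar>" for w
    have "((\<lambda>w. clock (fst w) (snd w) - clock (fst w0) (snd w0)) \<longlongrightarrow> 0) (at w0 within ?S)"
    proof (rule Lim_null_comparison)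
      have "((\<lambda>w. clock (fst w0) (snd w)) \<longlongrightarrow> clock (fst w0) (snd w0)) (at w0 within ?S)"
        using continuous_clock[of "fst w0"]
        by (intro isCont_tendsto_compose[of _ "clock (fst w0)"] tendsto_intros) (auto simp: continuous_on_eq_continuous_at)
      then have "(g \<longlongrightarrow> norm (fst w0 - fst w0) * exp (K * real n) + \<bar>clock (fst w0) (snd w0) - clock (fst w0) (snd w0)\<bar>) (at w0 within ?S)"
        unfolding g_def by (intro tendsto_intros)
      then show "(g \<longlongrightarrow> 0) (at w0 within ?S)" by simp
      show "eventually (\<lambda>w. norm (clock (fst w) (snd w) - clock (fst w0) (snd w0)) \<le> g w) (at w0 within ?S)"
        unfolding eventually_at_filter
      proof (intro always_eventually allI impI)
        fix w assume "w \<in> ?S"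
        then have w: "0 \<le> snd w" "snd w \<le> real n" by auto
        have "\<bar>clock (fst w) (snd w) - clock (fst w0) (snd w)\<bar> \<le> norm (fst w - fst w0) * exp (K * snd w)"
          by (rule K(2)[OF w(1)])
        also have "\<dots> \<le> norm (fst w - fst w0) * exp (K * real n)"
          using w K(1) by (intro mult_left_mono) (auto intro: mult_left_mono)
        finally show "norm (clock (fst w) (snd w) - clock (fst w0) (snd w0)) \<le> g w"
          unfolding g_def by simp
      qed
    qed
    then show "((\<lambda>w. clock (fst w) (snd w)) \<longlongrightarrow> clock (fst w0) (snd w0)) (at w0 within ?S)"
      by (rule LIM_zero_cancel)
  qed
  then have "continuous_on ?S (\<lambda>w. fst w + clock (fst w) (snd w) *\<^sub>R linear_field \<alpha>)"
    by (intro continuous_intros)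
  then have "continuous_on ?S (\<lambda>w. f (abs_torus (fst w + clock (fst w) (snd w) *\<^sub>R linear_field \<alpha>)))"
    by (rule continuous_on_compose2[OF f[unfolded continuous_on_torus_iff]]) auto
  then have "continuous_on (UNIV \<times> cbox 0 (real n)) (\<lambda>(z, t). f (\<Phi> t (abs_torus z)))"
    by (simp add: flow_clock case_prod_beta)
  then have "continuous_on UNIV (\<lambda>z. integral (cbox 0 (real n)) (\<lambda>t. f (\<Phi> t (abs_torus z))))"
    by (rule integral_continuous_on_param)
  then show ?thesis
    unfolding continuous_on_torus_iff time_average_def
    by (cases "n = 0") (auto intro!: continuous_intros)
qed

context
  fixes \<psi> :: "torus \<Rightarrow> real"
  assumes \<psi>: "torus_cutoff p q \<psi>"
begin

lemma one_minus_cutoff_continuous: "continuous_on UNIV (\<lambda>x. 1 - \<psi> x)"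
  by (intro continuous_on_diff continuous_on_const torus_cutoffD(1)[OF \<psi>])

lemma time_average_range:
  assumes "t > 0"
  shows "time_average (\<lambda>x. 1 - \<psi> x) t x \<in> {0..1}"
proof -
  have int: "(\<lambda>s. 1 - \<psi> (\<Phi> s x)) integrable_on {0..t}"
    by (rule integrable_continuous_real, rule continuous_on_subset[OF orbit_function_continuous[OF one_minus_cutoff_continuous]]) auto
  have "integral {0..t} (\<lambda>s. 1 - \<psi> (\<Phi> s x)) \<le> integral {0..t} (\<lambda>_. 1)"
    by (rule integral_le[OF int]) (use torus_cutoffD(2)[OF \<psi>] in auto)
  moreover have "0 \<le> integral {0..t} (\<lambda>s. 1 - \<psi> (\<Phi> s x))"
    by (rule integral_nonneg[OF int]) (use torus_cutoffD(3)[OF \<psi>] in auto)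
  ultimately show ?thesis using assms by (simp add: time_average_def)
qed

lemma cutoff_p: "\<psi> p = 1" and cutoff_q: "\<psi> q = 0"
  using torus_cutoffD(4,5)[OF \<psi>] by blast+

text \<open>Subtracting from \<open>f\<close> the combination of 1 and \<open>1 - \<psi>\<close>
  with the same values at \<open>p\<close> and \<open>q\<close> leaves a function whose averages
  vanish in the limit.\<close>

lemma time_average_two_point:
  assumes f: "continuous_on UNIV f" and t: "filterlim t at_top F"
    and lim: "((\<lambda>n. time_average (\<lambda>x. 1 - \<psi> x) (t n) x) \<longlongrightarrow> v) F"
  shows "((\<lambda>n. \<integral>y. f y \<partial>empirical_measure \<Phi> (t n) x) \<longlongrightarrow> (1 - v) * f p + v * f q) F"
proof -
  define g where "g x = f x - f p - (f q - f p) * (1 - \<psi> x)" for x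
  have g: "continuous_on UNIV g"
    unfolding g_def by (intro continuous_on_diff continuous_on_mult continuous_on_const f torus_cutoffD(1)[OF \<psi>])
  have "((\<lambda>t. time_average g t x) \<longlongrightarrow> 0) at_top"
    by (rule time_average_vanishing[OF g]) (simp_all add: g_def cutoff_p cutoff_q)
  then have g0: "((\<lambda>n. time_average g (t n) x) \<longlongrightarrow> 0) F" by (rule filterlim_compose[OF _ t])
  have "((\<lambda>n. time_average g (t n) x + f p + (f q - f p) * time_average (\<lambda>x. 1 - \<psi> x) (t n) x) \<longlongrightarrow>
      0 + f p + (f q - f p) * v) F"
    by (intro tendsto_intros g0 lim)
  then have "((\<lambda>n. time_average g (t n) x + f p + (f q - f p) * time_average (\<lambda>x. 1 - \<psi> x) (t n) x) \<longlongrightarrow>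
      (1 - v) * f p + v * f q) F" by (simp add: algebra_simps)
  then show ?thesis
  proof (rule Lim_transform_eventually)
    have "eventually (\<lambda>n. t n > 0) F" using t by (simp add: filterlim_at_top_dense)
    then show "eventually (\<lambda>n. time_average g (t n) x + f p + (f q - f p) * time_average (\<lambda>x. 1 - \<psi> x) (t n) x =
        (\<integral>y. f y \<partial>empirical_measure \<Phi> (t n) x)) F"
    proof eventually_elim
      case (elim n)
      have int: "(\<lambda>s. h (\<Phi> s x)) integrable_on {0..t n}" if "continuous_on UNIV h" for h :: "torus \<Rightarrow> real"
        by (rule integrable_continuous_real, rule continuous_on_subset[OF orbit_function_continuous[OF that]]) auto
      have "integral {0..t n} (\<lambda>s. f (\<Phi> s x)) =
          integral {0..t n} (\<lambda>s. g (\<Phi> s x) + (f p + (f q - f p) * (1 - \<psi> (\<Phi> s x))))"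
        by (simp add: g_def)
      also have "\<dots> = integral {0..t n} (\<lambda>s. g (\<Phi> s x)) + integral {0..t n} (\<lambda>s. f p + (f q - f p) * (1 - \<psi> (\<Phi> s x)))"
        by (intro Henstock_Kurzweil_Integration.integral_add int[OF g] integrable_add integrable_on_mult_right int[OF one_minus_cutoff_continuous]) auto
      also have "integral {0..t n} (\<lambda>s. f p + (f q - f p) * (1 - \<psi> (\<Phi> s x))) =
          integral {0..t n} (\<lambda>s. f p) + integral {0..t n} (\<lambda>s. (f q - f p) * (1 - \<psi> (\<Phi> s x)))"
        by (intro Henstock_Kurzweil_Integration.integral_add integrable_on_mult_right int[OF one_minus_cutoff_continuous]) auto
      also have "integral {0..t n} (\<lambda>s. (f q - f p) * (1 - \<psi> (\<Phi> s x))) = (f q - f p) * integral {0..t n} (\<lambda>s. 1 - \<psi> (\<Phi> s x))"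
        by (rule integral_mult_right)
      finally have "time_average f (t n) x = time_average g (t n) x + f p + (f q - f p) * time_average (\<lambda>x. 1 - \<psi> x) (t n) x"
        using elim by (simp add: time_average_def add_divide_distrib)
      then show ?case using integral_empirical_eq_time_average[OF f elim] by simp
    qed
  qed
qed

lemma weight_range: "0 < weight" "weight < 1"
proof -
  interpret P: stop_point \<alpha> \<phi> P q \<psi> by (rule stop_point_p[OF \<psi>])
  interpret Q: stop_point \<alpha> \<phi> Q p "\<lambda>x. 1 - \<psi> x" by (rule stop_point_q[OF \<psi>])
  have "sqrt (det (torus_hessian \<phi> p)) > 0" "sqrt (det (torus_hessian \<phi> q)) > 0"
    using P.det_pos Q.det_pos by (simp_all add: abs_P abs_Q)
  then show "0 < weight" "weight < 1" by (simp_all add: weight_def add_pos_pos)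
qed

lemma mu_infinity_eq: "mu_infinity \<phi> p q = two_point_measure (1 - weight) p weight q"
proof -
  interpret P: stop_point \<alpha> \<phi> P q \<psi> by (rule stop_point_p[OF \<psi>])
  have "sqrt (det (torus_hessian \<phi> p)) > 0" using P.det_pos by (simp add: abs_P)
  moreover have "sqrt (det (torus_hessian \<phi> q)) > 0"
  proof -
    interpret Q: stop_point \<alpha> \<phi> Q p "\<lambda>x. 1 - \<psi> x" by (rule stop_point_q[OF \<psi>])
    show ?thesis using Q.det_pos by (simp add: abs_Q)
  qed
  moreover have one_minus_ratio: "1 - a / (a + b) = b / (a + b)" if "a > 0" "b > 0" for a b :: real
    using that by (simp add: field_simps)
  ultimately have "1 - weight = sqrt (det (torus_hessian \<phi> q)) / (sqrt (det (torus_hessian \<phi> p)) + sqrt (det (torus_hessian \<phi> q)))"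
    unfolding weight_def using one_minus_ratio by blast
  then show ?thesis by (simp add: mu_infinity_def Let_def weight_def)
qed

text \<open>The limits of the empirical measures of \<open>x\<close> are convex combinations of the two point masses, so the
  average of \<open>1 - \<psi>\<close>, which is the weight of \<open>q\<close>, determines them.\<close>

lemma mem_basin_iff:
  "x \<in> basin \<Phi> (mu_infinity \<phi> p q) \<longleftrightarrow> ((\<lambda>t. time_average (\<lambda>x. 1 - \<psi> x) t x) \<longlongrightarrow> weight) at_top"
proof
  assume lim: "((\<lambda>t. time_average (\<lambda>x. 1 - \<psi> x) t x) \<longlongrightarrow> weight) at_top"
  have w: "0 \<le> 1 - weight" "0 \<le> weight" "1 - weight + weight = 1" using weight_range by auto
  have in_bpm: "mu_infinity \<phi> p q \<in> borel_prob_measures"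
    unfolding mu_infinity_eq by (rule two_point_measure_in[OF w])
  have conv: "((\<lambda>t. \<integral>y. f y \<partial>empirical_measure \<Phi> t x) \<longlongrightarrow> (1 - weight) * f p + weight * f q) at_top"
    if "continuous_on UNIV f" for f
    by (rule time_average_two_point[OF that filterlim_ident lim])
  have int: "(\<integral>y. f y \<partial>mu_infinity \<phi> p q) = (1 - weight) * f p + weight * f q" if "continuous_on UNIV f" for f
    unfolding mu_infinity_eq by (rule integral_two_point_measure[OF w pq that])
  have "mu_infinity \<phi> p q \<in> p_omega \<Phi> x"
    by (rule p_omega_memberI[OF in_bpm orbit_continuous filterlim_ident]) (simp_all add: int conv)
  moreover have "\<nu> = mu_infinity \<phi> p q" if \<nu>: "\<nu> \<in> p_omega \<Phi> x" for \<nu>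
  proof -
    have *: "prob_space \<nu>" "sets \<nu> = sets borel"
      using p_omega_subset[of \<Phi> x] \<nu> by (auto simp: borel_prob_measures_def)
    have int': "(\<integral>y. f y \<partial>\<nu>) = (1 - weight) * f p + weight * f q" if "continuous_on UNIV f" for f :: "torus \<Rightarrow> real"
      by (rule p_omega_integral[OF \<nu> that conv[OF that]])
    have "measure \<nu> {p} = 1 - weight"
      by (rule measure_singleton_of_integrals[OF * int' pq])
    moreover have "measure \<nu> {q} = weight"
    proof (rule measure_singleton_of_integrals[OF *])
      show "(\<integral>y. f y \<partial>\<nu>) = weight * f q + (1 - weight) * f p" if "continuous_on UNIV f" for f :: "torus \<Rightarrow> real"
        using int'[OF that] by simp
    qed (use pq in simp)
    ultimately show ?thesis
      unfolding mu_infinity_eq by (intro prob_space_eq_two_point_measure[OF * pq]) auto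
  qed
  ultimately show "x \<in> basin \<Phi> (mu_infinity \<phi> p q)" unfolding basin_def by blast
next
  assume x: "x \<in> basin \<Phi> (mu_infinity \<phi> p q)"
  show "((\<lambda>t. time_average (\<lambda>x. 1 - \<psi> x) t x) \<longlongrightarrow> weight) at_top"
  proof (rule ccontr)
    have rng: "time_average (\<lambda>x. 1 - \<psi> x) t x \<in> {0..1}" if "t \<ge> 1" for t
      by (rule time_average_range) (use that in simp)
    assume not: "\<not> ((\<lambda>t. time_average (\<lambda>x. 1 - \<psi> x) t x) \<longlongrightarrow> weight) at_top"
    \<comment> \<open>By compactness of the unit interval the averages accumulate at another value
      \<open>v\<close>. Along these times the empirical measures converge to a two-point measure
      different from \<open>mu_infinity\<close>.\<close>
    obtain t :: "nat \<Rightarrow> real" and v where tv: "filterlim t at_top sequentially" "v \<in> {0..1}" "v \<noteq> weight"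
      "(\<lambda>n. time_average (\<lambda>x. 1 - \<psi> x) (t n) x) \<longlonglongrightarrow> v"
      by (rule subsequence_avoiding_limit[OF rng not])
    have v: "0 \<le> 1 - v" "0 \<le> v" "1 - v + v = 1" using tv(2) by auto
    let ?\<nu> = "two_point_measure (1 - v) p v q"
    have "?\<nu> \<in> p_omega \<Phi> x"
    proof (rule p_omega_memberI[OF two_point_measure_in[OF v] orbit_continuous tv(1)])
      fix f :: "torus \<Rightarrow> real" assume f: "continuous_on UNIV f"
      show "(\<lambda>n. \<integral>y. f y \<partial>empirical_measure \<Phi> (t n) x) \<longlonglongrightarrow> (\<integral>x. f x \<partial>?\<nu>)"
        unfolding integral_two_point_measure[OF v pq f] by (rule time_average_two_point[OF f tv(1,4)])
    qed simp
    then have "?\<nu> = mu_infinity \<phi> p q" using x by (simp add: basin_def)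
    then have "(\<integral>x. 1 - \<psi> x \<partial>?\<nu>) = (\<integral>x. 1 - \<psi> x \<partial>two_point_measure (1 - weight) p weight q)"
      by (simp add: mu_infinity_eq)
    moreover have "0 \<le> 1 - weight" "0 \<le> weight" "1 - weight + weight = 1" using weight_range by auto
    ultimately have "v = weight"
      using integral_two_point_measure[OF v pq one_minus_cutoff_continuous]
        integral_two_point_measure[OF _ _ _ pq one_minus_cutoff_continuous, of "1 - weight" weight]
      by (simp add: cutoff_p cutoff_q)
    then show False using tv(3) by simp
  qed
qed

text \<open>Needed because \<open>emeasure\<close> is \<open>0\<close> on non-measurable sets.\<close>

lemma basin_borel: "basin \<Phi> (mu_infinity \<phi> p q) \<in> sets borel"
proof -
  let ?A = "\<lambda>n x. time_average (\<lambda>x. 1 - \<psi> x) (real n) x"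
  have "(((\<lambda>t. time_average (\<lambda>x. 1 - \<psi> x) t x) \<longlongrightarrow> weight) at_top) \<longleftrightarrow> (\<lambda>n. ?A n x) \<longlonglongrightarrow> weight" for x
  proof
    assume "((\<lambda>t. time_average (\<lambda>x. 1 - \<psi> x) t x) \<longlongrightarrow> weight) at_top"
    then show "(\<lambda>n. ?A n x) \<longlonglongrightarrow> weight" by (rule filterlim_compose[OF _ filterlim_real_sequentially])
  next
    assume "(\<lambda>n. ?A n x) \<longlonglongrightarrow> weight"
    then show "((\<lambda>t. time_average (\<lambda>x. 1 - \<psi> x) t x) \<longlongrightarrow> weight) at_top"
      unfolding time_average_def
      by (rule time_average_limit_of_nat[OF orbit_function_continuous[OF one_minus_cutoff_continuous], rotated 2])
        (use torus_cutoffD(2,3)[OF \<psi>] in auto)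
  qed
  then have "basin \<Phi> (mu_infinity \<phi> p q) = {x \<in> space borel. (\<lambda>n. ?A n x) \<longlonglongrightarrow> weight}"
    using mem_basin_iff by auto
  also have "\<dots> \<in> sets borel"
  proof -
    have "?A n \<in> borel_measurable borel" for n
      by (rule borel_measurable_continuous_onI[OF time_average_continuous[OF one_minus_cutoff_continuous]])
    then show ?thesis by measurable
  qed
  finally show ?thesis .
qed

end

text \<open>The product of a null set of offsets with the line is null in the plane, and the
  differentiable map \<open>line_point\<close> preserves null sets.\<close>

lemma AE_leaf:
  assumes "AE y in lborel. R y"
  shows "AE z in lborel. R (leaf z)"
proof -
  obtain N where N: "N \<in> null_sets lborel" "{y. \<not> R y} \<subseteq> N"
    using assms unfolding eventually_ae_filter by auto
  have "emeasure (lborel \<Otimes>\<^sub>M lborel) (N \<times> (UNIV :: real set)) = emeasure lborel N * emeasure lborel (UNIV :: real set)"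
    using N by (intro lborel.emeasure_pair_measure_Times) auto
  also have "\<dots> = 0" using N by auto
  finally have "N \<times> (UNIV :: real set) \<in> null_sets (lborel \<Otimes>\<^sub>M lborel)"
    using N by (intro null_setsI) auto
  then have "N \<times> (UNIV :: real set) \<in> null_sets lborel" by (simp add: lborel_prod)
  then have "negligible (N \<times> (UNIV :: real set))"
    by (simp add: negligible_iff_null_sets null_sets_completionI)
  moreover have "(\<lambda>w. line_point \<alpha> P (fst w) (snd w)) differentiable_on N \<times> (UNIV :: real set)"
    unfolding line_point_def differentiable_on_def differentiable_def
    by (intro ballI exI) (auto intro!: derivative_eq_intros)
  ultimately have "negligible ((\<lambda>w. line_point \<alpha> P (fst w) (snd w)) ` (N \<times> (UNIV :: real set)))"
    by (intro negligible_differentiable_image_negligible) auto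
  moreover have "{z. \<not> R (leaf z)} \<subseteq> (\<lambda>w. line_point \<alpha> P (fst w) (snd w)) ` (N \<times> (UNIV :: real set))"
  proof
    fix z assume "z \<in> {z. \<not> R (leaf z)}"
    then have "leaf z \<in> N" using N(2) by auto
    moreover have "z = line_point \<alpha> P (leaf z) (offset z)" using line_point_leaf[of z 0] by simp
    ultimately show "z \<in> (\<lambda>w. line_point \<alpha> P (fst w) (snd w)) ` (N \<times> (UNIV :: real set))"
      by (intro image_eqI[of _ _ "(leaf z, offset z)"]) auto
  qed
  ultimately have "negligible {z. \<not> R (leaf z)}" by (rule negligible_subset)
  then have "AE z in lebesgue. R (leaf z)"
    unfolding negligible_iff_null_sets by (intro AE_I'[of "{z. \<not> R (leaf z)}"]) auto
  then show ?thesis by (simp add: AE_completion_iff)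
qed

lemma AE_basin: "AE x in torus_lebesgue. x \<in> basin \<Phi> (mu_infinity \<phi> p q)"
proof -
  obtain \<psi> where \<psi>: "torus_cutoff p q \<psi>" using exists_torus_cutoff[OF pq] by blast
  let ?D = "{z :: real^2. \<forall>i. 0 \<le> z $ i \<and> z $ i < 1}"
  have D: "?D \<in> sets borel" by measurable
  have meas: "abs_torus \<in> measurable (restrict_space lborel ?D) borel"
    by (intro measurable_restrict_space1)
      (simp add: borel_measurable_continuous_onI continuous_on_abs_torus)
  have "AE z in lborel. abs_torus z \<in> basin \<Phi> (mu_infinity \<phi> p q)"
    using AE_leaf[OF AE_rotation_sum_ratio]
  proof eventually_elim
    case (elim z)
    show ?case unfolding mem_basin_iff[OF \<psi>]
      by (rule time_average_generic[OF \<psi>]) (use elim in auto)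
  qed
  then have "AE z in restrict_space lborel ?D. abs_torus z \<in> basin \<Phi> (mu_infinity \<phi> p q)"
    using D by (subst AE_restrict_space_iff) auto
  then show ?thesis
    unfolding torus_lebesgue_def
    using basin_borel[OF \<psi>] by (subst AE_distr_iff[OF meas]) auto
qed

lemma physical_measure_mu_infinity: "physical_measure \<Phi> (mu_infinity \<phi> p q)"
proof -
  obtain \<psi> where \<psi>: "torus_cutoff p q \<psi>" using exists_torus_cutoff[OF pq] by blast
  interpret prob_space torus_lebesgue by (rule prob_space_torus_lebesgue)
  have "basin \<Phi> (mu_infinity \<phi> p q) \<in> events"
    using basin_borel[OF \<psi>] by (simp add: torus_lebesgue_def)
  then have "emeasure torus_lebesgue (basin \<Phi> (mu_infinity \<phi> p q)) = 1"
    using AE_basin by (rule emeasure_eq_1_AE)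
  moreover have "mu_infinity \<phi> p q \<in> borel_prob_measures"
    unfolding mu_infinity_eq[OF \<psi>] using weight_range[OF \<psi>] by (intro two_point_measure_in) auto
  ultimately show ?thesis by (simp add: physical_measure_def)
qed

text \<open>Basins of distinct measures are disjoint, so \<open>basin \<Phi> \<nu>\<close> would
  avoid a set of full measure. It is measurable because its \<open>emeasure\<close> is
  positive.\<close>

lemma physical_measure_unique:
  assumes "physical_measure \<Phi> \<nu>"
  shows "\<nu> = mu_infinity \<phi> p q"
proof (rule ccontr)
  assume ne: "\<nu> \<noteq> mu_infinity \<phi> p q"
  have pos: "emeasure torus_lebesgue (basin \<Phi> \<nu>) > 0" using assms by (simp add: physical_measure_def)
  then have B: "basin \<Phi> \<nu> \<in> sets torus_lebesgue"
    using emeasure_notin_sets[of "basin \<Phi> \<nu>" torus_lebesgue] by (cases "basin \<Phi> \<nu> \<in> sets torus_lebesgue") auto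
  have "AE x in torus_lebesgue. x \<notin> basin \<Phi> \<nu>"
    using AE_basin by eventually_elim (use ne in \<open>auto simp: basin_def\<close>)
  then have "basin \<Phi> \<nu> \<in> null_sets torus_lebesgue"
    using B by (simp add: AE_iff_null_sets)
  then show False using pos by auto
qed

end

theorem theorem8p1:
  fixes \<alpha> :: real and a :: "nat \<Rightarrow> int"
    and p q :: torus and \<phi> :: "torus \<Rightarrow> real" and \<Phi> :: "real \<Rightarrow> torus \<Rightarrow> torus"
  assumes "\<alpha> \<notin> \<rat>"
    and "is_cfrac_expansion a \<alpha>"
    and "eventually (\<lambda>n. a n \<ge> 2) sequentially"
    and "summable (\<lambda>n. 1 / ln (real_of_int (a n)))"
    and "reparametrized_linear_flow \<alpha> p q \<phi> \<Phi>"
    and "same_linear_orbit \<alpha> p q"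
  shows "(\<exists>!\<mu>. physical_measure \<Phi> \<mu>) \<and>
    physical_measure \<Phi> (mu_infinity \<phi> p q) \<and>
    (AE x in torus_lebesgue. x \<in> basin \<Phi> (mu_infinity \<phi> p q))"
proof -
  interpret same_orbit_flow \<alpha> a p q \<phi> \<Phi>
    by unfold_locales (fact assms)+
  show ?thesis
    using physical_measure_mu_infinity physical_measure_unique AE_basin by blast
qed

end
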